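(* For the conformal $m(e)$-flatness of a statistical manifold $M$ (of dimension $m$), the following relations hold. (i) $M$ is conjugate $m(e)$-symmetric and conformally $m(e)$-flat if and only if $M$ is a space of constant $m(e)$-curvature. (ii) A full regular minimally represented (f.r.m.) exponential family $M_e$ is always conformally $m(e)$-flat.
   Context: Einstein summation is used throughout. A statistical manifold $M=\{f(x,1,\theta)\mid\theta\in\Theta\}$ is a smooth regular family of probability densities (with respect to a $\sigma$-finite measure), where $\Theta$ is homeomorphic to $\mathbb{R}^m$ and $\theta=(\theta^1,\dots,\theta^m)$ serves as a coordinate system. With $l_1=\log f(x,1,\theta)$ and $\partial_i=\partial/\partial\theta^i$, put $$g_{ij}=E_\theta[\partial_il_1\partial_jl_1],\qquad T_{ijk}=E_\theta[\partial_il_1\partial_jl_1\partial_kl_1],\qquad \Gamma^{(\alpha)}_{ijk}=E_\theta[\partial_i\partial_jl_1\,\partial_kl_1]+\tfrac{1-\alpha}{2}T_{ijk}.$$ Here $g$ is the (positive definite) Fisher metric. One has $\Gamma^{(\alpha)}_{ijk}=\Gamma^{(0)}_{ijk}-\frac{\alpha}{2}T_{ijk}$ with $\Gamma^{(0)}$ the Levi-Civita connection of $g$. Indices are raised and lowered with $g$. The $\alpha$-Riemann-Christoffel curvature tensor is $$R_{ijk}^{(\alpha)l}=\partial_i\Gamma_{jk}^{(\alpha)l}-\partial_j\Gamma_{ik}^{(\alpha)l}+\Gamma_{ir}^{(\alpha)l}\Gamma_{jk}^{(\alpha)r}-\Gamma_{jr}^{(\alpha)l}\Gamma_{ik}^{(\alpha)r},\qquad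 R^{(\alpha)}_{ijkl}=R_{ijk}^{(\alpha)r}g_{rl},$$ and it satisfies $R^{(\alpha)}_{ijkl}=-R^{(-\alpha)}_{ijlk}$. Conformal transformation: given a smooth gauge function $\nu(\theta)>0$ and $s_k=\partial_k\log\nu$, the conformal transformation $M\mapsto\bar M$ replaces $(g,T)$ by $\bar g_{ij}=\nu g_{ij}$, $\bar T_{ijk}=\nu[T_{ijk}+g_{ij}s_k+g_{jk}s_i+g_{ki}s_j]$. Correspondingly $\bar\Gamma^{(\alpha)}_{ijk}=\bar\Gamma^{(0)}_{ijk}-\frac{\alpha}{2}\bar T_{ijk}$, where $\bar\Gamma^{(0)}$ is the Levi-Civita connection of $\bar g$, and $\bar R_{ijk}^{(\alpha)l}$ is the curvature of $\bar\Gamma^{(\alpha)}$. $M$ is conformally $m(e)$-flat (conformally mixture flat, equivalently conformally exponential flat) if there exists a gauge function $\nu(\theta)>0$ such that $\bar R_{ijk}^{(-1)l}=0$ (equivalently $\bar R_{ijk}^{(1)l}=0$). $M$ is a space of constant $m(e)$-curvature (constant mixture (exponential) curvature) if $R_{ijkl}^{(-1)}=\lambda(g_{jk}g_{il}-g_{ik}g_{jl})$ with $\lambda$ constant on $M$. $M$ is conjugate $m(e)$-symmetric if $R_{ijkl}^{(-1)}=-R_{ijlk}^{(-1)}=R_{ijkl}^{(1)}=R_{jilk}^{(-1)}$. An $m$-dimensional f.r.m. exponential family is a full regular minimally represented exponential family, with densities at time $t$ given by $f_e(x,t,\theta)=\exp\{\theta^ix_i-\psi(\theta)t\}$, $x\in\mathbb{R}^m$,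 where $\theta$ is the natural parameter and $\psi$ is a smooth convex function; the corresponding statistical manifold $M_e$ is the family at $t=1$.
   Formalization: In (i), "conformally m(e)-flat" is read locally: a gauge function exists near each point of M. With one gauge function on all of M, constant curvature does not imply flatness (e.g. normal means on a punctured sphere). Part (ii) has one global gauge function. *)

theory Defs
  imports "HOL-Analysis.Analysis"
begin

subsection \<open>Partial derivatives and smoothness\<close>

definition pd :: "'m::finite \<Rightarrow> (real^'m \<Rightarrow> real) \<Rightarrow> real^'m \<Rightarrow> real" where
  "pd i F \<theta> = frechet_derivative F (at \<theta>) (axis i 1)"

text \<open>Intended for open domains: all partial derivatives up to order \<open>n\<close> exist and are continuous.\<close>

primrec Ck_on :: "nat \<Rightarrow> (real^'m::finite) set \<Rightarrow> (real^'m \<Rightarrow> real) \<Rightarrow> bool" where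
  "Ck_on 0 U F \<longleftrightarrow> continuous_on U F"
| "Ck_on (Suc n) U F \<longleftrightarrow> F differentiable_on U \<and> (\<forall>i. Ck_on n U (pd i F))"

definition smooth_on :: "(real^'m::finite) set \<Rightarrow> (real^'m \<Rightarrow> real) \<Rightarrow> bool" where
  "smooth_on U F \<longleftrightarrow> (\<forall>n. Ck_on n U F)"


subsection \<open>Parametrized densities: Fisher metric, skewness tensor, \<open>\<alpha>\<close>-connections\<close>

text \<open>
  A family is given by a dominating measure \<open>\<mu>\<close>, a parameter domain \<open>\<Theta>\<close> and densities
  \<open>f x \<theta>\<close>. Where \<open>f x \<theta> = 0\<close> the value of the log-likelihood is irrelevant, because
  it only enters weighted by \<open>f x \<theta>\<close>.
\<close>

definition loglik :: "('x \<Rightarrow> real^'m::finite \<Rightarrow> real) \<Rightarrow> 'x \<Rightarrow> real^'m \<Rightarrow> real" where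
  "loglik f x \<theta> = ln (f x \<theta>)"

definition expect :: "'x measure \<Rightarrow> ('x \<Rightarrow> real^'m::finite \<Rightarrow> real) \<Rightarrow> real^'m \<Rightarrow> ('x \<Rightarrow> real) \<Rightarrow> real" where
  "expect \<mu> f \<theta> h = (\<integral>x. h x * f x \<theta> \<partial>\<mu>)"

definition fisher :: "'x measure \<Rightarrow> ('x \<Rightarrow> real^'m::finite \<Rightarrow> real) \<Rightarrow> real^'m \<Rightarrow> real^'m^'m" where
  "fisher \<mu> f \<theta> = (\<chi> i j. expect \<mu> f \<theta> (\<lambda>x. pd i (loglik f x) \<theta> * pd j (loglik f x) \<theta>))"

definition skew :: "'x measure \<Rightarrow> ('x \<Rightarrow> real^'m::finite \<Rightarrow> real) \<Rightarrow> 'm \<Rightarrow> 'm \<Rightarrow> 'm \<Rightarrow> real^'m \<Rightarrow> real" where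
  "skew \<mu> f i j k \<theta> =
     expect \<mu> f \<theta> (\<lambda>x. pd i (loglik f x) \<theta> * pd j (loglik f x) \<theta> * pd k (loglik f x) \<theta>)"

definition alpha_conn ::
  "'x measure \<Rightarrow> ('x \<Rightarrow> real^'m::finite \<Rightarrow> real) \<Rightarrow> real \<Rightarrow> 'm \<Rightarrow> 'm \<Rightarrow> 'm \<Rightarrow> real^'m \<Rightarrow> real" where
  "alpha_conn \<mu> f \<alpha> i j k \<theta> =
     expect \<mu> f \<theta> (\<lambda>x. pd i (pd j (loglik f x)) \<theta> * pd k (loglik f x) \<theta>)
     + (1 - \<alpha>) / 2 * skew \<mu> f i j k \<theta>"


subsection \<open>Statistical manifolds\<close>

definition diff_under_integral ::
  "'x measure \<Rightarrow> (real^'m::finite) set \<Rightarrow> ('x \<Rightarrow> real^'m \<Rightarrow> real) \<Rightarrow> bool" where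
  "diff_under_integral \<mu> \<Theta> h \<longleftrightarrow>
     (\<forall>\<theta>\<in>\<Theta>. integrable \<mu> (\<lambda>x. h x \<theta>)
        \<and> (\<lambda>\<theta>'. \<integral>x. h x \<theta>' \<partial>\<mu>) differentiable (at \<theta>)
        \<and> (\<forall>k. integrable \<mu> (\<lambda>x. pd k (h x) \<theta>)
             \<and> pd k (\<lambda>\<theta>'. \<integral>x. h x \<theta>' \<partial>\<mu>) \<theta> = (\<integral>x. pd k (h x) \<theta> \<partial>\<mu>)))"

text \<open>
  Besides being a smooth, identifiable family of densities with common support, ``regular''
  means: the expectations defining \<open>g\<close>, \<open>T\<close> and the \<open>\<alpha>\<close>-connections exist,
  \<open>g\<close> and \<open>T\<close> are smooth, \<open>g\<close> is positive definite, and differentiation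
  commutes with integration in \<open>\<integral> f\<close> and \<open>g\<^sub>i\<^sub>j\<close>. The latter is what makes
  the \<open>0\<close>-connection the Levi-Civita connection of \<open>g\<close>.
\<close>

definition statistical_manifold ::
  "'x measure \<Rightarrow> (real^'m::finite) set \<Rightarrow> ('x \<Rightarrow> real^'m \<Rightarrow> real) \<Rightarrow> bool" where
  "statistical_manifold \<mu> \<Theta> f \<longleftrightarrow>
     sigma_finite_measure \<mu> \<and> open \<Theta> \<and> \<Theta> homeomorphic (UNIV :: (real^'m) set)
   \<and> (\<forall>\<theta>\<in>\<Theta>. has_bochner_integral \<mu> (\<lambda>x. f x \<theta>) 1)
   \<and> (\<forall>x\<in>space \<mu>. (\<forall>\<theta>\<in>\<Theta>. f x \<theta> > 0) \<or> (\<forall>\<theta>\<in>\<Theta>. f x \<theta> = 0))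
   \<and> (\<forall>x\<in>space \<mu>. smooth_on \<Theta> (f x))
   \<and> (\<forall>\<theta>\<in>\<Theta>. \<forall>\<theta>'\<in>\<Theta>. (AE x in \<mu>. f x \<theta> = f x \<theta>') \<longrightarrow> \<theta> = \<theta>')
   \<and> (\<forall>\<theta>\<in>\<Theta>. \<forall>i j k.
        integrable \<mu> (\<lambda>x. pd i (loglik f x) \<theta> * pd j (loglik f x) \<theta> * pd k (loglik f x) \<theta> * f x \<theta>)
      \<and> integrable \<mu> (\<lambda>x. pd i (pd j (loglik f x)) \<theta> * pd k (loglik f x) \<theta> * f x \<theta>))
   \<and> diff_under_integral \<mu> \<Theta> f
   \<and> (\<forall>i j. diff_under_integral \<mu> \<Theta>
          (\<lambda>x \<theta>. pd i (loglik f x) \<theta> * pd j (loglik f x) \<theta> * f x \<theta>))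
   \<and> (\<forall>i j. smooth_on \<Theta> (\<lambda>\<theta>. fisher \<mu> f \<theta> $ i $ j))
   \<and> (\<forall>i j k. smooth_on \<Theta> (skew \<mu> f i j k))
   \<and> (\<forall>\<theta>\<in>\<Theta>. \<forall>v. v \<noteq> 0 \<longrightarrow> v \<bullet> (fisher \<mu> f \<theta> *v v) > 0)"


subsection \<open>Curvature\<close>

text \<open>For a metric \<open>G\<close> and a connection with lowered coefficients
  \<open>\<Gamma> i j k\<close>; \<open>raise_conn G \<Gamma> i j l\<close> has upper index \<open>l\<close>.\<close>

definition raise_conn ::
  "(real^'m::finite \<Rightarrow> real^'m^'m) \<Rightarrow> ('m \<Rightarrow> 'm \<Rightarrow> 'm \<Rightarrow> real^'m \<Rightarrow> real)
    \<Rightarrow> 'm \<Rightarrow> 'm \<Rightarrow> 'm \<Rightarrow> real^'m \<Rightarrow> real" where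
  "raise_conn G \<Gamma> i j l \<theta> = (\<Sum>r\<in>UNIV. \<Gamma> i j r \<theta> * matrix_inv (G \<theta>) $ r $ l)"

definition curv ::
  "(real^'m::finite \<Rightarrow> real^'m^'m) \<Rightarrow> ('m \<Rightarrow> 'm \<Rightarrow> 'm \<Rightarrow> real^'m \<Rightarrow> real)
    \<Rightarrow> 'm \<Rightarrow> 'm \<Rightarrow> 'm \<Rightarrow> 'm \<Rightarrow> real^'m \<Rightarrow> real" where
  "curv G \<Gamma> i j k l \<theta> =
     pd i (raise_conn G \<Gamma> j k l) \<theta> - pd j (raise_conn G \<Gamma> i k l) \<theta>
     + (\<Sum>r\<in>UNIV. raise_conn G \<Gamma> i r l \<theta> * raise_conn G \<Gamma> j k r \<theta>)
     - (\<Sum>r\<in>UNIV. raise_conn G \<Gamma> j r l \<theta> * raise_conn G \<Gamma> i k r \<theta>)"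

definition alpha_curv_lower ::
  "'x measure \<Rightarrow> ('x \<Rightarrow> real^'m::finite \<Rightarrow> real) \<Rightarrow> real
    \<Rightarrow> 'm \<Rightarrow> 'm \<Rightarrow> 'm \<Rightarrow> 'm \<Rightarrow> real^'m \<Rightarrow> real" where
  "alpha_curv_lower \<mu> f \<alpha> i j k l \<theta> =
     (\<Sum>r\<in>UNIV. curv (fisher \<mu> f) (alpha_conn \<mu> f \<alpha>) i j k r \<theta> * fisher \<mu> f \<theta> $ r $ l)"

definition const_m_curvature ::
  "'x measure \<Rightarrow> (real^'m::finite) set \<Rightarrow> ('x \<Rightarrow> real^'m \<Rightarrow> real) \<Rightarrow> bool" where
  "const_m_curvature \<mu> \<Theta> f \<longleftrightarrow>
     (\<exists>c::real. \<forall>\<theta>\<in>\<Theta>. \<forall>i j k l.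
        alpha_curv_lower \<mu> f (-1) i j k l \<theta> =
          c * (fisher \<mu> f \<theta> $ j $ k * fisher \<mu> f \<theta> $ i $ l
                - fisher \<mu> f \<theta> $ i $ k * fisher \<mu> f \<theta> $ j $ l))"

definition conjugate_m_symmetric ::
  "'x measure \<Rightarrow> (real^'m::finite) set \<Rightarrow> ('x \<Rightarrow> real^'m \<Rightarrow> real) \<Rightarrow> bool" where
  "conjugate_m_symmetric \<mu> \<Theta> f \<longleftrightarrow>
     (\<forall>\<theta>\<in>\<Theta>. \<forall>i j k l.
        alpha_curv_lower \<mu> f (-1) i j k l \<theta> = - alpha_curv_lower \<mu> f (-1) i j l k \<theta>
      \<and> - alpha_curv_lower \<mu> f (-1) i j l k \<theta> = alpha_curv_lower \<mu> f 1 i j k l \<theta>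
      \<and> alpha_curv_lower \<mu> f 1 i j k l \<theta> = alpha_curv_lower \<mu> f (-1) j i l k \<theta>)"


subsection \<open>Conformal transformations\<close>

definition levi_civita ::
  "(real^'m::finite \<Rightarrow> real^'m^'m) \<Rightarrow> 'm \<Rightarrow> 'm \<Rightarrow> 'm \<Rightarrow> real^'m \<Rightarrow> real" where
  "levi_civita G i j k \<theta> =
     (pd i (\<lambda>\<theta>'. G \<theta>' $ j $ k) \<theta> + pd j (\<lambda>\<theta>'. G \<theta>' $ i $ k) \<theta> - pd k (\<lambda>\<theta>'. G \<theta>' $ i $ j) \<theta>) / 2"

definition conf_metric ::
  "'x measure \<Rightarrow> ('x \<Rightarrow> real^'m::finite \<Rightarrow> real) \<Rightarrow> (real^'m \<Rightarrow> real) \<Rightarrow> real^'m \<Rightarrow> real^'m^'m" where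
  "conf_metric \<mu> f \<nu> \<theta> = (\<chi> i j. \<nu> \<theta> * fisher \<mu> f \<theta> $ i $ j)"

definition conf_skew ::
  "'x measure \<Rightarrow> ('x \<Rightarrow> real^'m::finite \<Rightarrow> real) \<Rightarrow> (real^'m \<Rightarrow> real)
    \<Rightarrow> 'm \<Rightarrow> 'm \<Rightarrow> 'm \<Rightarrow> real^'m \<Rightarrow> real" where
  "conf_skew \<mu> f \<nu> i j k \<theta> =
     (let g = fisher \<mu> f \<theta>; s = (\<lambda>a. pd a (\<lambda>\<theta>'. ln (\<nu> \<theta>')) \<theta>)
      in \<nu> \<theta> * (skew \<mu> f i j k \<theta> + g $ i $ j * s k + g $ j $ k * s i + g $ k $ i * s j))"

definition conf_conn ::
  "'x measure \<Rightarrow> ('x \<Rightarrow> real^'m::finite \<Rightarrow> real) \<Rightarrow> (real^'m \<Rightarrow> real) \<Rightarrow> real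
    \<Rightarrow> 'm \<Rightarrow> 'm \<Rightarrow> 'm \<Rightarrow> real^'m \<Rightarrow> real" where
  "conf_conn \<mu> f \<nu> \<alpha> i j k \<theta> =
     levi_civita (conf_metric \<mu> f \<nu>) i j k \<theta> - \<alpha> / 2 * conf_skew \<mu> f \<nu> i j k \<theta>"

definition gauge_function :: "(real^'m::finite) set \<Rightarrow> (real^'m \<Rightarrow> real) \<Rightarrow> bool" where
  "gauge_function U \<nu> \<longleftrightarrow> smooth_on U \<nu> \<and> (\<forall>\<theta>\<in>U. \<nu> \<theta> > 0)"

text \<open>A single gauge function works on all of \<open>U\<close>.\<close>

definition conformally_m_flat_on ::
  "'x measure \<Rightarrow> (real^'m::finite) set \<Rightarrow> ('x \<Rightarrow> real^'m \<Rightarrow> real) \<Rightarrow> bool" where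
  "conformally_m_flat_on \<mu> U f \<longleftrightarrow>
     (\<exists>\<nu>. gauge_function U \<nu> \<and>
        (\<forall>\<theta>\<in>U. \<forall>i j k l. curv (conf_metric \<mu> f \<nu>) (conf_conn \<mu> f \<nu> (-1)) i j k l \<theta> = 0))"

text \<open>
  Conformal flatness of a manifold is, as usual in conformal geometry, a local notion: gauge
  functions exist near every point. One gauge function on all of \<open>\<Theta>\<close> is too much to ask for in
  constant curvature: the normal family \<open>N(p(\<theta>), I)\<close> on \<open>\<real>\<^sup>3\<close>, where \<open>p\<close> is inverse
  stereographic projection of the plane onto the punctured unit sphere, has the round metric
  and \<open>T = 0\<close>, but a flattening \<open>\<nu>\<close> on all of \<open>\<real>\<^sup>2\<close> would make \<open>1 / \<nu>\<close> the restriction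
  of a linear form of \<open>\<real>\<^sup>3\<close> that is positive on the punctured sphere.
\<close>

definition conformally_m_flat ::
  "'x measure \<Rightarrow> (real^'m::finite) set \<Rightarrow> ('x \<Rightarrow> real^'m \<Rightarrow> real) \<Rightarrow> bool" where
  "conformally_m_flat \<mu> \<Theta> f \<longleftrightarrow>
     (\<forall>\<theta>\<in>\<Theta>. \<exists>U. open U \<and> \<theta> \<in> U \<and> U \<subseteq> \<Theta> \<and> conformally_m_flat_on \<mu> U f)"


subsection \<open>Exponential families\<close>

definition exp_density ::
  "(real^'m::finite \<Rightarrow> real) \<Rightarrow> real^'m \<Rightarrow> real \<Rightarrow> real^'m \<Rightarrow> real" where
  "exp_density \<psi> x t \<theta> = exp (\<theta> \<bullet> x - \<psi> \<theta> * t)"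

text \<open>
  Full regular minimally represented exponential family at time 1, with dominating measure
  \<open>\<rho>\<close>. Full: \<open>\<Theta>\<close> consists of all \<open>\<theta>\<close> for which the density can be normalized. Regular:
  \<open>\<Theta>\<close> is open. Minimal: \<open>x\<close> satisfies no affine relation almost everywhere (for the natural
  parameters this is automatic, \<open>\<Theta>\<close> being open and nonempty).
\<close>

definition frm_exponential_family ::
  "(real^'m::finite) measure \<Rightarrow> (real^'m) set \<Rightarrow> (real^'m \<Rightarrow> real) \<Rightarrow> bool" where
  "frm_exponential_family \<rho> \<Theta> \<psi> \<longleftrightarrow>
     sigma_finite_measure \<rho> \<and> sets \<rho> = sets borel
   \<and> \<Theta> \<noteq> {} \<and> open \<Theta> \<and> \<Theta> = {\<theta>. integrable \<rho> (\<lambda>x. exp (\<theta> \<bullet> x))}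
   \<and> (\<forall>c b. (AE x in \<rho>. c \<bullet> x = b) \<longrightarrow> c = 0)
   \<and> smooth_on \<Theta> \<psi> \<and> convex_on \<Theta> \<psi>
   \<and> (\<forall>\<theta>\<in>\<Theta>. has_bochner_integral \<rho> (\<lambda>x. exp_density \<psi> x 1 \<theta>) 1)"

end

theory Submission
  imports Defs
begin

text \<open>
The link between the conformal transformation and curvature is that, for \<open>\<alpha> = -1\<close>, passing from
\<open>(g, T)\<close> to the conformal transform with gauge \<open>\<nu>\<close> adds \<open>\<sigma>\<^sub>i\<delta>\<^sub>j\<^sup>l + \<sigma>\<^sub>j\<delta>\<^sub>i\<^sup>l\<close> to the raised connection
coefficients, with \<open>\<sigma> = d ln \<nu>\<close> (\<open>raise_conf_conn\<close>). This is a projective change by an exact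
1-form, and it changes the curvature by \<open>\<delta>\<^sub>j\<^sup>lP\<^sub>i\<^sub>k - \<delta>\<^sub>i\<^sup>lP\<^sub>j\<^sub>k\<close>, where
\<open>P = \<nabla>\<sigma> - \<sigma> \<otimes> \<sigma>\<close> (\<open>curv_conformal\<close>). So conformal flatness means that locally the curvature is
\<open>R\<^sub>i\<^sub>j\<^sub>k\<^sub>l = P\<^sub>j\<^sub>kg\<^sub>i\<^sub>l - P\<^sub>i\<^sub>kg\<^sub>j\<^sub>l\<close> with a tensor \<open>P\<close> of this particular form.

If moreover \<open>R\<close> is antisymmetric in \<open>k, l\<close>, a contraction with the inverse metric shows
\<open>P = \<kappa>g\<close> (\<open>umbilic_if_antisymmetric\<close>). Differentiating \<open>\<nabla>\<sigma> = \<sigma> \<otimes> \<sigma> + \<kappa>g\<close> once more and using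
that \<open>\<nabla>g\<close> is totally symmetric gives \<open>\<partial>\<^sub>j\<kappa> g\<^sub>i\<^sub>k = \<partial>\<^sub>i\<kappa> g\<^sub>j\<^sub>k\<close> (\<open>hessian_factor_derivative\<close>), so in
dimension at least two \<open>\<kappa>\<close> is locally constant, and constant because the parameter domain is
connected. In dimension one all curvatures vanish.

Conversely, let the curvature be constant, \<open>c\<close>. A gauge \<open>\<nu>\<close> with \<open>P = c * g\<close> makes the conformal
transform flat. For \<open>u = 1 / \<nu>\<close> this is the linear equation \<open>Hess u = -c * u * g\<close>, that is, an overdetermined
first-order system for \<open>(u, du)\<close>, whose integrability conditions amount to the constancy
of the curvature (\<open>hessian_system_flat\<close>). Such a system has local solutions by Frobenius' theorem
(\<open>linear_total_differential_system\<close>): Picard iterates along rays converge, and flatness implies a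
recursion for the amount by which they fail to solve the system, which therefore tends to zero.
Conjugate symmetry comes from the duality \<open>R\<^sup>-\<^sup>\<alpha>\<^sub>i\<^sub>j\<^sub>k\<^sub>l = -R\<^sup>\<alpha>\<^sub>i\<^sub>j\<^sub>l\<^sub>k\<close> (\<open>curv_lower_dual\<close>).

For an exponential family \<open>g\<close> and \<open>T\<close> are the second and third derivatives of \<open>\<psi>\<close>. The
\<open>1\<close>-connection then has zero coefficients in natural parameters, and by duality the \<open>-1\<close>-connection
is flat without any change of gauge (\<open>exp_family_flat\<close>).
\<close>

section \<open>Partial derivatives\<close>

lemma pd_eqI: "(F has_derivative D) (at \<theta>) \<Longrightarrow> pd i F \<theta> = D (axis i 1)"
  by (simp add: pd_def frechet_derivative_at[symmetric])

lemma has_derivative_pd: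
  assumes "F differentiable (at \<theta>)"
  shows "(F has_derivative (\<lambda>v. \<Sum>i\<in>UNIV. v $ i * pd i F \<theta>)) (at \<theta>)"
proof -
  have D: "(F has_derivative frechet_derivative F (at \<theta>)) (at \<theta>)"
    using assms by (simp add: frechet_derivative_works)
  have "frechet_derivative F (at \<theta>) v = (\<Sum>i\<in>UNIV. v $ i * pd i F \<theta>)" for v
  proof -
    have "frechet_derivative F (at \<theta>) v
        = frechet_derivative F (at \<theta>) (\<Sum>i\<in>UNIV. v $ i *\<^sub>R axis i 1)"
      by (simp add: basis_expansion scalar_mult_eq_scaleR[symmetric])
    also have "\<dots> = (\<Sum>i\<in>UNIV. v $ i * pd i F \<theta>)"
      using linear_frechet_derivative[OF assms]
      by (simp add: linear_sum linear_cmul pd_def)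
    finally show ?thesis .
  qed
  hence "frechet_derivative F (at \<theta>) = (\<lambda>v. \<Sum>i\<in>UNIV. v $ i * pd i F \<theta>)" ..
  with D show ?thesis by simp
qed

text \<open>
\<open>pd\<close> selects some Frechet derivative. Functions that agree near \<open>\<theta>\<close> have the same derivatives
there, hence the same selection, also at a point where they have none.
\<close>

lemma pd_cong:
  assumes "open U" "\<theta> \<in> U" "\<And>x. x \<in> U \<Longrightarrow> F x = G x"
  shows "pd i F \<theta> = pd i G \<theta>"
proof -
  have "(F has_derivative D) (at \<theta>) \<longleftrightarrow> (G has_derivative D) (at \<theta>)" for D
    using assms by (metis has_derivative_transform_within_open)
  thus ?thesis by (simp add: pd_def frechet_derivative_def)
qed

lemma pd_const [simp]: "pd i (\<lambda>_. c) \<theta> = 0"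
  by (simp add: pd_def)

lemma pd_add:
  "\<lbrakk>F differentiable (at \<theta>); G differentiable (at \<theta>)\<rbrakk>
    \<Longrightarrow> pd i (\<lambda>x. F x + G x) \<theta> = pd i F \<theta> + pd i G \<theta>"
  unfolding frechet_derivative_works
  by (subst pd_eqI, rule has_derivative_add, assumption, assumption) (simp add: pd_def)

lemma pd_diff:
  "\<lbrakk>F differentiable (at \<theta>); G differentiable (at \<theta>)\<rbrakk>
    \<Longrightarrow> pd i (\<lambda>x. F x - G x) \<theta> = pd i F \<theta> - pd i G \<theta>"
  unfolding frechet_derivative_works
  by (subst pd_eqI, rule has_derivative_diff, assumption, assumption) (simp add: pd_def)

lemma pd_mult:
  "\<lbrakk>F differentiable (at \<theta>); G differentiable (at \<theta>)\<rbrakk>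
    \<Longrightarrow> pd i (\<lambda>x. F x * G x) \<theta> = pd i F \<theta> * G \<theta> + F \<theta> * pd i G \<theta>"
  unfolding frechet_derivative_works
  by (subst pd_eqI, rule has_derivative_mult, assumption, assumption) (simp add: pd_def)

lemma pd_cmult:
  "F differentiable (at \<theta>) \<Longrightarrow> pd i (\<lambda>x. c * F x) \<theta> = c * pd i F \<theta>"
  using pd_mult[of "\<lambda>_. c" \<theta> F i] by simp

lemma pd_sum:
  assumes "\<And>r. r \<in> A \<Longrightarrow> F r differentiable (at \<theta>)"
  shows "pd i (\<lambda>x. \<Sum>r\<in>A. F r x) \<theta> = (\<Sum>r\<in>A. pd i (F r) \<theta>)"
  by (subst pd_eqI, rule has_derivative_sum, rule assms[unfolded frechet_derivative_works])
    (simp_all add: pd_def)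

lemma pd_chain:
  assumes "F differentiable (at \<theta>)" "(h has_field_derivative d) (at (F \<theta>))"
  shows "pd i (\<lambda>x. h (F x)) \<theta> = d * pd i F \<theta>"
    and "(\<lambda>x. h (F x)) differentiable (at \<theta>)"
proof -
  have "((\<lambda>x. h (F x)) has_derivative (\<lambda>v. d * frechet_derivative F (at \<theta>) v)) (at \<theta>)"
    using has_derivative_compose[of F "frechet_derivative F (at \<theta>)" \<theta> UNIV h "(*) d"] assms
    by (simp add: frechet_derivative_works has_field_derivative_def)
  thus "pd i (\<lambda>x. h (F x)) \<theta> = d * pd i F \<theta>" "(\<lambda>x. h (F x)) differentiable (at \<theta>)"
    by (auto simp: pd_eqI differentiable_def) (simp add: pd_def)
qed

lemma pd_ln:
  assumes "F differentiable (at \<theta>)" "F \<theta> > 0"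
  shows "pd i (\<lambda>x. ln (F x)) \<theta> = pd i F \<theta> / F \<theta>"
    and "(\<lambda>x. ln (F x)) differentiable (at \<theta>)"
  using pd_chain[OF assms(1) DERIV_ln[OF assms(2)]] by (simp_all add: divide_inverse mult.commute)

lemma pd_inverse:
  assumes "F differentiable (at \<theta>)" "F \<theta> \<noteq> 0"
  shows "pd i (\<lambda>x. inverse (F x)) \<theta> = - (pd i F \<theta> * (inverse (F \<theta>) * inverse (F \<theta>)))"
    and "(\<lambda>x. inverse (F x)) differentiable (at \<theta>)"
  using pd_chain[OF assms(1) DERIV_inverse[OF assms(2)]] by (simp_all add: power2_eq_square)


section \<open>Functions of class \<open>C\<^sup>k\<close> on open sets\<close>

lemma Ck_on_SucD: "Ck_on (Suc n) U F \<Longrightarrow> Ck_on n U F"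
proof (induction n arbitrary: F)
  case (Suc n)
  have "Ck_on n U (pd i F)" for i
    by (rule Suc.IH) (use Suc.prems in \<open>simp only: Ck_on.simps(2)[of "Suc n"]\<close>)
  moreover have "F differentiable_on U"
    using Suc.prems by (simp only: Ck_on.simps(2)[of "Suc n"])
  ultimately show ?case by (simp only: Ck_on.simps(2)) simp
qed (simp add: differentiable_imp_continuous_on)

lemma Ck_on_differentiable_at:
  "Ck_on (Suc n) U F \<Longrightarrow> open U \<Longrightarrow> \<theta> \<in> U \<Longrightarrow> F differentiable (at \<theta>)"
  by (simp add: differentiable_on_eq_differentiable_at)

lemma smooth_on_differentiable_at:
  "smooth_on U F \<Longrightarrow> open U \<Longrightarrow> \<theta> \<in> U \<Longrightarrow> F differentiable (at \<theta>)"
  unfolding smooth_on_def by (drule spec[of _ "Suc 0"], rule Ck_on_differentiable_at)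

lemma smooth_on_pd: "smooth_on U F \<Longrightarrow> smooth_on U (pd i F)"
  unfolding smooth_on_def
proof
  fix n assume "\<forall>n. Ck_on n U F"
  hence "Ck_on (Suc n) U F" ..
  thus "Ck_on n U (pd i F)" by simp
qed

lemma Ck_on_cong:
  assumes "open U" "\<And>x. x \<in> U \<Longrightarrow> F x = G x"
  shows "Ck_on n U F \<longleftrightarrow> Ck_on n U G"
  using assms(2)
proof (induction n arbitrary: F G)
  case 0
  thus ?case using continuous_on_cong[of U U F G] by simp
next
  case (Suc n)
  have "Ck_on n U (pd i F) \<longleftrightarrow> Ck_on n U (pd i G)" for i
    by (rule Suc.IH) (rule pd_cong[OF assms(1) _ Suc.prems])
  moreover have "(F has_derivative D) (at x) \<longleftrightarrow> (G has_derivative D) (at x)"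
    if "x \<in> U" for x D
    using assms(1) Suc.prems that by (metis has_derivative_transform_within_open)
  hence "F differentiable_on U \<longleftrightarrow> G differentiable_on U"
    using assms(1) by (simp add: differentiable_on_eq_differentiable_at differentiable_def)
  ultimately show ?case by simp
qed

lemma Ck_on_subset:
  assumes "Ck_on n U F" "V \<subseteq> U"
  shows "Ck_on n V F"
  using assms(1) by (induction n arbitrary: F)
    (auto intro: continuous_on_subset[OF _ assms(2)] differentiable_on_subset[OF _ assms(2)])

lemma Ck_on_const: "Ck_on n U (\<lambda>_. c)"
proof (induction n arbitrary: c)
  case (Suc n)
  have "pd i (\<lambda>_::real^'a. c) = (\<lambda>_. 0)" for i by (rule ext) simp
  with Suc show ?case by simp
qed simp

lemma Ck_on_add:
  assumes "open U" "Ck_on n U F" "Ck_on n U G"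
  shows "Ck_on n U (\<lambda>x. F x + G x)"
  using assms(2,3)
proof (induction n arbitrary: F G)
  case 0
  thus ?case by (simp add: continuous_on_add)
next
  case (Suc n)
  have "Ck_on n U (pd i (\<lambda>x. F x + G x)) = Ck_on n U (\<lambda>x. pd i F x + pd i G x)" for i
    by (rule Ck_on_cong[OF assms(1)])
      (rule pd_add[OF Ck_on_differentiable_at[OF Suc.prems(1) assms(1)]
            Ck_on_differentiable_at[OF Suc.prems(2) assms(1)]])
  moreover have "Ck_on n U (\<lambda>x. pd i F x + pd i G x)" for i
    by (rule Suc.IH) (use Suc.prems in simp_all)
  moreover have "(\<lambda>x. F x + G x) differentiable_on U"
    by (rule differentiable_on_add) (use Suc.prems in simp_all)
  ultimately show ?case by (simp only: Ck_on.simps) simp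
qed

lemma Ck_on_mult:
  assumes "open U" "Ck_on n U F" "Ck_on n U G"
  shows "Ck_on n U (\<lambda>x. F x * G x)"
  using assms(2,3)
proof (induction n arbitrary: F G)
  case 0
  thus ?case by (simp add: continuous_on_mult)
next
  case (Suc n)
  have "Ck_on n U (pd i (\<lambda>x. F x * G x))
      = Ck_on n U (\<lambda>x. pd i F x * G x + F x * pd i G x)" for i
    by (rule Ck_on_cong[OF assms(1)])
      (rule pd_mult[OF Ck_on_differentiable_at[OF Suc.prems(1) assms(1)]
            Ck_on_differentiable_at[OF Suc.prems(2) assms(1)]])
  moreover have "Ck_on n U (\<lambda>x. pd i F x * G x + F x * pd i G x)" for i
    by (rule Ck_on_add[OF assms(1) Suc.IH[OF _ Ck_on_SucD] Suc.IH[OF Ck_on_SucD]])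
      (use Suc.prems in simp_all)
  moreover have "(\<lambda>x. F x * G x) differentiable_on U"
    by (rule differentiable_on_mult) (use Suc.prems in simp_all)
  ultimately show ?case by (simp only: Ck_on.simps) simp
qed

lemma Ck_on_sum:
  assumes "open U" "\<And>r. r \<in> A \<Longrightarrow> Ck_on n U (F r)"
  shows "Ck_on n U (\<lambda>x. \<Sum>r\<in>A. F r x)"
  using assms(2)
proof (induction A rule: infinite_finite_induct)
  case (insert r A)
  have "Ck_on n U (F r)" "Ck_on n U (\<lambda>x. \<Sum>r\<in>A. F r x)"
    by (rule insert.prems, simp) (rule insert.IH, rule insert.prems, simp)
  from Ck_on_add[OF assms(1) this] show ?case
    by (simp only: sum.insert[OF insert.hyps])
qed (simp_all only: sum.infinite sum.empty Ck_on_const not_False_eq_True)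

lemma Ck_on_prod:
  assumes "open U" "\<And>r. r \<in> A \<Longrightarrow> Ck_on n U (F r)"
  shows "Ck_on n U (\<lambda>x. \<Prod>r\<in>A. F r x)"
  using assms(2)
proof (induction A rule: infinite_finite_induct)
  case (insert r A)
  have "Ck_on n U (F r)" "Ck_on n U (\<lambda>x. \<Prod>r\<in>A. F r x)"
    by (rule insert.prems, simp) (rule insert.IH, rule insert.prems, simp)
  from Ck_on_mult[OF assms(1) this] show ?case
    by (simp only: prod.insert[OF insert.hyps])
qed (simp_all only: prod.infinite prod.empty Ck_on_const not_False_eq_True)

lemma Ck_on_inverse:
  assumes "open U" "Ck_on n U F" "\<And>x. x \<in> U \<Longrightarrow> F x \<noteq> 0"
  shows "Ck_on n U (\<lambda>x. inverse (F x))"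
  using assms(2)
proof (induction n)
  case 0
  thus ?case using assms(3) by (auto intro!: continuous_on_inverse)
next
  case (Suc n)
  note inv = Suc.IH[OF Ck_on_SucD[OF Suc.prems]]
  have d: "F differentiable (at x)" if "x \<in> U" for x
    using Ck_on_differentiable_at[OF Suc.prems assms(1) that] .
  have "Ck_on n U (pd i (\<lambda>x. inverse (F x)))
      = Ck_on n U (\<lambda>x. (- 1) * (pd i F x * (inverse (F x) * inverse (F x))))" for i
    by (rule Ck_on_cong[OF assms(1)]) (simp add: pd_inverse(1)[OF d assms(3)])
  moreover have "Ck_on n U (\<lambda>x. (- 1) * (pd i F x * (inverse (F x) * inverse (F x))))" for i
  proof -
    have "Ck_on n U (pd i F)" using Suc.prems by simp
    thus ?thesis by (rule Ck_on_mult[OF assms(1) Ck_on_const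
          Ck_on_mult[OF assms(1) _ Ck_on_mult[OF assms(1) inv inv]]])
  qed
  ultimately show ?case
    using pd_inverse(2)[OF d assms(3)] assms(1)
    by (simp add: differentiable_on_eq_differentiable_at del: Ck_on.simps(1))
qed

lemma smooth_on_cong:
  "open U \<Longrightarrow> (\<And>x. x \<in> U \<Longrightarrow> F x = G x) \<Longrightarrow> smooth_on U F \<longleftrightarrow> smooth_on U G"
  using Ck_on_cong[of U F G] by (simp add: smooth_on_def)

lemma smooth_on_subset: "smooth_on U F \<Longrightarrow> V \<subseteq> U \<Longrightarrow> smooth_on V F"
  by (simp add: smooth_on_def Ck_on_subset[of _ U F V])

lemma smooth_on_const: "smooth_on U (\<lambda>_. c)"
  by (simp add: smooth_on_def Ck_on_const)

lemma smooth_on_add: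
  "open U \<Longrightarrow> smooth_on U F \<Longrightarrow> smooth_on U G \<Longrightarrow> smooth_on U (\<lambda>x. F x + G x)"
  by (simp add: smooth_on_def Ck_on_add)

lemma smooth_on_mult:
  "open U \<Longrightarrow> smooth_on U F \<Longrightarrow> smooth_on U G \<Longrightarrow> smooth_on U (\<lambda>x. F x * G x)"
  by (simp add: smooth_on_def Ck_on_mult)

lemma smooth_on_diff:
  "open U \<Longrightarrow> smooth_on U F \<Longrightarrow> smooth_on U G \<Longrightarrow> smooth_on U (\<lambda>x. F x - G x)"
  using smooth_on_add[OF _ _ smooth_on_mult[OF _ smooth_on_const], of U F G "-1"] by simp

lemma smooth_on_sum:
  "open U \<Longrightarrow> (\<And>r. r \<in> A \<Longrightarrow> smooth_on U (F r)) \<Longrightarrow> smooth_on U (\<lambda>x. \<Sum>r\<in>A. F r x)"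
  by (simp add: smooth_on_def Ck_on_sum)

lemma smooth_on_prod:
  "open U \<Longrightarrow> (\<And>r. r \<in> A \<Longrightarrow> smooth_on U (F r)) \<Longrightarrow> smooth_on U (\<lambda>x. \<Prod>r\<in>A. F r x)"
  by (simp add: smooth_on_def Ck_on_prod)

lemma smooth_on_inverse:
  "open U \<Longrightarrow> smooth_on U F \<Longrightarrow> (\<And>x. x \<in> U \<Longrightarrow> F x \<noteq> 0) \<Longrightarrow> smooth_on U (\<lambda>x. inverse (F x))"
  by (simp add: smooth_on_def Ck_on_inverse)

lemmas smooth_on_intros =
  smooth_on_const smooth_on_add smooth_on_mult smooth_on_diff smooth_on_sum smooth_on_prod

lemma smooth_on_pd_ln:
  assumes "open U" "smooth_on U F" "\<And>x. x \<in> U \<Longrightarrow> F x > 0"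
  shows "smooth_on U (pd i (\<lambda>x. ln (F x)))"
proof -
  have "smooth_on U (\<lambda>x. pd i F x * inverse (F x))"
    using assms(3)
    by (intro smooth_on_mult[OF assms(1)] smooth_on_inverse[OF assms(1)] smooth_on_pd assms(2))
      force
  moreover have "pd i (\<lambda>x. ln (F x)) x = pd i F x * inverse (F x)" if "x \<in> U" for x
    using pd_ln(1)[OF smooth_on_differentiable_at[OF assms(2,1) that] assms(3)[OF that]]
    by (simp add: field_simps)
  ultimately show ?thesis by (subst smooth_on_cong[OF assms(1)])
qed

lemma matrix_inv_works:
  assumes "invertible A"
  shows "A ** matrix_inv A = mat 1" "matrix_inv A ** A = mat 1"
  using someI_ex[OF assms[unfolded invertible_def]] by (simp_all add: matrix_inv_def)

lemma matrix_inv_unique: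
  assumes "A ** B = mat 1" "B ** A = mat 1"
  shows "matrix_inv A = B"
proof -
  have "invertible A" using assms by (auto simp: invertible_def)
  hence "B = (matrix_inv A ** A) ** B" by (simp add: matrix_inv_works)
  thus ?thesis by (simp add: matrix_mul_assoc[symmetric] assms)
qed

text \<open>
By Cramer's rule an entry of the inverse is a quotient of two determinants, which are polynomials
in the entries.
\<close>

lemma smooth_on_matrix_inv:
  fixes G :: "real^'m::finite \<Rightarrow> real^'m^'m"
  assumes "open U" "\<And>i j. smooth_on U (\<lambda>\<theta>. G \<theta> $ i $ j)" "\<And>\<theta>. \<theta> \<in> U \<Longrightarrow> invertible (G \<theta>)"
  shows "smooth_on U (\<lambda>\<theta>. matrix_inv (G \<theta>) $ r $ l)"
proof -
  define N where "N \<theta> = (\<chi> i j. if j = r then axis l 1 $ i else G \<theta> $ i $ j)" for \<theta>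
  have sd: "smooth_on U (\<lambda>\<theta>. det (M \<theta>))" if "\<And>i j. smooth_on U (\<lambda>\<theta>. M \<theta> $ i $ j)"
    for M :: "real^'m::finite \<Rightarrow> real^'m^'m"
    unfolding det_def by (intro smooth_on_intros assms(1) that)
  have "smooth_on U (\<lambda>\<theta>. N \<theta> $ i $ j)" for i j
    using assms(2) by (cases "j = r") (auto simp: N_def smooth_on_const)
  hence "smooth_on U (\<lambda>\<theta>. det (N \<theta>) * inverse (det (G \<theta>)))"
    using assms by (intro smooth_on_mult smooth_on_inverse sd) (auto simp: invertible_det_nz)
  moreover have "matrix_inv (G \<theta>) $ r $ l = det (N \<theta>) * inverse (det (G \<theta>))" if "\<theta> \<in> U" for \<theta>
  proof -
    have "G \<theta> ** matrix_inv (G \<theta>) = mat 1"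
      using assms(3)[OF that] by (simp add: matrix_inv_works)
    hence "G \<theta> *v (matrix_inv (G \<theta>) *v axis l 1) = axis l 1"
      by (simp add: matrix_vector_mul_assoc)
    hence "matrix_inv (G \<theta>) *v axis l 1
        = (\<chi> k. det (\<chi> i j. if j = k then axis l 1 $ i else G \<theta> $ i $ j) / det (G \<theta>))"
      using assms(3)[OF that] by (subst (asm) cramer) (auto simp: invertible_det_nz)
    moreover have "(matrix_inv (G \<theta>) *v axis l 1) $ r = matrix_inv (G \<theta>) $ r $ l"
      by (simp add: matrix_vector_mul_component inner_axis)
    ultimately show ?thesis by (simp add: N_def field_simps)
  qed
  ultimately show ?thesis by (subst smooth_on_cong[OF assms(1)])
qed

section \<open>Integration along rays and symmetry of second derivatives\<close>

text \<open>
The integral of the 1-form \<open>\<omega>\<close> along the segment from \<open>c\<close> to \<open>\<theta>\<close>: the homotopy operator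
of the Poincare lemma.
\<close>

definition cone_integral :: "real^'m::finite \<Rightarrow> ('m \<Rightarrow> real^'m \<Rightarrow> real) \<Rightarrow> real^'m \<Rightarrow> real" where
  "cone_integral c \<omega> \<theta> = integral {0..1} (\<lambda>t. \<Sum>i\<in>UNIV. (\<theta> - c) $ i * \<omega> i (c + t *\<^sub>R (\<theta> - c)))"

lemma cone_point_in:
  assumes "convex S" "c \<in> S" "\<theta> \<in> S" "t \<in> {0..1}"
  shows "c + t *\<^sub>R (\<theta> - c) \<in> S"
proof -
  have "c + t *\<^sub>R (\<theta> - c) = (1 - t) *\<^sub>R c + t *\<^sub>R \<theta>" by (simp add: algebra_simps)
  with assms show ?thesis by (auto intro: convexD_alt)
qed

lemma continuous_on_cone:
  fixes c :: "'a::real_normed_vector"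
  assumes "convex S" "c \<in> S" "continuous_on S F"
  shows "continuous_on (S \<times> {0..1}) (\<lambda>z. F (c + snd z *\<^sub>R (fst z - c)))"
proof (rule continuous_on_compose2[OF assms(3)])
  show "continuous_on (S \<times> {0..1}) (\<lambda>z. c + snd z *\<^sub>R (fst z - c))"
    by (intro continuous_intros)
qed (auto intro!: cone_point_in[OF assms(1,2)])

lemma continuous_on_cone_ray:
  fixes c :: "'a::real_normed_vector"
  assumes "convex S" "c \<in> S" "continuous_on S F" "\<theta> \<in> S"
  shows "continuous_on {0..1} (\<lambda>t. F (c + t *\<^sub>R (\<theta> - c)))"
proof (rule continuous_on_compose2[OF assms(3)])
  show "continuous_on {0..1} (\<lambda>t. c + t *\<^sub>R (\<theta> - c))"
    by (intro continuous_intros)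
qed (auto intro!: cone_point_in[OF assms(1,2,4)])

lemma has_derivative_along_ray:
  assumes "F differentiable (at (c + t *\<^sub>R (\<theta> - c)))"
  shows "((\<lambda>t. F (c + t *\<^sub>R (\<theta> - c))) has_real_derivative
          (\<Sum>i\<in>UNIV. (\<theta> - c) $ i * pd i F (c + t *\<^sub>R (\<theta> - c)))) (at t within T)"
proof -
  have "((\<lambda>t. c + t *\<^sub>R (\<theta> - c)) has_derivative (\<lambda>h. h *\<^sub>R (\<theta> - c))) (at t within T)"
    by (auto intro!: derivative_eq_intros)
  from has_derivative_compose[OF this has_derivative_pd[OF assms]]
  show ?thesis
    by (rule has_derivative_imp_has_field_derivative) (simp add: sum_distrib_left mult_ac)
qed

text \<open>
The homotopy formula of the Poincare lemma, in degree one and pointwise: the derivative of the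
cone integral is \<open>\<omega>\<close> plus a ray integral of the exterior derivative of \<open>\<omega>\<close>. Differentiation under
the integral gives \<open>\<omega>\<^sub>j + t * (\<theta> - c)\<^sup>i * \<partial>\<^sub>j\<omega>\<^sub>i\<close> as integrand. The part with \<open>\<partial>\<^sub>i\<omega>\<^sub>j\<close> in place
of \<open>\<partial>\<^sub>j\<omega>\<^sub>i\<close> is the \<open>t\<close>-derivative of \<open>t * \<omega>\<^sub>j\<close> along the ray.
\<close>

lemma cone_integral_has_derivative:
  fixes \<omega> :: "'m::finite \<Rightarrow> real^'m \<Rightarrow> real"
  assumes S: "open S" "convex S" "c \<in> S"
    and diff: "\<And>i. \<omega> i differentiable_on S"
    and cont: "\<And>i j. continuous_on S (pd j (\<omega> i))"
    and \<theta>: "\<theta> \<in> S"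
  shows "(cone_integral c \<omega> has_derivative (\<lambda>v. \<Sum>j\<in>UNIV. v $ j * (\<omega> j \<theta> +
      integral {0..1} (\<lambda>t. t * (\<Sum>i\<in>UNIV. (\<theta> - c) $ i *
        (pd j (\<omega> i) (c + t *\<^sub>R (\<theta> - c)) - pd i (\<omega> j) (c + t *\<^sub>R (\<theta> - c))))))))
    (at \<theta>)"
proof -
  define p where "p x t = c + t *\<^sub>R (x - c)" for x t
  \<comment> \<open>the partial derivative in direction \<open>j\<close> of the integrand at parameter \<open>t\<close>\<close>
  define D where "D j x t = \<omega> j (p x t) + t * (\<Sum>i\<in>UNIV. (x - c) $ i * pd j (\<omega> i) (p x t))" for j x t
  define E where "E j = Blinfun (\<lambda>v::real^'m. v $ j)" for j
  have E: "blinfun_apply (E j) v = v $ j" for j v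
    by (simp add: E_def bounded_linear_Blinfun_apply[OF bounded_linear_vec_nth])
  have c\<omega>: "continuous_on S (\<omega> i)" for i
    by (rule differentiable_imp_continuous_on[OF diff])
  have pS: "p x t \<in> S" if "x \<in> S" "t \<in> {0..1}" for x t
    unfolding p_def by (rule cone_point_in[OF S(2,3) that])
  have d\<omega>: "\<omega> i differentiable (at x)" if "x \<in> S" for i x
    using diff[of i] S(1) that by (simp add: differentiable_on_eq_differentiable_at)
  have cD: "continuous_on (S \<times> {0..1}) (\<lambda>z. D j (fst z) (snd z))" for j
    unfolding D_def p_def
    by (intro continuous_intros continuous_on_cone[OF S(2,3)] c\<omega> cont)
  have cDray: "continuous_on {0..1} (\<lambda>t. D j \<theta> t)" for j
    unfolding D_def p_def
    by (intro continuous_intros continuous_on_cone_ray[OF S(2,3) _ \<theta>] c\<omega> cont)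
  have leib: "((\<lambda>x. integral (cbox 0 1) (\<lambda>t. \<Sum>i\<in>UNIV. (x - c) $ i * \<omega> i (p x t)))
      has_derivative blinfun_apply (integral (cbox 0 1) (\<lambda>t. \<Sum>j\<in>UNIV. D j \<theta> t *\<^sub>R E j))) (at \<theta> within S)"
  proof (rule leibniz_rule[OF _ _ _ \<theta> S(2)])
    fix x and t :: real assume x: "x \<in> S" and t: "t \<in> cbox 0 1"
    have tp: "t \<in> {0..1}" using t by simp
    have "((\<lambda>x. \<omega> i (p x t)) has_derivative (\<lambda>v. \<Sum>j\<in>UNIV. (t *\<^sub>R v) $ j * pd j (\<omega> i) (p x t)))
        (at x within S)" for i
    proof -
      have "((\<lambda>x. p x t) has_derivative (\<lambda>v. t *\<^sub>R v)) (at x within S)"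
        unfolding p_def by (auto intro!: derivative_eq_intros)
      from has_derivative_compose[OF this has_derivative_pd[OF d\<omega>[OF pS[OF x tp]]]]
      show ?thesis .
    qed
    note [derivative_intros] = this
    have "((\<lambda>x. \<Sum>i\<in>UNIV. (x - c) $ i * \<omega> i (p x t)) has_derivative
       (\<lambda>v. \<Sum>i\<in>UNIV. (x - c) $ i * (\<Sum>j\<in>UNIV. (t *\<^sub>R v) $ j * pd j (\<omega> i) (p x t)) + v $ i * \<omega> i (p x t)))
       (at x within S)"
      by (auto intro!: derivative_eq_intros bounded_linear.has_derivative[OF bounded_linear_vec_nth])
    also have "(\<lambda>v. \<Sum>i\<in>UNIV. (x - c) $ i * (\<Sum>j\<in>UNIV. (t *\<^sub>R v) $ j * pd j (\<omega> i) (p x t)) + v $ i * \<omega> i (p x t))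
        = blinfun_apply (\<Sum>j\<in>UNIV. D j x t *\<^sub>R E j)"
    proof
      fix v :: "real^'m"
      have "(\<Sum>i\<in>UNIV. (x - c) $ i * (\<Sum>j\<in>UNIV. (t *\<^sub>R v) $ j * pd j (\<omega> i) (p x t)))
        = (\<Sum>i\<in>UNIV. \<Sum>j\<in>UNIV. v $ j * (t * ((x - c) $ i * pd j (\<omega> i) (p x t))))"
        by (simp add: sum_distrib_left mult_ac)
      also have "\<dots> = (\<Sum>j\<in>UNIV. v $ j * (t * (\<Sum>i\<in>UNIV. (x - c) $ i * pd j (\<omega> i) (p x t))))"
        by (subst sum.swap) (simp add: sum_distrib_left)
      finally show "(\<Sum>i\<in>UNIV. (x - c) $ i * (\<Sum>j\<in>UNIV. (t *\<^sub>R v) $ j * pd j (\<omega> i) (p x t)) + v $ i * \<omega> i (p x t))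
        = blinfun_apply (\<Sum>j\<in>UNIV. D j x t *\<^sub>R E j) v"
        by (simp add: sum.distrib blinfun.sum_left blinfun.scaleR_left E D_def distrib_left
            mult.commute)
    qed
    finally show "((\<lambda>x. \<Sum>i\<in>UNIV. (x - c) $ i * \<omega> i (p x t)) has_derivative
        blinfun_apply (\<Sum>j\<in>UNIV. D j x t *\<^sub>R E j)) (at x within S)" .
  next
    fix x assume x: "x \<in> S"
    show "(\<lambda>t. \<Sum>i\<in>UNIV. (x - c) $ i * \<omega> i (p x t)) integrable_on cbox 0 1"
      unfolding p_def box_real
      by (intro integrable_continuous_real continuous_intros continuous_on_cone_ray[OF S(2,3) _ x] c\<omega>)
  next
    show "continuous_on (S \<times> cbox 0 1) (\<lambda>(x, t). \<Sum>j\<in>UNIV. D j x t *\<^sub>R E j)"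
      unfolding split_beta box_real by (intro continuous_intros cD)
  qed
  have "blinfun_apply (integral (cbox 0 1) (\<lambda>t. \<Sum>j\<in>UNIV. D j \<theta> t *\<^sub>R E j)) v
      = (\<Sum>j\<in>UNIV. v $ j * integral {0..1} (D j \<theta>))" for v
  proof -
    have "integral {0..1} (\<lambda>t. \<Sum>j\<in>UNIV. D j \<theta> t *\<^sub>R E j)
        = (\<Sum>j\<in>UNIV. integral {0..1} (\<lambda>t. D j \<theta> t *\<^sub>R E j))"
      by (intro integral_sum integrable_continuous_real continuous_intros cDray) simp
    also have "\<dots> = (\<Sum>j\<in>UNIV. integral {0..1} (D j \<theta>) *\<^sub>R E j)"
    proof (rule sum.cong[OF refl])
      fix j
      have "((\<lambda>t. D j \<theta> t *\<^sub>R E j) has_integral integral {0..1} (D j \<theta>) *\<^sub>R E j) {0..1}"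
        by (intro has_integral_scaleR_left integrable_integral integrable_continuous_real cDray)
      thus "integral {0..1} (\<lambda>t. D j \<theta> t *\<^sub>R E j) = integral {0..1} (D j \<theta>) *\<^sub>R E j"
        by (rule integral_unique)
    qed
    finally show ?thesis
      by (simp add: blinfun.sum_left blinfun.scaleR_left E mult.commute)
  qed
  moreover have "integral {0..1} (D j \<theta>) = \<omega> j \<theta> + integral {0..1} (\<lambda>t. t *
      (\<Sum>i\<in>UNIV. (\<theta> - c) $ i * (pd j (\<omega> i) (p \<theta> t) - pd i (\<omega> j) (p \<theta> t))))" for j
  proof -
    let ?X = "\<lambda>t. t * (\<Sum>i\<in>UNIV. (\<theta> - c) $ i * (pd j (\<omega> i) (p \<theta> t) - pd i (\<omega> j) (p \<theta> t)))"
    let ?Y = "\<lambda>t. \<omega> j (p \<theta> t) + t * (\<Sum>i\<in>UNIV. (\<theta> - c) $ i * pd i (\<omega> j) (p \<theta> t))"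
    have "(?Y has_integral (1 * \<omega> j (p \<theta> 1) - 0 * \<omega> j (p \<theta> 0))) {0..1}"
    proof (rule fundamental_theorem_of_calculus)
      fix t :: real assume "t \<in> {0..1}"
      from DERIV_mult[OF DERIV_ident has_derivative_along_ray[OF d\<omega>[OF pS[OF \<theta> this, unfolded p_def]]]]
      show "((\<lambda>t. t * \<omega> j (p \<theta> t)) has_vector_derivative ?Y t) (at t within {0..1})"
        unfolding p_def by (simp add: has_real_derivative_iff_has_vector_derivative[symmetric] mult.commute)
    qed simp
    moreover have "?X integrable_on {0..1}"
      unfolding p_def
      by (intro integrable_continuous_real continuous_intros continuous_on_cone_ray[OF S(2,3) _ \<theta>] c\<omega> cont)
    ultimately have "((\<lambda>t. ?Y t + ?X t) has_integral (\<omega> j \<theta> + integral {0..1} ?X)) {0..1}"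
      by (intro has_integral_add integrable_integral) (simp_all add: p_def)
    moreover have "?Y t + ?X t = D j \<theta> t" for t
      by (simp add: D_def sum_subtractf right_diff_distrib)
    ultimately show ?thesis by (simp add: integral_unique)
  qed
  ultimately have "blinfun_apply (integral (cbox 0 1) (\<lambda>t. \<Sum>j\<in>UNIV. D j \<theta> t *\<^sub>R E j))
      = (\<lambda>v. \<Sum>j\<in>UNIV. v $ j * (\<omega> j \<theta> + integral {0..1} (\<lambda>t. t *
          (\<Sum>i\<in>UNIV. (\<theta> - c) $ i * (pd j (\<omega> i) (p \<theta> t) - pd i (\<omega> j) (p \<theta> t))))))"
    by (intro ext) (simp only:)
  with leib show ?thesis
    unfolding at_within_open[OF \<theta> S(1)] cone_integral_def[abs_def] p_def box_real
    by (simp only:)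
qed

lemma cone_integral_pd:
  fixes \<omega> :: "'m::finite \<Rightarrow> real^'m \<Rightarrow> real"
  assumes "open S" "convex S" "c \<in> S" "\<And>i. \<omega> i differentiable_on S"
    "\<And>i j. continuous_on S (pd j (\<omega> i))" "\<theta> \<in> S"
  shows "pd j (cone_integral c \<omega>) \<theta> = \<omega> j \<theta> +
      integral {0..1} (\<lambda>t. t * (\<Sum>i\<in>UNIV. (\<theta> - c) $ i *
        (pd j (\<omega> i) (c + t *\<^sub>R (\<theta> - c)) - pd i (\<omega> j) (c + t *\<^sub>R (\<theta> - c)))))"
  by (subst pd_eqI[OF cone_integral_has_derivative[OF assms]])
    (simp add: axis_def if_distrib if_distribR sum.delta cong: if_cong)

lemma continuous_on_cone_remainder:
  fixes \<eta> :: "'m::finite \<Rightarrow> 'm \<Rightarrow> real^'m \<Rightarrow> real"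
  assumes "convex S" "c \<in> S" "\<And>i j. continuous_on S (\<eta> j i)"
  shows "continuous_on S (\<lambda>\<theta>. integral {0..1} (\<lambda>t. t * (\<Sum>i\<in>UNIV. (\<theta> - c) $ i *
          \<eta> j i (c + t *\<^sub>R (\<theta> - c)))))"
proof -
  have "continuous_on (S \<times> cbox 0 1) (\<lambda>(\<theta>, t). t * (\<Sum>i\<in>UNIV. (\<theta> - c) $ i *
          \<eta> j i (c + t *\<^sub>R (\<theta> - c))))"
    unfolding split_beta box_real
    by (intro continuous_intros continuous_on_cone assms)
  from integral_continuous_on_param[OF this] show ?thesis by (simp add: box_real)
qed

text \<open>
Apply the homotopy formula to \<open>\<omega> = dF\<close>. Its cone integral is \<open>F - F c\<close>, with derivative \<open>\<omega>\<close>, so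
the ray integrals of the antisymmetrized second derivative \<open>\<Omega>\<close> vanish. Divided by the length of the
ray, those in direction \<open>i\<close> tend to \<open>\<Omega> c / 2\<close> as the ray shrinks.
\<close>

lemma pd_commute:
  fixes F :: "real^'m::finite \<Rightarrow> real"
  assumes U: "open U" "c \<in> U" and F: "Ck_on (Suc (Suc 0)) U F"
  shows "pd i (pd j F) c = pd j (pd i F) c"
proof -
  obtain e where e: "e > 0" "ball c e \<subseteq> U" using U open_contains_ball by blast
  define S where "S = ball c e"
  have S: "open S" "convex S" "c \<in> S" using e by (auto simp: S_def)
  have FS: "Ck_on (Suc (Suc 0)) S F" using Ck_on_subset[OF F] e by (simp add: S_def)
  hence d1: "pd k F differentiable_on S" for k by simp
  from FS have cc: "continuous_on S (pd l (pd k F))" for k l by simp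
  have dF: "F differentiable (at x)" if "x \<in> S" for x
    using Ck_on_differentiable_at[OF FS S(1) that] .
  have cone: "cone_integral c (\<lambda>k. pd k F) \<theta> = F \<theta> - F c" if "\<theta> \<in> S" for \<theta>
  proof -
    have "((\<lambda>t. \<Sum>i\<in>UNIV. (\<theta> - c) $ i * pd i F (c + t *\<^sub>R (\<theta> - c))) has_integral
        F (c + 1 *\<^sub>R (\<theta> - c)) - F (c + 0 *\<^sub>R (\<theta> - c))) {0..1}"
    proof (rule fundamental_theorem_of_calculus)
      fix t :: real assume "t \<in> {0..1}"
      from has_derivative_along_ray[OF dF[OF cone_point_in[OF S(2,3) that this]]]
      show "((\<lambda>t. F (c + t *\<^sub>R (\<theta> - c))) has_vector_derivative
          (\<Sum>i\<in>UNIV. (\<theta> - c) $ i * pd i F (c + t *\<^sub>R (\<theta> - c)))) (at t within {0..1})"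
        by (simp only: has_real_derivative_iff_has_vector_derivative)
    qed simp
    thus ?thesis by (simp add: cone_integral_def integral_unique)
  qed
  define \<Omega> where "\<Omega> x = pd j (pd i F) x - pd i (pd j F) x" for x
  have c\<Omega>: "continuous_on S \<Omega>" unfolding \<Omega>_def by (intro continuous_intros cc)
  \<comment> \<open>the ray integral in direction \<open>i\<close>, divided by the length \<open>s\<close> of the ray\<close>
  define I where "I s = integral {0..1} (\<lambda>t. t * \<Omega> (c + (t * s) *\<^sub>R axis i 1))" for s
  have in_S: "c + (t * s) *\<^sub>R axis i 1 \<in> S" if "t \<in> {0..1}" "s \<in> {0..<e}" for t s
  proof -
    have "t * s \<le> 1 * s" using that by (intro mult_right_mono) auto
    thus ?thesis using that by (simp add: S_def dist_norm)
  qed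
  have I0: "I s = 0" if s: "0 < s" "s < e" for s
  proof -
    define \<theta> where "\<theta> = c + s *\<^sub>R axis i (1::real)"
    have \<theta>: "\<theta> \<in> S" using in_S[of 1 s] s by (simp add: \<theta>_def)
    have "pd j (cone_integral c (\<lambda>k. pd k F)) \<theta> = pd j (\<lambda>x. F x - F c) \<theta>"
      by (rule pd_cong[OF S(1) \<theta> cone])
    also have "\<dots> = pd j F \<theta>"
      using dF[OF \<theta>] by (simp add: pd_diff)
    finally have "integral {0..1} (\<lambda>t. t * (\<Sum>k\<in>UNIV. (\<theta> - c) $ k *
        (pd j (pd k F) (c + t *\<^sub>R (\<theta> - c)) - pd k (pd j F) (c + t *\<^sub>R (\<theta> - c))))) = 0"
      by (simp add: cone_integral_pd[OF S d1 cc \<theta>])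
    also have "(\<lambda>t. t * (\<Sum>k\<in>UNIV. (\<theta> - c) $ k *
        (pd j (pd k F) (c + t *\<^sub>R (\<theta> - c)) - pd k (pd j F) (c + t *\<^sub>R (\<theta> - c)))))
        = (\<lambda>t. s * (t * \<Omega> (c + (t * s) *\<^sub>R axis i 1)))"
      by (simp add: \<theta>_def \<Omega>_def axis_def if_distrib if_distribR sum.delta fun_eq_iff cong: if_cong)
    finally show ?thesis using s by (simp add: I_def)
  qed
  have "continuous_on ({0..<e} \<times> cbox 0 1) (\<lambda>(s, t). t * \<Omega> (c + (t * s) *\<^sub>R axis i 1))"
    unfolding split_beta box_real
    by (intro continuous_intros continuous_on_compose2[OF c\<Omega>]) (auto intro!: in_S)
  hence "continuous_on {0..<e} I"
    unfolding I_def by (drule_tac integral_continuous_on_param) (simp add: box_real)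
  hence "continuous_on {0..e/2} I"
    by (rule continuous_on_subset) (use e in auto)
  hence "(I \<longlongrightarrow> I 0) (at 0 within {0..e/2})"
    using e by (simp add: continuous_on_def)
  hence "(I \<longlongrightarrow> I 0) (at_right 0)"
    using at_within_Icc_at_right[of 0 "e/2"] e by simp
  moreover have "(I \<longlongrightarrow> 0) (at_right 0)"
    by (rule tendsto_eventually) (use e I0 in \<open>auto simp: eventually_at_right intro!: exI[of _ e]\<close>)
  ultimately have "I 0 = 0"
    by (rule tendsto_unique[OF trivial_limit_at_right_real])
  moreover have "I 0 = \<Omega> c / 2"
  proof -
    have "((\<lambda>t. t * \<Omega> c) has_integral (1 ^ 2 / 2 * \<Omega> c - 0 ^ 2 / 2 * \<Omega> c)) {0..1}"
      by (rule fundamental_theorem_of_calculus)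
        (auto simp: has_real_derivative_iff_has_vector_derivative[symmetric]
          intro!: derivative_eq_intros)
    thus ?thesis by (simp add: I_def integral_unique)
  qed
  ultimately show ?thesis by (simp add: \<Omega>_def)
qed

lemma cone_integral_C1:
  assumes S: "open S" "convex S" "c \<in> S" and \<omega>: "\<And>i. Ck_on (Suc 0) S (\<omega> i)"
  shows "Ck_on (Suc 0) S (cone_integral c \<omega>)"
    and "\<theta> \<in> S \<Longrightarrow> pd j (cone_integral c \<omega>) \<theta> = \<omega> j \<theta> +
      integral {0..1} (\<lambda>t. t * (\<Sum>i\<in>UNIV. (\<theta> - c) $ i *
        (pd j (\<omega> i) (c + t *\<^sub>R (\<theta> - c)) - pd i (\<omega> j) (c + t *\<^sub>R (\<theta> - c)))))"
proof -
  have d: "\<omega> i differentiable_on S" and cc: "continuous_on S (pd j (\<omega> i))" for i j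
    using \<omega>[of i] by simp_all
  have pd: "pd j (cone_integral c \<omega>) \<theta> = \<omega> j \<theta> +
      integral {0..1} (\<lambda>t. t * (\<Sum>i\<in>UNIV. (\<theta> - c) $ i *
        (pd j (\<omega> i) (c + t *\<^sub>R (\<theta> - c)) - pd i (\<omega> j) (c + t *\<^sub>R (\<theta> - c)))))"
    if "\<theta> \<in> S" for \<theta> j
    by (rule cone_integral_pd[OF S d cc that])
  thus "\<theta> \<in> S \<Longrightarrow> pd j (cone_integral c \<omega>) \<theta> = \<omega> j \<theta> +
      integral {0..1} (\<lambda>t. t * (\<Sum>i\<in>UNIV. (\<theta> - c) $ i *
        (pd j (\<omega> i) (c + t *\<^sub>R (\<theta> - c)) - pd i (\<omega> j) (c + t *\<^sub>R (\<theta> - c)))))" .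
  have "continuous_on S (\<lambda>\<theta>. \<omega> j \<theta> + integral {0..1} (\<lambda>t. t * (\<Sum>i\<in>UNIV. (\<theta> - c) $ i *
        (pd j (\<omega> i) (c + t *\<^sub>R (\<theta> - c)) - pd i (\<omega> j) (c + t *\<^sub>R (\<theta> - c))))))" for j
    by (intro continuous_on_add differentiable_imp_continuous_on[OF d]
        continuous_on_cone_remainder[OF S(2,3), where \<eta> = "\<lambda>j i x. pd j (\<omega> i) x - pd i (\<omega> j) x"]
        continuous_on_diff cc)
  hence "continuous_on S (pd j (cone_integral c \<omega>))" for j
    by (subst continuous_on_cong[OF refl pd])
  moreover have "cone_integral c \<omega> differentiable_on S"
    using cone_integral_has_derivative[where \<omega> = \<omega>, OF S d cc] S(1)
    by (auto simp: differentiable_on_eq_differentiable_at differentiable_def)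
  ultimately show "Ck_on (Suc 0) S (cone_integral c \<omega>)" by simp
qed

section \<open>Linear total differential systems\<close>

text \<open>
Picard iterates for the system \<open>\<partial>\<^sub>i y\<^sub>p = a\<^sub>i\<^sub>p\<^sub>q * y\<^sub>q\<close>, integrated along the rays from \<open>c\<close>.
\<close>

primrec picard ::
  "('m::finite \<Rightarrow> 'k::finite \<Rightarrow> 'k \<Rightarrow> real^'m \<Rightarrow> real) \<Rightarrow> real^'m \<Rightarrow> ('k \<Rightarrow> real)
    \<Rightarrow> nat \<Rightarrow> 'k \<Rightarrow> real^'m \<Rightarrow> real" where
  "picard a c y0 0 = (\<lambda>p \<theta>. y0 p)"
| "picard a c y0 (Suc n) = (\<lambda>p \<theta>. y0 p +
     cone_integral c (\<lambda>i x. \<Sum>q\<in>UNIV. a i p q x * picard a c y0 n q x) \<theta>)"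

text \<open>
The amount by which \<open>y\<close> fails to solve the system. Picard iterates satisfy the radial part of the
system in the limit by construction; the defect controls the other directions.
\<close>

definition defect ::
  "('m::finite \<Rightarrow> 'k::finite \<Rightarrow> 'k \<Rightarrow> real^'m \<Rightarrow> real) \<Rightarrow> ('k \<Rightarrow> real^'m \<Rightarrow> real)
    \<Rightarrow> 'm \<Rightarrow> 'k \<Rightarrow> real^'m \<Rightarrow> real" where
  "defect a y j p \<theta> = pd j (y p) \<theta> - (\<Sum>q\<in>UNIV. a j p q \<theta> * y q \<theta>)"

lemma picard_C1:
  assumes S: "open S" "convex S" "c \<in> S" and a: "\<And>i p q. Ck_on (Suc 0) S (a i p q)"
  shows "Ck_on (Suc 0) S (picard a c y0 n p)"
proof (induction n arbitrary: p)
  case 0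
  show ?case unfolding picard.simps by (rule Ck_on_const)
next
  case (Suc n)
  show ?case unfolding picard.simps
    by (intro Ck_on_add Ck_on_const cone_integral_C1(1) Ck_on_sum Ck_on_mult S a Suc.IH)
qed

text \<open>
The hypothesis \<open>flat\<close> says that the connection form \<open>a\<close> has curvature zero. By the homotopy formula
the derivative of the next iterate is \<open>a * y\<close> plus a ray integral of the exterior derivative of
\<open>a * y\<close>. If the derivative of \<open>y\<close> in the latter is written as \<open>a * y\<close> plus defect, flatness
cancels every term but those with the defect. Hence the defects obey a linear recursion, and
nothing has to be known about derivatives of the limit.
\<close>

lemma defect_picard_Suc:
  fixes a :: "'m::finite \<Rightarrow> 'k::finite \<Rightarrow> 'k \<Rightarrow> real^'m \<Rightarrow> real" and y0 :: "'k \<Rightarrow> real"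
  assumes S: "open S" "convex S" "c \<in> S" and a: "\<And>i p q. Ck_on (Suc 0) S (a i p q)"
    and flat: "\<And>\<theta> i j p q. \<theta> \<in> S \<Longrightarrow>
        pd i (a j p q) \<theta> + (\<Sum>r\<in>UNIV. a j p r \<theta> * a i r q \<theta>)
      = pd j (a i p q) \<theta> + (\<Sum>r\<in>UNIV. a i p r \<theta> * a j r q \<theta>)"
    and \<theta>: "\<theta> \<in> S"
  defines "y \<equiv> picard a c y0"
  shows "defect a (y (Suc n)) j p \<theta> =
      (\<Sum>q\<in>UNIV. a j p q \<theta> * (y n q \<theta> - y (Suc n) q \<theta>)) +
      integral {0..1} (\<lambda>t. t * (\<Sum>i\<in>UNIV. (\<theta> - c) $ i *
        (\<Sum>q\<in>UNIV. a i p q (c + t *\<^sub>R (\<theta> - c)) * defect a (y n) j q (c + t *\<^sub>R (\<theta> - c))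
                   - a j p q (c + t *\<^sub>R (\<theta> - c)) * defect a (y n) i q (c + t *\<^sub>R (\<theta> - c)))))"
proof -
  define \<omega> where "\<omega> i x = (\<Sum>q\<in>UNIV. a i p q x * y n q x)" for i x
  have yC: "Ck_on (Suc 0) S (y n q)" for n q
    unfolding y_def by (rule picard_C1[OF S a])
  have \<omega>C: "Ck_on (Suc 0) S (\<omega> i)" for i
    unfolding \<omega>_def by (intro Ck_on_sum Ck_on_mult S a yC)
  have d: "a i p q differentiable (at x)" "y n q differentiable (at x)"
    "cone_integral c \<omega> differentiable (at x)" if "x \<in> S" for i p q x n
    using Ck_on_differentiable_at[OF a S(1) that] Ck_on_differentiable_at[OF yC S(1) that]
      Ck_on_differentiable_at[OF cone_integral_C1(1)[where \<omega> = \<omega>, OF S \<omega>C] S(1) that] by blast+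
  have cross: "pd j (\<omega> i) x - pd i (\<omega> j) x
      = (\<Sum>q\<in>UNIV. a i p q x * defect a (y n) j q x - a j p q x * defect a (y n) i q x)"
    if x: "x \<in> S" for i j x
  proof -
    have *: "pd j (\<omega> i) x = (\<Sum>q\<in>UNIV. a i p q x * defect a (y n) j q x)
        + (\<Sum>q\<in>UNIV. (pd j (a i p q) x + (\<Sum>r\<in>UNIV. a i p r x * a j r q x)) * y n q x)" for i j
    proof -
      have "pd j (\<omega> i) x = (\<Sum>q\<in>UNIV. pd j (a i p q) x * y n q x + a i p q x * pd j (y n q) x)"
        unfolding \<omega>_def by (simp add: pd_sum pd_mult d[OF x])
      also have "\<dots> = (\<Sum>q\<in>UNIV. a i p q x * defect a (y n) j q x)
          + ((\<Sum>q\<in>UNIV. pd j (a i p q) x * y n q x)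
            + (\<Sum>q\<in>UNIV. a i p q x * (\<Sum>r\<in>UNIV. a j q r x * y n r x)))"
        by (simp add: defect_def sum.distrib[symmetric] algebra_simps)
      also have "(\<Sum>q\<in>UNIV. a i p q x * (\<Sum>r\<in>UNIV. a j q r x * y n r x))
          = (\<Sum>q\<in>UNIV. (\<Sum>r\<in>UNIV. a i p r x * a j r q x) * y n q x)"
        unfolding sum_distrib_left sum_distrib_right by (subst sum.swap) (simp add: mult.assoc)
      finally show ?thesis by (simp add: sum.distrib distrib_right)
    qed
    show ?thesis unfolding *[of j i] *[of i j] by (simp add: flat[OF x, of i j] sum_subtractf)
  qed
  have "pd j (y (Suc n) p) \<theta> = pd j (cone_integral c \<omega>) \<theta>"
    using pd_add[OF differentiable_const d(3)[OF \<theta>], of j "y0 p"]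
    by (simp add: y_def \<omega>_def[abs_def])
  also have "\<dots> = \<omega> j \<theta> + integral {0..1} (\<lambda>t. t * (\<Sum>i\<in>UNIV. (\<theta> - c) $ i *
        (pd j (\<omega> i) (c + t *\<^sub>R (\<theta> - c)) - pd i (\<omega> j) (c + t *\<^sub>R (\<theta> - c)))))"
    by (rule cone_integral_C1(2)[OF S \<omega>C \<theta>])
  also have "integral {0..1} (\<lambda>t. t * (\<Sum>i\<in>UNIV. (\<theta> - c) $ i *
        (pd j (\<omega> i) (c + t *\<^sub>R (\<theta> - c)) - pd i (\<omega> j) (c + t *\<^sub>R (\<theta> - c)))))
     = integral {0..1} (\<lambda>t. t * (\<Sum>i\<in>UNIV. (\<theta> - c) $ i *
        (\<Sum>q\<in>UNIV. a i p q (c + t *\<^sub>R (\<theta> - c)) * defect a (y n) j q (c + t *\<^sub>R (\<theta> - c))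
                   - a j p q (c + t *\<^sub>R (\<theta> - c)) * defect a (y n) i q (c + t *\<^sub>R (\<theta> - c)))))"
    by (rule integral_cong) (simp only: cross[OF cone_point_in[OF S(2,3) \<theta>]])
  finally show ?thesis
    by (simp only: defect_def \<omega>_def right_diff_distrib sum_subtractf)
qed

lemma sum_UNIV_abs_le:
  fixes f :: "'k::finite \<Rightarrow> real"
  assumes "\<And>q. \<bar>f q\<bar> \<le> B"
  shows "\<bar>\<Sum>q\<in>UNIV. f q\<bar> \<le> real CARD('k) * B"
  using order_trans[OF sum_abs sum_bounded_above[of UNIV "\<lambda>q. \<bar>f q\<bar>" B]] assms by simp

lemma abs_integral_01_le:
  fixes f :: "real \<Rightarrow> real"
  assumes "continuous_on {0..1} f" "\<And>t. t \<in> {0..1} \<Longrightarrow> \<bar>f t\<bar> \<le> B"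
  shows "\<bar>integral {0..1} f\<bar> \<le> B"
  using integral_bound[of 0 1 f B] assms by simp

lemma geometric_increments_converge:
  fixes f :: "nat \<Rightarrow> real"
  assumes "\<And>n. \<bar>f (Suc n) - f n\<bar> \<le> D * (1/2) ^ n"
  obtains l where "f \<longlonglongrightarrow> l" "\<And>n. \<bar>f n - l\<bar> \<le> 2 * D * (1/2) ^ n"
proof -
  have step: "\<bar>f (n + k) - f n\<bar> \<le> 2 * D * (1/2) ^ n * (1 - (1/2) ^ k)" for n k
  proof (induction k)
    case (Suc k)
    have "\<bar>f (n + Suc k) - f n\<bar> \<le> \<bar>f (Suc (n + k)) - f (n + k)\<bar> + \<bar>f (n + k) - f n\<bar>" by simp
    also have "\<dots> \<le> D * (1/2) ^ (n + k) + 2 * D * (1/2) ^ n * (1 - (1/2) ^ k)"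
      by (intro add_mono assms Suc.IH)
    also have "\<dots> = 2 * D * (1/2) ^ n * (1 - (1/2) ^ Suc k)"
      by (simp add: power_add algebra_simps)
    finally show ?case .
  qed simp
  have D: "D \<ge> 0" using order_trans[OF abs_ge_zero assms[of 0]] by simp
  have bound: "\<bar>f (n + k) - f n\<bar> \<le> 2 * D * (1/2) ^ n" for n k
    by (rule order_trans[OF step]) (use D in \<open>simp add: mult_left_le\<close>)
  have lim0: "(\<lambda>n. 2 * D * (1/2) ^ n) \<longlonglongrightarrow> 0"
    using tendsto_mult_right_zero[OF LIMSEQ_power_zero[of "1/2::real"], of "2 * D"] by simp
  have "Cauchy f"
  proof (rule CauchyI')
    fix e :: real assume "e > 0"
    with lim0 have "eventually (\<lambda>n. 2 * D * (1/2) ^ n < e) sequentially"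
      by (rule order_tendstoD(2))
    then obtain N where N: "\<And>n. n \<ge> N \<Longrightarrow> 2 * D * (1/2) ^ n < e"
      by (auto simp: eventually_sequentially)
    have "dist (f m) (f n) < e" if "m \<ge> N" "n > m" for m n
      using bound[of m "n - m"] N[OF that(1)] that(2) by (simp add: dist_real_def abs_minus_commute)
    thus "\<exists>M. \<forall>m\<ge>M. \<forall>n>m. dist (f m) (f n) < e" by blast
  qed
  then obtain l where l: "f \<longlonglongrightarrow> l" by (auto simp: Cauchy_convergent_iff convergent_def)
  have "\<bar>f n - l\<bar> \<le> 2 * D * (1/2) ^ n" for n
  proof -
    have "(\<lambda>k. \<bar>f (k + n) - f n\<bar>) \<longlonglongrightarrow> \<bar>l - f n\<bar>"
      by (intro tendsto_intros LIMSEQ_ignore_initial_segment l)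
    hence "\<bar>l - f n\<bar> \<le> 2 * D * (1/2) ^ n"
      by (rule LIMSEQ_le_const2) (simp only: add.commute[of _ n] bound, blast)
    thus ?thesis by (simp add: abs_minus_commute)
  qed
  with l show ?thesis by (rule that)
qed

lemma cone_integral_bound:
  fixes \<omega> :: "'m::finite \<Rightarrow> real^'m \<Rightarrow> real"
  assumes "\<And>i. continuous_on (ball c \<epsilon>) (\<omega> i)" "\<And>i x. x \<in> ball c \<epsilon> \<Longrightarrow> \<bar>\<omega> i x\<bar> \<le> B"
    and \<theta>: "\<theta> \<in> ball c \<epsilon>"
  shows "\<bar>cone_integral c \<omega> \<theta>\<bar> \<le> real CARD('m) * (\<epsilon> * B)"
proof -
  have c: "c \<in> ball c \<epsilon>" using \<theta> by (auto intro: le_less_trans[OF zero_le_dist])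
  show ?thesis unfolding cone_integral_def
  proof (rule abs_integral_01_le)
    show "continuous_on {0..1} (\<lambda>t. \<Sum>i\<in>UNIV. (\<theta> - c) $ i * \<omega> i (c + t *\<^sub>R (\<theta> - c)))"
      by (intro continuous_intros continuous_on_cone_ray[OF convex_ball c _ \<theta>] assms(1))
  next
    fix t :: real assume t: "t \<in> {0..1}"
    show "\<bar>\<Sum>i\<in>UNIV. (\<theta> - c) $ i * \<omega> i (c + t *\<^sub>R (\<theta> - c))\<bar> \<le> real CARD('m) * (\<epsilon> * B)"
    proof (rule sum_UNIV_abs_le)
      fix i
      have "\<bar>(\<theta> - c) $ i\<bar> \<le> \<epsilon>"
        using order_trans[OF component_le_norm_cart[of "\<theta> - c" i]] \<theta>
        by (simp add: dist_norm norm_minus_commute)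
      thus "\<bar>(\<theta> - c) $ i * \<omega> i (c + t *\<^sub>R (\<theta> - c))\<bar> \<le> \<epsilon> * B"
        unfolding abs_mult
        by (intro mult_mono assms(2) cone_point_in[OF convex_ball c \<theta> t]) auto
    qed
  qed
qed

lemma cone_integral_diff:
  assumes "convex S" "c \<in> S" "\<theta> \<in> S"
    "\<And>i. continuous_on S (\<omega> i)" "\<And>i. continuous_on S (\<eta> i)"
  shows "cone_integral c \<omega> \<theta> - cone_integral c \<eta> \<theta> = cone_integral c (\<lambda>i x. \<omega> i x - \<eta> i x) \<theta>"
proof -
  have "(\<lambda>t. \<Sum>i\<in>UNIV. (\<theta> - c) $ i * F i (c + t *\<^sub>R (\<theta> - c))) integrable_on {0..1}"
    if "\<And>i. continuous_on S (F i)" for F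
    by (intro integrable_continuous_real continuous_intros
        continuous_on_cone_ray[OF assms(1,2) that assms(3)])
  from integral_diff[OF this[OF assms(4)] this[OF assms(5)]] show ?thesis
    by (simp add: cone_integral_def sum_subtractf right_diff_distrib)
qed

text \<open>
On a ball of radius \<open>\<epsilon>\<close> a step of the iteration multiplies differences by at most
\<open>m * \<epsilon> * k * A\<close>, and the integral term in the recursion of the defects has at most twice this
factor. With \<open>small\<close> these are at most \<open>1/8\<close> and \<open>1/4\<close>. In the second estimate the difference of
two iterates contributes another \<open>k * A * D * (1/2)\<^sup>n\<close>, which is a quarter of the bound
\<open>4 * k * A * D * (1/2)\<^sup>n\<close>; a quarter and a quarter make the required half.
\<close>

lemma picard_estimates:
  fixes a :: "'m::finite \<Rightarrow> 'k::finite \<Rightarrow> 'k \<Rightarrow> real^'m \<Rightarrow> real" and y0 :: "'k \<Rightarrow> real"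
  assumes \<epsilon>: "\<epsilon> > 0" and a: "\<And>i p q. Ck_on (Suc 0) (ball c \<epsilon>) (a i p q)"
    and flat: "\<And>\<theta> i j p q. \<theta> \<in> ball c \<epsilon> \<Longrightarrow>
        pd i (a j p q) \<theta> + (\<Sum>r\<in>UNIV. a j p r \<theta> * a i r q \<theta>)
      = pd j (a i p q) \<theta> + (\<Sum>r\<in>UNIV. a i p r \<theta> * a j r q \<theta>)"
    and A: "\<And>i p q \<theta>. \<theta> \<in> ball c \<epsilon> \<Longrightarrow> \<bar>a i p q \<theta>\<bar> \<le> A"
    and small: "8 * (real CARD('m) * (\<epsilon> * (real CARD('k) * A))) \<le> 1"
    and D: "\<And>p. \<bar>y0 p\<bar> \<le> D"
  shows "\<theta> \<in> ball c \<epsilon> \<Longrightarrow>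
      \<bar>picard a c y0 (Suc n) p \<theta> - picard a c y0 n p \<theta>\<bar> \<le> D * (1/2) ^ n"
    and "\<theta> \<in> ball c \<epsilon> \<Longrightarrow>
      \<bar>defect a (picard a c y0 n) j p \<theta>\<bar> \<le> 4 * (real CARD('k) * (A * D)) * (1/2) ^ n"
proof -
  define B where "B = ball c \<epsilon>"
  define y where "y = picard a c y0"
  let ?m = "real CARD('m)" and ?k = "real CARD('k)"
  have B: "open B" "convex B" "c \<in> B" using \<epsilon> by (auto simp: B_def)
  have A0: "A \<ge> 0" using A[of c] \<epsilon> by (force intro: order_trans[OF abs_ge_zero])
  have D0: "D \<ge> 0" using D by (force intro: order_trans[OF abs_ge_zero])
  have ac: "continuous_on B (a i p q)" for i p q
    using a[of i p q] by (simp add: B_def differentiable_imp_continuous_on)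
  have yC: "Ck_on (Suc 0) B (y n p)" for n p
    unfolding y_def by (rule picard_C1[OF B a[folded B_def]])
  hence yc: "continuous_on B (y n p)" for n p
    using differentiable_imp_continuous_on by (metis Ck_on.simps(2))
  have dc: "continuous_on B (defect a (y n) j p)" for n j p
    unfolding defect_def[abs_def]
    using yC[of n p] by (intro continuous_intros ac yc) simp
  have lin: "\<bar>\<Sum>q\<in>UNIV. a i p q \<theta> * f q\<bar> \<le> ?k * (A * K)"
    if "\<theta> \<in> B" "\<And>q. \<bar>f q\<bar> \<le> K" for i p \<theta> f K
    by (rule sum_UNIV_abs_le, unfold abs_mult, intro mult_mono)
      (use that A A0 in \<open>auto simp: B_def\<close>)
  have cont: "continuous_on B (\<lambda>x. \<Sum>q\<in>UNIV. a i p q x * y n q x)" for i p n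
    by (intro continuous_intros ac yc)
  have "0 \<le> ?m * (\<epsilon> * (?k * A))" using \<epsilon> A0 by simp
  with small have half: "?m * (\<epsilon> * (?k * A)) \<le> 1 / 2" by linarith
  have y0: "y 0 p \<theta> = y0 p" for p \<theta> by (simp add: y_def)
  have ind1: "\<theta> \<in> B \<Longrightarrow> \<bar>y (Suc n) p \<theta> - y n p \<theta>\<bar> \<le> D * (1/2) ^ n" for n p \<theta>
  proof (induction n arbitrary: p \<theta>)
    case 0
    have "\<bar>cone_integral c (\<lambda>i x. \<Sum>q\<in>UNIV. a i p q x * y 0 q x) \<theta>\<bar> \<le> ?m * (\<epsilon> * (?k * (A * D)))"
      by (rule cone_integral_bound)
        (use 0 D cont[of _ _ 0] in \<open>auto simp: B_def[symmetric] y0 intro!: lin\<close>)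
    also have "\<dots> \<le> D" using mult_right_mono[OF small D0] D0 by (simp add: algebra_simps)
    finally show ?case by (simp add: y_def)
  next
    case (Suc n)
    have "y (Suc (Suc n)) p \<theta> - y (Suc n) p \<theta> =
       cone_integral c (\<lambda>i x. \<Sum>q\<in>UNIV. a i p q x * y (Suc n) q x) \<theta>
       - cone_integral c (\<lambda>i x. \<Sum>q\<in>UNIV. a i p q x * y n q x) \<theta>"
      unfolding y_def by (simp only: picard.simps)
    also have "\<dots> = cone_integral c (\<lambda>i x. (\<Sum>q\<in>UNIV. a i p q x * y (Suc n) q x)
          - (\<Sum>q\<in>UNIV. a i p q x * y n q x)) \<theta>"
      by (rule cone_integral_diff[OF B(2,3) Suc.prems cont cont])
    also have "\<dots> = cone_integral c (\<lambda>i x. \<Sum>q\<in>UNIV. a i p q x * (y (Suc n) q x - y n q x)) \<theta>"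
      by (simp only: sum_subtractf right_diff_distrib)
    also have "\<bar>\<dots>\<bar> \<le> ?m * (\<epsilon> * (?k * (A * (D * (1/2) ^ n))))"
    proof (rule cone_integral_bound)
      show "continuous_on (ball c \<epsilon>) (\<lambda>x. \<Sum>q\<in>UNIV. a i p q x * (y (Suc n) q x - y n q x))" for i
        unfolding B_def[symmetric] by (intro continuous_intros ac yc)
      show "\<bar>\<Sum>q\<in>UNIV. a i p q x * (y (Suc n) q x - y n q x)\<bar> \<le> ?k * (A * (D * (1/2) ^ n))"
        if "x \<in> ball c \<epsilon>" for i x
        using that by (intro lin Suc.IH) (simp_all add: B_def)
    qed (use Suc.prems in \<open>simp add: B_def\<close>)
    also have "\<dots> \<le> D * (1/2) ^ Suc n"
      using mult_right_mono[OF half, of "D * (1/2) ^ n"] D0 by (simp add: mult_ac)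
    finally show ?case .
  qed
  have ind2: "\<theta> \<in> B \<Longrightarrow> \<bar>defect a (y n) j p \<theta>\<bar> \<le> 4 * (?k * (A * D)) * (1/2) ^ n" for n j p \<theta>
  proof (induction n arbitrary: j p \<theta>)
    case 0
    have "\<bar>\<Sum>q\<in>UNIV. a j p q \<theta> * y0 q\<bar> \<le> ?k * (A * D)"
      by (rule lin[OF 0 D])
    thus ?case using A0 D0 by (simp add: defect_def y_def)
  next
    case (Suc n)
    define E where "E = 4 * (?k * (A * D)) * (1/2) ^ n"
    have E0: "E \<ge> 0" using A0 D0 by (simp add: E_def)
    have "\<bar>\<Sum>q\<in>UNIV. a j p q \<theta> * (y n q \<theta> - y (Suc n) q \<theta>)\<bar> \<le> ?k * (A * (D * (1/2) ^ n))"
      using ind1[OF Suc.prems] by (intro lin Suc.prems) (simp add: abs_minus_commute)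
    also have "\<dots> = E / 4" by (simp add: E_def)
    finally have 1: "\<bar>\<Sum>q\<in>UNIV. a j p q \<theta> * (y n q \<theta> - y (Suc n) q \<theta>)\<bar> \<le> E / 4" .
    let ?R = "\<lambda>i x. \<Sum>q\<in>UNIV. a i p q x * defect a (y n) j q x - a j p q x * defect a (y n) i q x"
    have cR: "continuous_on B (?R i)" for i
      by (intro continuous_intros ac dc)
    have bR: "\<bar>?R i x\<bar> \<le> 2 * (?k * (A * E))" if "x \<in> B" for i x
    proof -
      have "\<bar>?R i x\<bar> \<le> \<bar>\<Sum>q\<in>UNIV. a i p q x * defect a (y n) j q x\<bar>
          + \<bar>\<Sum>q\<in>UNIV. a j p q x * defect a (y n) i q x\<bar>"
        by (simp add: sum_subtractf abs_triangle_ineq4)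
      also have "\<dots> \<le> ?k * (A * E) + ?k * (A * E)"
        using Suc.IH[OF that] by (intro add_mono lin that) (simp_all add: E_def)
      finally show ?thesis by (simp add: mult_ac)
    qed
    have "\<bar>integral {0..1} (\<lambda>t. t * (\<Sum>i\<in>UNIV. (\<theta> - c) $ i * ?R i (c + t *\<^sub>R (\<theta> - c))))\<bar>
        \<le> ?m * (\<epsilon> * (2 * (?k * (A * E))))"
    proof (rule abs_integral_01_le)
      show "continuous_on {0..1} (\<lambda>t. t * (\<Sum>i\<in>UNIV. (\<theta> - c) $ i * ?R i (c + t *\<^sub>R (\<theta> - c))))"
        by (intro continuous_on_mult continuous_on_sum continuous_on_const continuous_on_id
            continuous_on_cone_ray[OF B(2,3) cR Suc.prems])
      fix t :: real assume t: "t \<in> {0..1}"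
      have *: "\<bar>\<Sum>i\<in>UNIV. (\<theta> - c) $ i * ?R i (c + t *\<^sub>R (\<theta> - c))\<bar> \<le> ?m * (\<epsilon> * (2 * (?k * (A * E))))"
      proof (rule sum_UNIV_abs_le)
        fix i
        have "\<bar>(\<theta> - c) $ i\<bar> \<le> \<epsilon>"
          using order_trans[OF component_le_norm_cart[of "\<theta> - c" i]] Suc.prems
          by (simp add: B_def dist_norm norm_minus_commute)
        thus "\<bar>(\<theta> - c) $ i * ?R i (c + t *\<^sub>R (\<theta> - c))\<bar> \<le> \<epsilon> * (2 * (?k * (A * E)))"
          unfolding abs_mult[of "(\<theta> - c) $ i"] using \<epsilon>
          by (intro mult_mono bR cone_point_in[OF B(2,3) Suc.prems t]) auto
      qed
      show "\<bar>t * (\<Sum>i\<in>UNIV. (\<theta> - c) $ i * ?R i (c + t *\<^sub>R (\<theta> - c)))\<bar> \<le> ?m * (\<epsilon> * (2 * (?k * (A * E))))"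
        using mult_mono[OF _ *, of "\<bar>t\<bar>" 1] t by (simp add: abs_mult)
    qed
    also have "\<dots> \<le> E / 4"
      using mult_right_mono[OF small E0] by (simp add: algebra_simps)
    finally have 2: "\<bar>integral {0..1} (\<lambda>t. t * (\<Sum>i\<in>UNIV. (\<theta> - c) $ i * ?R i (c + t *\<^sub>R (\<theta> - c))))\<bar> \<le> E / 4" .
    have "defect a (y (Suc n)) j p \<theta> =
      (\<Sum>q\<in>UNIV. a j p q \<theta> * (y n q \<theta> - y (Suc n) q \<theta>)) +
      integral {0..1} (\<lambda>t. t * (\<Sum>i\<in>UNIV. (\<theta> - c) $ i * ?R i (c + t *\<^sub>R (\<theta> - c))))"
      unfolding y_def
      by (rule defect_picard_Suc[OF B a[folded B_def] flat[folded B_def] Suc.prems])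
    with 1 2 have "\<bar>defect a (y (Suc n)) j p \<theta>\<bar> \<le> E / 2" by linarith
    thus ?case by (simp add: E_def)
  qed
  show "\<theta> \<in> ball c \<epsilon> \<Longrightarrow>
      \<bar>picard a c y0 (Suc n) p \<theta> - picard a c y0 n p \<theta>\<bar> \<le> D * (1/2) ^ n"
    using ind1[of \<theta> n p] by (simp only: y_def B_def)
  show "\<theta> \<in> ball c \<epsilon> \<Longrightarrow>
      \<bar>defect a (picard a c y0 n) j p \<theta>\<bar> \<le> 4 * (real CARD('k) * (A * D)) * (1/2) ^ n"
    using ind2[of \<theta> n j p] by (simp only: y_def B_def)
qed

text \<open>
Frobenius' theorem for linear systems: a flat connection has a parallel section with any given
initial value. The Picard iterates converge uniformly, and since their defects tend to zero so do
their derivatives; therefore the limit is differentiable and solves the system.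
\<close>

theorem linear_total_differential_system:
  fixes a :: "'m::finite \<Rightarrow> 'k::finite \<Rightarrow> 'k \<Rightarrow> real^'m \<Rightarrow> real" and y0 :: "'k \<Rightarrow> real"
  assumes S: "open S" "c \<in> S" and a: "\<And>i p q. Ck_on (Suc 0) S (a i p q)"
    and flat: "\<And>\<theta> i j p q. \<theta> \<in> S \<Longrightarrow>
        pd i (a j p q) \<theta> + (\<Sum>r\<in>UNIV. a j p r \<theta> * a i r q \<theta>)
      = pd j (a i p q) \<theta> + (\<Sum>r\<in>UNIV. a i p r \<theta> * a j r q \<theta>)"
  obtains \<epsilon> y where "\<epsilon> > 0" "ball c \<epsilon> \<subseteq> S" "\<And>p. y p c = y0 p"
    "\<And>p \<theta>. \<theta> \<in> ball c \<epsilon> \<Longrightarrow> y p differentiable (at \<theta>)"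
    "\<And>p i \<theta>. \<theta> \<in> ball c \<epsilon> \<Longrightarrow> pd i (y p) \<theta> = (\<Sum>q\<in>UNIV. a i p q \<theta> * y q \<theta>)"
proof -
  let ?m = "real CARD('m)" and ?k = "real CARD('k)"
  obtain \<epsilon>0 where \<epsilon>0: "\<epsilon>0 > 0" "cball c \<epsilon>0 \<subseteq> S"
    using S open_contains_cball by blast
  have "\<exists>A. \<forall>\<theta>\<in>cball c \<epsilon>0. \<bar>a i p q \<theta>\<bar> \<le> A" for i p q
  proof -
    have "continuous_on (cball c \<epsilon>0) (a i p q)"
      using a[of i p q] \<epsilon>0(2)
      by (auto intro: continuous_on_subset differentiable_imp_continuous_on)
    from compact_imp_bounded[OF compact_continuous_image[OF this compact_cball]]
    show ?thesis by (auto simp: bounded_iff)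
  qed
  then obtain A where A: "\<And>i p q \<theta>. \<theta> \<in> cball c \<epsilon>0 \<Longrightarrow> \<bar>a i p q \<theta>\<bar> \<le> A i p q" by metis
  \<comment> \<open>the summand 1 makes the bound positive, so that the radius below is well defined\<close>
  define Amax where "Amax = 1 + (\<Sum>i\<in>UNIV. \<Sum>p\<in>UNIV. \<Sum>q\<in>UNIV. \<bar>A i p q\<bar>)"
  have AA: "\<bar>A i p q\<bar> \<le> Amax" for i p q
  proof -
    have "\<bar>A i p q\<bar> \<le> (\<Sum>q\<in>UNIV. \<bar>A i p q\<bar>)" by (rule member_le_sum) auto
    also have "\<dots> \<le> (\<Sum>p\<in>UNIV. \<Sum>q\<in>UNIV. \<bar>A i p q\<bar>)"
      by (rule member_le_sum) (auto intro: sum_nonneg)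
    also have "\<dots> \<le> (\<Sum>i\<in>UNIV. \<Sum>p\<in>UNIV. \<Sum>q\<in>UNIV. \<bar>A i p q\<bar>)"
      by (rule member_le_sum[where f = "\<lambda>i. \<Sum>p\<in>UNIV. \<Sum>q\<in>UNIV. \<bar>A i p q\<bar>"]) (auto intro: sum_nonneg)
    finally show ?thesis by (simp add: Amax_def)
  qed
  have Apos: "Amax > 0" unfolding Amax_def by (intro add_pos_nonneg sum_nonneg) auto
  define \<epsilon> where "\<epsilon> = min \<epsilon>0 (1 / (8 * (?m * (?k * Amax))))"
  have \<epsilon>: "\<epsilon> > 0" "\<epsilon> \<le> \<epsilon>0" using \<epsilon>0 Apos by (auto simp: \<epsilon>_def)
  have sub: "ball c \<epsilon> \<subseteq> cball c \<epsilon>0" "ball c \<epsilon> \<subseteq> S" using \<epsilon> \<epsilon>0 by (auto simp: subset_iff)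
  have "\<epsilon> * (8 * (?m * (?k * Amax))) \<le> 1"
  proof -
    have "\<epsilon> \<le> 1 / (8 * (?m * (?k * Amax)))" by (simp add: \<epsilon>_def)
    thus ?thesis using Apos by (subst (asm) pos_le_divide_eq) auto
  qed
  hence small: "8 * (?m * (\<epsilon> * (?k * Amax))) \<le> 1" by (simp add: mult_ac)
  define D where "D = (\<Sum>p\<in>UNIV. \<bar>y0 p\<bar>)"
  have D: "\<bar>y0 p\<bar> \<le> D" for p unfolding D_def by (rule member_le_sum) auto
  define B where "B = ball c \<epsilon>"
  define Y where "Y = picard a c y0"
  have aB: "Ck_on (Suc 0) B (a i p q)" for i p q
    using Ck_on_subset[OF a] sub by (simp add: B_def)
  have B: "open B" "convex B" "c \<in> B" using \<epsilon> by (auto simp: B_def)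
  have AB: "\<bar>a i p q \<theta>\<bar> \<le> Amax" if "\<theta> \<in> B" for i p q \<theta>
    using order_trans[OF A[of \<theta> i p q] order_trans[OF abs_ge_self AA]] that sub by (auto simp: B_def)
  have flatB: "pd i (a j p q) \<theta> + (\<Sum>r\<in>UNIV. a j p r \<theta> * a i r q \<theta>)
      = pd j (a i p q) \<theta> + (\<Sum>r\<in>UNIV. a i p r \<theta> * a j r q \<theta>)" if "\<theta> \<in> B" for i j p q \<theta>
    by (rule flat) (use that sub in \<open>auto simp: B_def\<close>)
  have est:
    "\<theta> \<in> B \<Longrightarrow> \<bar>Y (Suc n) p \<theta> - Y n p \<theta>\<bar> \<le> D * (1/2) ^ n"
    "\<theta> \<in> B \<Longrightarrow> \<bar>defect a (Y n) j p \<theta>\<bar> \<le> 4 * (?k * (Amax * D)) * (1/2) ^ n" for n j p \<theta>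
    unfolding B_def Y_def
    by (rule picard_estimates(1)[OF \<epsilon>(1) aB[unfolded B_def] _ _ small D],
        rule flatB[unfolded B_def], assumption, rule AB[unfolded B_def], assumption, assumption)
      (rule picard_estimates(2)[OF \<epsilon>(1) aB[unfolded B_def] _ _ small D],
        rule flatB[unfolded B_def], assumption, rule AB[unfolded B_def], assumption, assumption)
  define y where "y p \<theta> = lim (\<lambda>n. Y n p \<theta>)" for p \<theta>
  have y: "(\<lambda>n. Y n p \<theta>) \<longlonglongrightarrow> y p \<theta>" "\<bar>Y n p \<theta> - y p \<theta>\<bar> \<le> 2 * D * (1/2) ^ n"
    if \<theta>: "\<theta> \<in> B" for p \<theta> n
  proof -
    obtain l where l: "(\<lambda>n. Y n p \<theta>) \<longlonglongrightarrow> l" "\<And>n. \<bar>Y n p \<theta> - l\<bar> \<le> 2 * D * (1/2) ^ n"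
      by (rule geometric_increments_converge[of "\<lambda>n. Y n p \<theta>", OF est(1)[OF \<theta>]]) blast
    have "y p \<theta> = l" unfolding y_def by (rule limI[OF l(1)])
    with l show "(\<lambda>n. Y n p \<theta>) \<longlonglongrightarrow> y p \<theta>" "\<bar>Y n p \<theta> - y p \<theta>\<bar> \<le> 2 * D * (1/2) ^ n"
      by simp_all
  qed
  define g' where "g' p x h = (\<Sum>j\<in>UNIV. h $ j * (\<Sum>q\<in>UNIV. a j p q x * y q x))" for p x and h :: "real^'m"
  define M where "M = 4 * (?k * (Amax * D)) + ?k * (Amax * (2 * D))"
  have D0: "D \<ge> 0" by (simp add: D_def sum_nonneg)
  have M0: "M \<ge> 0" using D0 Apos by (simp add: M_def)
  have pd_close: "\<bar>pd j (Y n p) x - (\<Sum>q\<in>UNIV. a j p q x * y q x)\<bar> \<le> M * (1/2) ^ n"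
    if x: "x \<in> B" for j n p x
  proof -
    have "\<bar>\<Sum>q\<in>UNIV. a j p q x * (Y n q x - y q x)\<bar> \<le> ?k * (Amax * (2 * D * (1/2) ^ n))"
      by (rule sum_UNIV_abs_le, unfold abs_mult, intro mult_mono AB y x)
        (use Apos in auto)
    moreover have "\<bar>defect a (Y n) j p x\<bar> \<le> 4 * (?k * (Amax * D)) * (1/2) ^ n"
      by (rule est(2)[OF x])
    moreover have "pd j (Y n p) x - (\<Sum>q\<in>UNIV. a j p q x * y q x)
        = defect a (Y n) j p x + (\<Sum>q\<in>UNIV. a j p q x * (Y n q x - y q x))"
      by (simp add: defect_def right_diff_distrib sum_subtractf)
    moreover have "M * (1/2) ^ n = 4 * (?k * (Amax * D)) * (1/2) ^ n + ?k * (Amax * (2 * D * (1/2) ^ n))"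
      by (simp add: M_def algebra_simps)
    ultimately show ?thesis by linarith
  qed
  have der: "(y p has_derivative g' p x) (at x)" if x: "x \<in> B" for p x
  proof -
    have "\<exists>g. \<forall>x\<in>B. (\<lambda>n. Y n p x) \<longlonglongrightarrow> g x \<and> (g has_derivative g' p x) (at x within B)"
    proof (rule has_derivative_sequence[where f = "\<lambda>n. Y n p" and ?x0.0 = c and l = "y p c",
          OF B(2) _ _ B(3) y(1)[OF B(3)]])
      fix n x assume x: "x \<in> B"
      have "Y n p differentiable (at x)"
        using picard_C1[OF B aB] unfolding Y_def by (rule Ck_on_differentiable_at[OF _ B(1) x])
      thus "(Y n p has_derivative (\<lambda>h. \<Sum>j\<in>UNIV. h $ j * pd j (Y n p) x)) (at x within B)"
        by (rule has_derivative_at_withinI[OF has_derivative_pd])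
    next
      fix e :: real assume e: "e > 0"
      have "(\<lambda>n. ?m * M * (1/2) ^ n) \<longlonglongrightarrow> 0"
        using tendsto_mult_right_zero[OF LIMSEQ_power_zero[of "1/2::real"], of "?m * M"] by simp
      hence "\<forall>\<^sub>F n in sequentially. ?m * M * (1/2) ^ n < e"
        using e by (rule order_tendstoD(2))
      thus "\<forall>\<^sub>F n in sequentially. \<forall>x\<in>B. \<forall>h.
          norm ((\<Sum>j\<in>UNIV. h $ j * pd j (Y n p) x) - g' p x h) \<le> e * norm h"
      proof (rule eventually_mono, intro ballI allI)
        fix n x and h :: "real^'m" assume n: "?m * M * (1/2) ^ n < e" and x: "x \<in> B"
        have "(\<Sum>j\<in>UNIV. h $ j * pd j (Y n p) x) - g' p x h
            = (\<Sum>j\<in>UNIV. h $ j * (pd j (Y n p) x - (\<Sum>q\<in>UNIV. a j p q x * y q x)))"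
          by (simp add: g'_def right_diff_distrib sum_subtractf)
        also have "\<bar>\<dots>\<bar> \<le> ?m * (norm h * (M * (1/2) ^ n))"
          by (rule sum_UNIV_abs_le, unfold abs_mult, intro mult_mono pd_close x component_le_norm_cart)
            auto
        also have "\<dots> = (?m * M * (1/2) ^ n) * norm h" by simp
        also have "\<dots> \<le> e * norm h" using n by (intro mult_right_mono) auto
        finally show "norm ((\<Sum>j\<in>UNIV. h $ j * pd j (Y n p) x) - g' p x h) \<le> e * norm h" by simp
      qed
    qed
    then obtain g where g: "\<And>x. x \<in> B \<Longrightarrow> (\<lambda>n. Y n p x) \<longlonglongrightarrow> g x"
        "(g has_derivative g' p x) (at x within B)"
      using x by blast
    have "g z = y p z" if "z \<in> B" for z
      using LIMSEQ_unique[OF g(1)[OF that] y(1)[OF that]] .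
    moreover have "(g has_derivative g' p x) (at x)"
      using g(2) by (simp add: at_within_open[OF x B(1)])
    ultimately show ?thesis
      using has_derivative_transform_within_open[OF _ B(1) x] by blast
  qed
  show ?thesis
  proof (rule that[OF \<epsilon>(1) sub(2), of y])
    fix p
    have "Y n p c = y0 p" for n
      by (cases n) (simp_all add: Y_def cone_integral_def)
    hence "(\<lambda>n. y0 p) \<longlonglongrightarrow> y p c" using y(1)[OF B(3), of p] by simp
    thus "y p c = y0 p" by (simp add: LIMSEQ_const_iff)
  next
    fix p \<theta> assume "\<theta> \<in> ball c \<epsilon>"
    with der[of \<theta> p] show "y p differentiable (at \<theta>)" by (auto simp: B_def differentiable_def)
  next
    fix p i \<theta> assume "\<theta> \<in> ball c \<epsilon>"
    with der[of \<theta> p] have "pd i (y p) \<theta> = g' p \<theta> (axis i 1)" by (simp add: B_def pd_eqI)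
    also have "\<dots> = (\<Sum>q\<in>UNIV. a i p q \<theta> * y q \<theta>)"
      by (simp add: g'_def axis_def if_distrib if_distribR sum.delta cong: if_cong)
    finally show "pd i (y p) \<theta> = (\<Sum>q\<in>UNIV. a i p q \<theta> * y q \<theta>)" .
  qed
qed

text \<open>
Bootstrapping: the partial derivatives of a solution are combinations of its own components with
smooth coefficients, so each component is as often differentiable as the components are, plus one.
\<close>

lemma total_differential_solution_smooth:
  fixes a :: "'m::finite \<Rightarrow> 'k::finite \<Rightarrow> 'k \<Rightarrow> real^'m \<Rightarrow> real"
  assumes U: "open U" and a: "\<And>i p q. smooth_on U (a i p q)"
    and y: "\<And>p \<theta>. \<theta> \<in> U \<Longrightarrow> y p differentiable (at \<theta>)"
    and pd_y: "\<And>p i \<theta>. \<theta> \<in> U \<Longrightarrow> pd i (y p) \<theta> = (\<Sum>q\<in>UNIV. a i p q \<theta> * y q \<theta>)"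
  shows "smooth_on U (y p)"
  unfolding smooth_on_def
proof
  fix n
  have d: "y p differentiable_on U" for p
    using y U by (simp add: differentiable_on_eq_differentiable_at)
  show "Ck_on n U (y p)"
  proof (induction n arbitrary: p)
    case 0
    show ?case using differentiable_imp_continuous_on[OF d] by simp
  next
    case (Suc n)
    have "Ck_on n U (\<lambda>\<theta>. \<Sum>q\<in>UNIV. a i p q \<theta> * y q \<theta>)" for i
      by (intro Ck_on_sum Ck_on_mult U Suc.IH) (use a in \<open>simp add: smooth_on_def\<close>)
    hence "Ck_on n U (pd i (y p))" for i
      by (subst Ck_on_cong[OF U pd_y])
    with d show ?case by simp
  qed
qed

section \<open>Curvature and projective changes of a connection\<close>

text \<open>
The Kronecker symbol as a constant of its own, so that contractions with it are rewrite rules and no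
case distinctions arise.
\<close>

definition kron :: "'m \<Rightarrow> 'm \<Rightarrow> real" where
  "kron i j = (if i = j then 1 else 0)"

lemma kron_same [simp]: "kron i i = 1"
  by (simp add: kron_def)

lemma sum_kron [simp]:
  fixes l :: "'m::finite"
  shows "(\<Sum>r\<in>UNIV. kron r l * F r) = F l" "(\<Sum>r\<in>UNIV. kron l r * F r) = F l"
    "(\<Sum>r\<in>UNIV. F r * kron r l) = F l" "(\<Sum>r\<in>UNIV. F r * kron l r) = F l"
  by (simp_all add: kron_def if_distrib if_distribR sum.delta cong: if_cong)

text \<open>
The curvature depends on the metric only through the raised coefficients.
\<close>

definition curv_of ::
  "('m::finite \<Rightarrow> 'm \<Rightarrow> 'm \<Rightarrow> real^'m \<Rightarrow> real) \<Rightarrow> 'm \<Rightarrow> 'm \<Rightarrow> 'm \<Rightarrow> 'm \<Rightarrow> real^'m \<Rightarrow> real" where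
  "curv_of \<gamma> i j k l \<theta> = pd i (\<gamma> j k l) \<theta> - pd j (\<gamma> i k l) \<theta>
     + (\<Sum>r\<in>UNIV. \<gamma> i r l \<theta> * \<gamma> j k r \<theta>) - (\<Sum>r\<in>UNIV. \<gamma> j r l \<theta> * \<gamma> i k r \<theta>)"

lemma curv_eq_curv_of: "curv G \<Gamma> = curv_of (raise_conn G \<Gamma>)"
  by (intro ext) (simp add: curv_def curv_of_def)

lemma curv_of_cong:
  assumes U: "open U" "\<theta> \<in> U" and eq: "\<And>i j k x. x \<in> U \<Longrightarrow> \<gamma> i j k x = \<gamma>' i j k x"
  shows "curv_of \<gamma> i j k l \<theta> = curv_of \<gamma>' i j k l \<theta>"
proof -
  have "pd i (\<gamma> j k l) \<theta> = pd i (\<gamma>' j k l) \<theta>" for i j k l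
    by (rule pd_cong[OF U eq])
  thus ?thesis by (simp only: curv_of_def eq[OF U(2)])
qed

text \<open>
A change \<open>\<gamma>\<^sub>i\<^sub>j\<^sup>l + \<sigma>\<^sub>i\<delta>\<^sub>j\<^sup>l + \<sigma>\<^sub>j\<delta>\<^sub>i\<^sup>l\<close> of a torsion-free connection by a closed 1-form \<open>\<sigma>\<close>
preserves unparametrized geodesics. In the change of the curvature, \<open>P = \<nabla>\<sigma> - \<sigma> \<otimes> \<sigma>\<close>; symmetry of
\<open>\<gamma>\<close> and closedness of \<open>\<sigma>\<close> remove all other terms.
\<close>

lemma curv_of_projective_change:
  fixes \<gamma> :: "'m::finite \<Rightarrow> 'm \<Rightarrow> 'm \<Rightarrow> real^'m \<Rightarrow> real"
  assumes U: "open U" "\<theta> \<in> U"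
    and \<gamma>: "\<And>i j l. \<gamma> i j l differentiable (at \<theta>)" "\<And>i j l. \<gamma> i j l \<theta> = \<gamma> j i l \<theta>"
    and \<sigma>: "\<And>i. \<sigma> i differentiable (at \<theta>)" "\<And>i j. pd i (\<sigma> j) \<theta> = pd j (\<sigma> i) \<theta>"
    and \<gamma>': "\<And>i j l x. x \<in> U \<Longrightarrow> \<gamma>' i j l x = \<gamma> i j l x + \<sigma> i x * kron j l + \<sigma> j x * kron i l"
  defines "P \<equiv> \<lambda>i k. pd i (\<sigma> k) \<theta> - (\<Sum>r\<in>UNIV. \<gamma> i k r \<theta> * \<sigma> r \<theta>) - \<sigma> i \<theta> * \<sigma> k \<theta>"
  shows "curv_of \<gamma>' i j k l \<theta> = curv_of \<gamma> i j k l \<theta> + kron j l * P i k - kron i l * P j k"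
proof -
  have pd': "pd i (\<gamma>' j k l) \<theta> = pd i (\<gamma> j k l) \<theta> + pd i (\<sigma> j) \<theta> * kron k l + pd i (\<sigma> k) \<theta> * kron j l"
    for i j k l
  proof -
    have "pd i (\<gamma>' j k l) \<theta> = pd i (\<lambda>x. \<gamma> j k l x + kron k l * \<sigma> j x + kron j l * \<sigma> k x) \<theta>"
      by (rule pd_cong[OF U]) (simp add: \<gamma>' mult.commute)
    also have "\<dots> = pd i (\<gamma> j k l) \<theta> + pd i (\<sigma> j) \<theta> * kron k l + pd i (\<sigma> k) \<theta> * kron j l"
      by (simp add: pd_add pd_cmult \<gamma> \<sigma>)
    finally show ?thesis .
  qed
  have quad: "(\<Sum>r\<in>UNIV. \<gamma>' i r l \<theta> * \<gamma>' j k r \<theta>) = (\<Sum>r\<in>UNIV. \<gamma> i r l \<theta> * \<gamma> j k r \<theta>)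
     + \<sigma> j \<theta> * \<gamma> i k l \<theta> + \<sigma> k \<theta> * \<gamma> i j l \<theta> + \<sigma> i \<theta> * \<gamma> j k l \<theta>
     + \<sigma> i \<theta> * \<sigma> j \<theta> * kron k l + \<sigma> i \<theta> * \<sigma> k \<theta> * kron j l
     + kron i l * ((\<Sum>r\<in>UNIV. \<gamma> j k r \<theta> * \<sigma> r \<theta>) + 2 * \<sigma> j \<theta> * \<sigma> k \<theta>)" for i j k l
  proof -
    have "(\<Sum>r\<in>UNIV. \<gamma>' i r l \<theta> * \<gamma>' j k r \<theta>) = (\<Sum>r\<in>UNIV. \<gamma> i r l \<theta> * \<gamma> j k r \<theta>
       + \<sigma> j \<theta> * (\<gamma> i r l \<theta> * kron k r) + \<sigma> k \<theta> * (\<gamma> i r l \<theta> * kron j r)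
       + \<sigma> i \<theta> * (kron r l * \<gamma> j k r \<theta>) + \<sigma> i \<theta> * \<sigma> j \<theta> * (kron r l * kron k r)
       + \<sigma> i \<theta> * \<sigma> k \<theta> * (kron r l * kron j r)
       + kron i l * (\<gamma> j k r \<theta> * \<sigma> r \<theta>) + kron i l * \<sigma> j \<theta> * (\<sigma> r \<theta> * kron k r)
       + kron i l * \<sigma> k \<theta> * (\<sigma> r \<theta> * kron j r))"
      unfolding \<gamma>'[OF U(2)] by (intro sum.cong refl) (simp add: algebra_simps)
    also have "\<dots> = (\<Sum>r\<in>UNIV. \<gamma> i r l \<theta> * \<gamma> j k r \<theta>)
       + \<sigma> j \<theta> * \<gamma> i k l \<theta> + \<sigma> k \<theta> * \<gamma> i j l \<theta> + \<sigma> i \<theta> * \<gamma> j k l \<theta>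
       + \<sigma> i \<theta> * \<sigma> j \<theta> * kron k l + \<sigma> i \<theta> * \<sigma> k \<theta> * kron j l
       + kron i l * (\<Sum>r\<in>UNIV. \<gamma> j k r \<theta> * \<sigma> r \<theta>) + kron i l * \<sigma> j \<theta> * \<sigma> k \<theta>
       + kron i l * \<sigma> k \<theta> * \<sigma> j \<theta>"
      by (simp only: sum.distrib sum_distrib_left[symmetric] sum_kron)
    finally show ?thesis by (simp add: algebra_simps)
  qed
  show ?thesis
    unfolding curv_of_def pd' quad P_def
    by (simp add: \<gamma>(2)[of j i l] \<sigma>(2)[of j i] algebra_simps)
qed

lemma invertible_matrix_sums:
  fixes A :: "real^'m^'m"
  assumes "invertible A"
  shows "(\<Sum>r\<in>UNIV. A $ i $ r * matrix_inv A $ r $ j) = kron i j"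
    and "(\<Sum>r\<in>UNIV. matrix_inv A $ i $ r * A $ r $ j) = kron i j"
  using matrix_inv_works[OF assms]
  by (simp_all add: matrix_matrix_mult_def mat_def vec_eq_iff kron_def)

lemma matrix_inv_symmetric:
  fixes A :: "real^'m^'m"
  assumes "invertible A" "\<And>i j. A $ i $ j = A $ j $ i"
  shows "matrix_inv A $ i $ j = matrix_inv A $ j $ i"
proof -
  have t: "transpose A = A" using assms(2) by (simp add: transpose_def vec_eq_iff)
  have "A ** transpose (matrix_inv A) = transpose (matrix_inv A ** A)"
    "transpose (matrix_inv A) ** A = transpose (A ** matrix_inv A)"
    by (simp_all add: matrix_transpose_mul t)
  hence sym: "matrix_inv A = transpose (matrix_inv A)"
    by (intro matrix_inv_unique) (simp_all add: matrix_inv_works[OF assms(1)] transpose_mat)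
  show ?thesis by (subst sym) (simp add: transpose_def)
qed

section \<open>Dual connections and conformal transformations\<close>

text \<open>
The part of a statistical manifold on which the tensor calculus relies: a smooth nondegenerate
\<open>g\<close> and a smooth \<open>T\<close>. The symmetry of both follows from their definition as moments of
the score. Families of densities enter only through these two tensors, so the locale also serves
for an exponential family.
\<close>

locale statistical_structure =
  fixes U :: "(real^'m::finite) set" and \<mu> :: "'x measure" and f :: "'x \<Rightarrow> real^'m \<Rightarrow> real"
  assumes U: "open U"
    and g_smooth: "\<And>i j. smooth_on U (\<lambda>\<theta>. fisher \<mu> f \<theta> $ i $ j)"
    and T_smooth: "\<And>i j k. smooth_on U (skew \<mu> f i j k)"
    and g_invertible: "\<And>\<theta>. \<theta> \<in> U \<Longrightarrow> invertible (fisher \<mu> f \<theta>)"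
begin

abbreviation g where "g \<equiv> fisher \<mu> f"
abbreviation h where "h \<theta> \<equiv> matrix_inv (fisher \<mu> f \<theta>)"
abbreviation T where "T \<equiv> skew \<mu> f"

definition conn :: "real \<Rightarrow> 'm \<Rightarrow> 'm \<Rightarrow> 'm \<Rightarrow> real^'m \<Rightarrow> real" where
  "conn \<alpha> i j k \<theta> = levi_civita g i j k \<theta> - \<alpha> / 2 * T i j k \<theta>"

abbreviation \<gamma> where "\<gamma> \<alpha> \<equiv> raise_conn g (conn \<alpha>)"

definition curv_lower :: "real \<Rightarrow> 'm \<Rightarrow> 'm \<Rightarrow> 'm \<Rightarrow> 'm \<Rightarrow> real^'m \<Rightarrow> real" where
  "curv_lower \<alpha> i j k l \<theta> = (\<Sum>r\<in>UNIV. curv g (conn \<alpha>) i j k r \<theta> * g \<theta> $ r $ l)"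

lemma g_sym: "g \<theta> $ i $ j = g \<theta> $ j $ i"
  by (simp add: fisher_def mult.commute)

lemma T_sym: "T i j k \<theta> = T j i k \<theta>" "T i j k \<theta> = T i k j \<theta>"
  by (simp_all add: skew_def mult_ac)

lemma h_sym: "\<theta> \<in> U \<Longrightarrow> h \<theta> $ i $ j = h \<theta> $ j $ i"
  by (rule matrix_inv_symmetric[OF g_invertible g_sym])

lemma g_h: "\<theta> \<in> U \<Longrightarrow> (\<Sum>r\<in>UNIV. g \<theta> $ i $ r * h \<theta> $ r $ j) = kron i j"
  and h_g: "\<theta> \<in> U \<Longrightarrow> (\<Sum>r\<in>UNIV. h \<theta> $ i $ r * g \<theta> $ r $ j) = kron i j"
  using invertible_matrix_sums[OF g_invertible] by blast+

lemma conn_sym: "conn \<alpha> i j k \<theta> = conn \<alpha> j i k \<theta>"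
  unfolding conn_def levi_civita_def g_sym[of _ i j] T_sym(1)[of i j] by simp

lemma \<gamma>_sym: "\<gamma> \<alpha> i j l \<theta> = \<gamma> \<alpha> j i l \<theta>"
  by (simp add: raise_conn_def conn_sym[of \<alpha> i j])

text \<open>
Duality of the \<open>\<alpha>\<close>- and the \<open>-\<alpha>\<close>-connection with respect to \<open>g\<close>: the multiples of \<open>T\<close> cancel, and
the Levi-Civita connection is its own dual.
\<close>

lemma metric_compatible: "pd k (\<lambda>x. g x $ i $ j) \<theta> = conn \<alpha> k i j \<theta> + conn (- \<alpha>) k j i \<theta>"
proof -
  have g: "pd a (\<lambda>x. g x $ b $ c) \<theta> = pd a (\<lambda>x. g x $ c $ b) \<theta>" for a b c
    by (simp only: g_sym[of _ b c])
  show ?thesis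
    using T_sym(2)[of k j i \<theta>] g[of i k j] g[of j k i] g[of k j i]
    by (simp add: conn_def levi_civita_def add_divide_distrib diff_divide_distrib)
qed

lemma lower_\<gamma>:
  assumes "\<theta> \<in> U"
  shows "(\<Sum>l\<in>UNIV. \<gamma> \<alpha> i j l \<theta> * g \<theta> $ l $ k) = conn \<alpha> i j k \<theta>"
proof -
  have "(\<Sum>l\<in>UNIV. \<gamma> \<alpha> i j l \<theta> * g \<theta> $ l $ k)
      = (\<Sum>l\<in>UNIV. \<Sum>r\<in>UNIV. conn \<alpha> i j r \<theta> * (h \<theta> $ r $ l * g \<theta> $ l $ k))"
    by (simp add: raise_conn_def sum_distrib_right mult.assoc)
  also have "\<dots> = (\<Sum>r\<in>UNIV. conn \<alpha> i j r \<theta> * kron r k)"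
    by (subst sum.swap) (simp add: sum_distrib_left[symmetric] h_g[OF assms])
  finally show ?thesis by simp
qed

lemma conn_smooth: "smooth_on U (conn \<alpha> i j k)"
proof -
  have "smooth_on U (\<lambda>\<theta>. (1/2) * (pd i (\<lambda>x. g x $ j $ k) \<theta> + pd j (\<lambda>x. g x $ i $ k) \<theta>
      - pd k (\<lambda>x. g x $ i $ j) \<theta>) - (\<alpha> / 2) * T i j k \<theta>)"
    by (intro smooth_on_intros smooth_on_pd g_smooth T_smooth U)
  thus ?thesis by (simp add: conn_def[abs_def] levi_civita_def)
qed

lemma \<gamma>_smooth: "smooth_on U (\<gamma> \<alpha> i j l)"
  unfolding raise_conn_def[abs_def]
  by (intro smooth_on_intros conn_smooth smooth_on_matrix_inv g_smooth g_invertible U)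

lemma differentiable_at:
  assumes "\<theta> \<in> U"
  shows "(\<lambda>x. g x $ i $ j) differentiable (at \<theta>)" "conn \<alpha> i j k differentiable (at \<theta>)"
    "\<gamma> \<alpha> i j k differentiable (at \<theta>)"
  using g_smooth conn_smooth \<gamma>_smooth by (blast intro: smooth_on_differentiable_at U assms)+

text \<open>
Lowering the last index of the curvature produces derivatives of \<open>g\<close>. By duality these combine with
the quadratic terms, and the products that remain pair a coefficient of the connection with one of
its dual. This form shows the behaviour under \<open>\<alpha> \<mapsto> -\<alpha>\<close>.
\<close>

lemma curv_lower_eq:
  assumes \<theta>: "\<theta> \<in> U"
  shows "curv_lower \<alpha> i j k l \<theta> = pd i (conn \<alpha> j k l) \<theta> - pd j (conn \<alpha> i k l) \<theta>
     - (\<Sum>r\<in>UNIV. \<gamma> \<alpha> j k r \<theta> * conn (- \<alpha>) i l r \<theta>) + (\<Sum>r\<in>UNIV. \<gamma> \<alpha> i k r \<theta> * conn (- \<alpha>) j l r \<theta>)"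
proof -
  have deriv: "(\<Sum>r\<in>UNIV. pd i (\<gamma> \<alpha> j k r) \<theta> * g \<theta> $ r $ l) = pd i (conn \<alpha> j k l) \<theta>
     - (\<Sum>r\<in>UNIV. \<gamma> \<alpha> j k r \<theta> * conn \<alpha> i r l \<theta>) - (\<Sum>r\<in>UNIV. \<gamma> \<alpha> j k r \<theta> * conn (- \<alpha>) i l r \<theta>)" for i j
  proof -
    have "pd i (conn \<alpha> j k l) \<theta> = pd i (\<lambda>x. \<Sum>r\<in>UNIV. \<gamma> \<alpha> j k r x * g x $ r $ l) \<theta>"
      by (rule pd_cong[OF U \<theta>]) (simp add: lower_\<gamma>)
    also have "\<dots> = (\<Sum>r\<in>UNIV. pd i (\<gamma> \<alpha> j k r) \<theta> * g \<theta> $ r $ l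
        + \<gamma> \<alpha> j k r \<theta> * (conn \<alpha> i r l \<theta> + conn (- \<alpha>) i l r \<theta>))"
      by (simp add: pd_sum pd_mult differentiable_at[OF \<theta>] metric_compatible[of i _ l \<theta> \<alpha>])
    finally show ?thesis by (simp add: sum.distrib distrib_left)
  qed
  have quad: "(\<Sum>r\<in>UNIV. (\<Sum>s\<in>UNIV. \<gamma> \<alpha> i s r \<theta> * \<gamma> \<alpha> j k s \<theta>) * g \<theta> $ r $ l)
      = (\<Sum>s\<in>UNIV. \<gamma> \<alpha> j k s \<theta> * conn \<alpha> i s l \<theta>)" for i j
  proof -
    have "(\<Sum>r\<in>UNIV. (\<Sum>s\<in>UNIV. \<gamma> \<alpha> i s r \<theta> * \<gamma> \<alpha> j k s \<theta>) * g \<theta> $ r $ l)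
       = (\<Sum>s\<in>UNIV. \<gamma> \<alpha> j k s \<theta> * (\<Sum>r\<in>UNIV. \<gamma> \<alpha> i s r \<theta> * g \<theta> $ r $ l))"
      unfolding sum_distrib_right sum_distrib_left by (subst sum.swap) (simp add: mult_ac)
    thus ?thesis by (simp add: lower_\<gamma>[OF \<theta>])
  qed
  have "curv_lower \<alpha> i j k l \<theta> = (\<Sum>r\<in>UNIV. pd i (\<gamma> \<alpha> j k r) \<theta> * g \<theta> $ r $ l)
      - (\<Sum>r\<in>UNIV. pd j (\<gamma> \<alpha> i k r) \<theta> * g \<theta> $ r $ l)
      + (\<Sum>r\<in>UNIV. (\<Sum>s\<in>UNIV. \<gamma> \<alpha> i s r \<theta> * \<gamma> \<alpha> j k s \<theta>) * g \<theta> $ r $ l)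
      - (\<Sum>r\<in>UNIV. (\<Sum>s\<in>UNIV. \<gamma> \<alpha> j s r \<theta> * \<gamma> \<alpha> i k s \<theta>) * g \<theta> $ r $ l)"
    by (simp only: curv_lower_def curv_def sum.distrib sum_subtractf distrib_right left_diff_distrib)
  thus ?thesis unfolding deriv quad by simp
qed

text \<open>
In the sum of the two curvatures the quadratic terms cancel since \<open>g\<close> is symmetric, and the
derivative terms are \<open>\<partial>\<^sub>i\<partial>\<^sub>j g\<^sub>k\<^sub>l - \<partial>\<^sub>j\<partial>\<^sub>i g\<^sub>k\<^sub>l\<close>, by duality of the connections.
\<close>

theorem curv_lower_dual:
  assumes \<theta>: "\<theta> \<in> U"
  shows "curv_lower (- \<alpha>) i j k l \<theta> = - curv_lower \<alpha> i j l k \<theta>"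
proof -
  have pairing: "(\<Sum>r\<in>UNIV. \<gamma> \<alpha> i j r \<theta> * conn \<beta> k l r \<theta>) = (\<Sum>r\<in>UNIV. \<gamma> \<beta> k l r \<theta> * conn \<alpha> i j r \<theta>)"
    for \<alpha> \<beta> i j k l
  proof -
    have "(\<Sum>r\<in>UNIV. \<gamma> \<alpha> i j r \<theta> * conn \<beta> k l r \<theta>)
        = (\<Sum>r\<in>UNIV. \<Sum>s\<in>UNIV. conn \<alpha> i j s \<theta> * h \<theta> $ s $ r * conn \<beta> k l r \<theta>)"
      by (simp add: raise_conn_def sum_distrib_right)
    also have "\<dots> = (\<Sum>s\<in>UNIV. \<Sum>r\<in>UNIV. conn \<beta> k l r \<theta> * h \<theta> $ r $ s * conn \<alpha> i j s \<theta>)"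
      by (subst sum.swap, intro sum.cong refl, subst h_sym[OF \<theta>]) (simp add: mult_ac)
    finally show ?thesis by (simp add: raise_conn_def sum_distrib_right)
  qed
  have "pd i (conn (- \<alpha>) j k l) \<theta> + pd i (conn \<alpha> j l k) \<theta>
      = pd j (conn (- \<alpha>) i k l) \<theta> + pd j (conn \<alpha> i l k) \<theta>"
  proof -
    have *: "pd i (conn (- \<alpha>) j k l) \<theta> + pd i (conn \<alpha> j l k) \<theta> = pd i (pd j (\<lambda>x. g x $ l $ k)) \<theta>" for i j
    proof -
      have "pd j (\<lambda>x. g x $ l $ k) = (\<lambda>x. conn \<alpha> j l k x + conn (- \<alpha>) j k l x)"
        by (rule ext) (rule metric_compatible)
      thus ?thesis by (simp add: pd_add differentiable_at[OF \<theta>])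
    qed
    have "pd i (pd j (\<lambda>x. g x $ l $ k)) \<theta> = pd j (pd i (\<lambda>x. g x $ l $ k)) \<theta>"
      using g_smooth[of l k] unfolding smooth_on_def by (blast intro: pd_commute[OF U \<theta>])
    thus ?thesis unfolding * .
  qed
  thus ?thesis
    unfolding curv_lower_eq[OF \<theta>] minus_minus
      pairing[of "- \<alpha>" j k \<alpha> i l] pairing[of "- \<alpha>" i k \<alpha> j l] by simp
qed


lemma curv_cong:
  assumes "open V" "\<theta> \<in> V" "\<And>i j k x. x \<in> V \<Longrightarrow> \<Gamma> i j k x = conn \<alpha> i j k x"
  shows "curv g \<Gamma> i j k l \<theta> = curv g (conn \<alpha>) i j k l \<theta>"
  unfolding curv_eq_curv_of
  by (rule curv_of_cong[OF assms(1,2)]) (simp add: raise_conn_def assms(3))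

lemma curv_eq_raised_lower:
  assumes \<theta>: "\<theta> \<in> U"
  shows "curv g (conn \<alpha>) i j k l \<theta> = (\<Sum>p\<in>UNIV. curv_lower \<alpha> i j k p \<theta> * h \<theta> $ p $ l)"
proof -
  have "(\<Sum>p\<in>UNIV. curv_lower \<alpha> i j k p \<theta> * h \<theta> $ p $ l)
      = (\<Sum>p\<in>UNIV. \<Sum>r\<in>UNIV. curv g (conn \<alpha>) i j k r \<theta> * (g \<theta> $ r $ p * h \<theta> $ p $ l))"
    by (simp add: curv_lower_def sum_distrib_right mult.assoc)
  also have "\<dots> = (\<Sum>r\<in>UNIV. curv g (conn \<alpha>) i j k r \<theta> * kron r l)"
    by (subst sum.swap) (simp add: sum_distrib_left[symmetric] g_h[OF \<theta>])
  finally show ?thesis by simp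
qed

text \<open>
For \<open>\<alpha> = -1\<close> the two kinds of terms that \<open>\<sigma> = d ln \<nu>\<close> contributes, through the Levi-Civita
connection of \<open>\<nu>g\<close> and through the conformal change of \<open>T\<close>, combine so that the term
\<open>g\<^sub>i\<^sub>j\<sigma>\<^sup>l\<close> drops out. What is left is a projective change.
\<close>

lemma raise_conf_conn:
  assumes \<nu>: "\<nu> differentiable (at \<theta>)" "\<nu> \<theta> > 0" and \<theta>: "\<theta> \<in> U"
  defines "\<sigma> \<equiv> \<lambda>a. pd a (\<lambda>x. ln (\<nu> x))"
  shows "raise_conn (conf_metric \<mu> f \<nu>) (conf_conn \<mu> f \<nu> (-1)) i j l \<theta>
      = \<gamma> (-1) i j l \<theta> + \<sigma> i \<theta> * kron j l + \<sigma> j \<theta> * kron i l"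
proof -
  have pd\<nu>: "pd a \<nu> \<theta> = \<nu> \<theta> * \<sigma> a \<theta>" for a
    using \<nu> pd_ln(1)[OF \<nu>, of a] by (simp add: \<sigma>_def)
  have \<sigma>': "pd a (\<lambda>x. ln (\<nu> x)) \<theta> = \<sigma> a \<theta>" for a by (simp add: \<sigma>_def)
  have pdG: "pd a (\<lambda>x. conf_metric \<mu> f \<nu> x $ b $ c) \<theta>
      = \<nu> \<theta> * (\<sigma> a \<theta> * g \<theta> $ b $ c + pd a (\<lambda>x. g x $ b $ c) \<theta>)" for a b c
    by (simp add: conf_metric_def pd_mult \<nu> differentiable_at[OF \<theta>] pd\<nu> algebra_simps)
  have low: "conf_conn \<mu> f \<nu> (-1) a b c \<theta>
      = \<nu> \<theta> * (conn (-1) a b c \<theta> + \<sigma> a \<theta> * g \<theta> $ b $ c + \<sigma> b \<theta> * g \<theta> $ a $ c)" for a b c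
    unfolding conf_conn_def levi_civita_def conf_skew_def Let_def pdG conn_def
    by (simp add: \<sigma>' g_sym[of \<theta> c a] algebra_simps add_divide_distrib diff_divide_distrib)
  have cancel: "\<nu> \<theta> * x * (inverse (\<nu> \<theta>) * y) = x * y"
    "inverse (\<nu> \<theta>) * x * (\<nu> \<theta> * y) = x * y" for x y
    using \<nu>(2) by simp_all
  have inv: "matrix_inv (conf_metric \<mu> f \<nu> \<theta>) $ r $ l = inverse (\<nu> \<theta>) * h \<theta> $ r $ l" for r l
  proof -
    have "matrix_inv (conf_metric \<mu> f \<nu> \<theta>) = (\<chi> r l. inverse (\<nu> \<theta>) * h \<theta> $ r $ l)"
    proof (rule matrix_inv_unique)
      have "(\<Sum>k\<in>UNIV. \<nu> \<theta> * g \<theta> $ i $ k * (inverse (\<nu> \<theta>) * h \<theta> $ k $ j)) = kron i j"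
        "(\<Sum>k\<in>UNIV. inverse (\<nu> \<theta>) * h \<theta> $ i $ k * (\<nu> \<theta> * g \<theta> $ k $ j)) = kron i j" for i j
        using g_h[OF \<theta>, of i j] h_g[OF \<theta>, of i j] by (simp_all only: cancel)
      thus "conf_metric \<mu> f \<nu> \<theta> ** (\<chi> r l. inverse (\<nu> \<theta>) * h \<theta> $ r $ l) = mat 1"
        "(\<chi> r l. inverse (\<nu> \<theta>) * h \<theta> $ r $ l) ** conf_metric \<mu> f \<nu> \<theta> = mat 1"
        by (simp_all add: matrix_matrix_mult_def mat_def vec_eq_iff conf_metric_def kron_def)
    qed
    thus ?thesis by simp
  qed
  have "raise_conn (conf_metric \<mu> f \<nu>) (conf_conn \<mu> f \<nu> (-1)) i j l \<theta>
      = (\<Sum>r\<in>UNIV. conn (-1) i j r \<theta> * h \<theta> $ r $ l + \<sigma> i \<theta> * (g \<theta> $ j $ r * h \<theta> $ r $ l)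
          + \<sigma> j \<theta> * (g \<theta> $ i $ r * h \<theta> $ r $ l))"
    unfolding raise_conn_def low inv cancel by (intro sum.cong refl) (simp add: algebra_simps)
  also have "\<dots> = \<gamma> (-1) i j l \<theta> + \<sigma> i \<theta> * kron j l + \<sigma> j \<theta> * kron i l"
    by (simp only: sum.distrib sum_distrib_left[symmetric] g_h[OF \<theta>] raise_conn_def)
  finally show ?thesis .
qed

lemma curv_conformal:
  assumes V: "open V" "V \<subseteq> U" "\<theta> \<in> V" and \<nu>: "gauge_function V \<nu>"
  defines "\<sigma> \<equiv> \<lambda>a. pd a (\<lambda>x. ln (\<nu> x))"
  defines "P \<equiv> \<lambda>i k. pd i (\<sigma> k) \<theta> - (\<Sum>r\<in>UNIV. \<gamma> (-1) i k r \<theta> * \<sigma> r \<theta>) - \<sigma> i \<theta> * \<sigma> k \<theta>"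
  shows "curv (conf_metric \<mu> f \<nu>) (conf_conn \<mu> f \<nu> (-1)) i j k l \<theta>
      = curv g (conn (-1)) i j k l \<theta> + kron j l * P i k - kron i l * P j k"
proof -
  have \<nu>V: "smooth_on V \<nu>" "\<And>x. x \<in> V \<Longrightarrow> \<nu> x > 0" using \<nu> by (auto simp: gauge_function_def)
  have \<nu>d: "\<nu> differentiable (at x)" if "x \<in> V" for x
    by (rule smooth_on_differentiable_at[OF \<nu>V(1) V(1) that])
  have \<sigma>s: "smooth_on V (\<sigma> a)" for a
    unfolding \<sigma>_def by (rule smooth_on_pd_ln[OF V(1) \<nu>V])
  have \<sigma>d: "\<sigma> a differentiable (at \<theta>)" for a
    by (rule smooth_on_differentiable_at[OF \<sigma>s V(1,3)])
  have \<sigma>_sym: "pd a (\<sigma> b) \<theta> = pd b (\<sigma> a) \<theta>" for a b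
  proof -
    have "Ck_on (Suc (Suc 0)) V (\<lambda>x. ln (\<nu> x))"
    proof -
      have "(\<lambda>x. ln (\<nu> x)) differentiable_on V"
        using pd_ln(2)[OF \<nu>d \<nu>V(2)] V(1) by (simp add: differentiable_on_eq_differentiable_at)
      moreover have "Ck_on (Suc 0) V (pd a (\<lambda>x. ln (\<nu> x)))" for a
        using \<sigma>s[of a] by (simp only: smooth_on_def \<sigma>_def)
      ultimately show ?thesis by (simp only: Ck_on.simps(2)[of "Suc 0"]) blast
    qed
    from pd_commute[OF V(1,3) this] show ?thesis by (simp only: \<sigma>_def)
  qed
  have \<theta>: "\<theta> \<in> U" using V by blast
  show ?thesis
    unfolding curv_eq_curv_of P_def
  proof (rule curv_of_projective_change[OF V(1,3)])
    fix i j l x assume "x \<in> V"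
    thus "raise_conn (conf_metric \<mu> f \<nu>) (conf_conn \<mu> f \<nu> (-1)) i j l x
        = \<gamma> (-1) i j l x + \<sigma> i x * kron j l + \<sigma> j x * kron i l"
      unfolding \<sigma>_def using V(2) by (intro raise_conf_conn \<nu>d \<nu>V(2)) auto
  qed (rule differentiable_at[OF \<theta>] \<gamma>_sym \<sigma>d \<sigma>_sym)+
qed

end

section \<open>Conformal flatness and constant curvature\<close>

context statistical_structure
begin

definition constant_curvature_at :: "real \<Rightarrow> real^'m \<Rightarrow> bool" where
  "constant_curvature_at c \<theta> \<longleftrightarrow> (\<forall>i j k l. curv_lower (-1) i j k l \<theta>
      = c * (g \<theta> $ j $ k * g \<theta> $ i $ l - g \<theta> $ i $ k * g \<theta> $ j $ l))"

text \<open>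
A flat conformal transform leaves for the original curvature only the terms of the projective
change. Here \<open>P\<close> is a function of the point, since later it is differentiated.
\<close>

lemma curv_of_conformally_flat:
  assumes V: "open V" "V \<subseteq> U" "\<theta> \<in> V" and \<nu>: "gauge_function V \<nu>"
    and flat: "\<And>i j k l. curv (conf_metric \<mu> f \<nu>) (conf_conn \<mu> f \<nu> (-1)) i j k l \<theta> = 0"
  defines "\<sigma> \<equiv> \<lambda>a. pd a (\<lambda>x. ln (\<nu> x))"
  defines "P \<equiv> \<lambda>i k x. pd i (\<sigma> k) x - (\<Sum>r\<in>UNIV. \<gamma> (-1) i k r x * \<sigma> r x) - \<sigma> i x * \<sigma> k x"
  shows "curv g (conn (-1)) i j k l \<theta> = kron i l * P j k \<theta> - kron j l * P i k \<theta>"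
    and "curv_lower (-1) i j k l \<theta> = P j k \<theta> * g \<theta> $ i $ l - P i k \<theta> * g \<theta> $ j $ l"
proof -
  have *: "curv g (conn (-1)) i j k l \<theta> = kron i l * P j k \<theta> - kron j l * P i k \<theta>" for i j k l
    using curv_conformal[OF V \<nu>, of i j k l] flat[of i j k l] by (simp add: P_def \<sigma>_def)
  thus "curv g (conn (-1)) i j k l \<theta> = kron i l * P j k \<theta> - kron j l * P i k \<theta>" .
  have "curv_lower (-1) i j k l \<theta>
      = (\<Sum>r\<in>UNIV. P j k \<theta> * (kron i r * g \<theta> $ r $ l) - P i k \<theta> * (kron j r * g \<theta> $ r $ l))"
    unfolding curv_lower_def * by (intro sum.cong refl) (simp add: algebra_simps)
  also have "\<dots> = P j k \<theta> * g \<theta> $ i $ l - P i k \<theta> * g \<theta> $ j $ l"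
    by (simp only: sum_subtractf sum_distrib_left[symmetric] sum_kron)
  finally show "curv_lower (-1) i j k l \<theta> = P j k \<theta> * g \<theta> $ i $ l - P i k \<theta> * g \<theta> $ j $ l" .
qed

lemma trace_h_g:
  assumes "\<theta> \<in> U"
  shows "(\<Sum>i\<in>UNIV. \<Sum>l\<in>UNIV. h \<theta> $ i $ l * g \<theta> $ i $ l) = real CARD('m)"
proof -
  have "(\<Sum>l\<in>UNIV. h \<theta> $ i $ l * g \<theta> $ i $ l) = kron i i" for i
    using h_g[OF assms, of i i] by (simp add: g_sym[of \<theta> i])
  thus ?thesis by simp
qed

text \<open>
Contraction of the antisymmetry relation with \<open>h\<^sup>i\<^sup>l\<close>: with \<open>m\<close> the dimension, the left-hand side becomes
\<open>(m - 1)A\<^sub>j\<^sub>k\<close> and the right-hand side \<open>-A\<^sub>j\<^sub>k + tr(A)g\<^sub>j\<^sub>k\<close>, so \<open>A\<close> is a multiple of \<open>g\<close>.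
\<close>

lemma umbilic_if_antisymmetric:
  assumes \<theta>: "\<theta> \<in> U"
    and R: "\<And>i j k l. A j k * g \<theta> $ i $ l - A i k * g \<theta> $ j $ l
      = - (A j l * g \<theta> $ i $ k - A i l * g \<theta> $ j $ k)"
  shows "A j k = (\<Sum>i\<in>UNIV. \<Sum>l\<in>UNIV. h \<theta> $ i $ l * A i l) / real CARD('m) * g \<theta> $ j $ k"
proof -
  have con: "(\<Sum>i\<in>UNIV. h \<theta> $ i $ l * g \<theta> $ i $ k) = kron l k"
    "(\<Sum>l\<in>UNIV. h \<theta> $ i $ l * g \<theta> $ j $ l) = kron i j" for i j k l
    using h_g[OF \<theta>, of l k] h_g[OF \<theta>, of i j] by (simp_all add: h_sym[OF \<theta>, of _ l] g_sym[of \<theta> j])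
  have 1: "(\<Sum>i\<in>UNIV. \<Sum>l\<in>UNIV. h \<theta> $ i $ l * (A j k * g \<theta> $ i $ l)) = real CARD('m) * A j k"
  proof -
    have "(\<Sum>i\<in>UNIV. \<Sum>l\<in>UNIV. h \<theta> $ i $ l * (A j k * g \<theta> $ i $ l))
        = A j k * (\<Sum>i\<in>UNIV. \<Sum>l\<in>UNIV. h \<theta> $ i $ l * g \<theta> $ i $ l)"
      unfolding sum_distrib_left by (intro sum.cong refl) simp
    thus ?thesis by (simp add: trace_h_g[OF \<theta>])
  qed
  have 2: "(\<Sum>i\<in>UNIV. \<Sum>l\<in>UNIV. h \<theta> $ i $ l * (A i k * g \<theta> $ j $ l)) = A j k"
  proof -
    have "(\<Sum>i\<in>UNIV. \<Sum>l\<in>UNIV. h \<theta> $ i $ l * (A i k * g \<theta> $ j $ l))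
        = (\<Sum>i\<in>UNIV. A i k * (\<Sum>l\<in>UNIV. h \<theta> $ i $ l * g \<theta> $ j $ l))"
      unfolding sum_distrib_left by (intro sum.cong refl) simp
    thus ?thesis by (simp add: con)
  qed
  have 3: "(\<Sum>i\<in>UNIV. \<Sum>l\<in>UNIV. h \<theta> $ i $ l * (A j l * g \<theta> $ i $ k)) = A j k"
  proof -
    have "(\<Sum>i\<in>UNIV. \<Sum>l\<in>UNIV. h \<theta> $ i $ l * (A j l * g \<theta> $ i $ k))
        = (\<Sum>l\<in>UNIV. A j l * (\<Sum>i\<in>UNIV. h \<theta> $ i $ l * g \<theta> $ i $ k))"
      unfolding sum_distrib_left by (subst sum.swap, intro sum.cong refl) simp
    thus ?thesis by (simp add: con)
  qed
  have 4: "(\<Sum>i\<in>UNIV. \<Sum>l\<in>UNIV. h \<theta> $ i $ l * (A i l * g \<theta> $ j $ k))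
      = (\<Sum>i\<in>UNIV. \<Sum>l\<in>UNIV. h \<theta> $ i $ l * A i l) * g \<theta> $ j $ k"
    by (simp add: sum_distrib_right mult.assoc)
  have "(\<Sum>i\<in>UNIV. \<Sum>l\<in>UNIV. h \<theta> $ i $ l * (A j k * g \<theta> $ i $ l - A i k * g \<theta> $ j $ l))
      = (\<Sum>i\<in>UNIV. \<Sum>l\<in>UNIV. h \<theta> $ i $ l * (- (A j l * g \<theta> $ i $ k - A i l * g \<theta> $ j $ k)))"
    by (rule sum.cong[OF refl], rule sum.cong[OF refl], subst R, rule refl)
  hence "real CARD('m) * A j k - A j k
      = - (A j k - (\<Sum>i\<in>UNIV. \<Sum>l\<in>UNIV. h \<theta> $ i $ l * A i l) * g \<theta> $ j $ k)"
    by (simp only: right_diff_distrib mult_minus_right sum_negf sum_subtractf 1 2 3 4)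
  thus ?thesis by (simp add: field_simps)
qed

text \<open>
The analogue of Schur's lemma. If \<open>\<nabla>\<sigma> - \<sigma> \<otimes> \<sigma> = \<kappa>g\<close>, then the Ricci identity, that is
\<open>\<partial>\<^sub>j\<partial>\<^sub>i\<sigma>\<^sub>k = \<partial>\<^sub>i\<partial>\<^sub>j\<sigma>\<^sub>k\<close>, relates \<open>d\<kappa>\<close> to the curvature. The curvature terms cancel because the
curvature itself is given by \<open>\<kappa>\<close>, and the derivatives of \<open>g\<close> cancel because \<open>\<nabla>g\<close> is a multiple of
\<open>T\<close>, hence totally symmetric. Unlike the argument by the second Bianchi identity this also covers
dimension two.
\<close>

lemma hessian_factor_derivative:
  assumes V: "open V" "V \<subseteq> U" and \<sigma>: "\<And>a. smooth_on V (\<sigma> a)"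
    and \<kappa>: "\<And>x. x \<in> V \<Longrightarrow> \<kappa> differentiable (at x)"
    and eq: "\<And>i k x. x \<in> V \<Longrightarrow>
      pd i (\<sigma> k) x = (\<Sum>r\<in>UNIV. \<gamma> (-1) i k r x * \<sigma> r x) + \<sigma> i x * \<sigma> k x + \<kappa> x * g x $ i $ k"
    and curv: "\<And>i j k l x. x \<in> V \<Longrightarrow>
      curv g (conn (-1)) i j k l x = \<kappa> x * (kron i l * g x $ j $ k - kron j l * g x $ i $ k)"
    and \<theta>: "\<theta> \<in> V"
  shows "pd j \<kappa> \<theta> * g \<theta> $ i $ k = pd i \<kappa> \<theta> * g \<theta> $ j $ k"
proof -
  have \<theta>U: "\<theta> \<in> U" using V(2) \<theta> by blast
  have \<sigma>d: "\<sigma> a differentiable (at \<theta>)" for a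
    by (rule smooth_on_differentiable_at[OF \<sigma> V(1) \<theta>])
  \<comment> \<open>\<open>S\<close> and \<open>B\<close> collect the terms of the second derivative that involve the connection: \<open>S\<close> is symmetric, and the antisymmetric part of \<open>B\<close> is the curvature applied to \<open>\<sigma>\<close>\<close>
  define S where "S i k = (\<Sum>r\<in>UNIV. \<gamma> (-1) i k r \<theta> * \<sigma> r \<theta>)" for i k
  have S_sym: "S i k = S k i" for i k by (simp add: S_def \<gamma>_sym[of _ i k])
  define B where "B j i k = (\<Sum>r\<in>UNIV. (pd j (\<gamma> (-1) i k r) \<theta>
      + (\<Sum>p\<in>UNIV. \<gamma> (-1) j p r \<theta> * \<gamma> (-1) i k p \<theta>)) * \<sigma> r \<theta>)" for i j k
  have second: "pd j (pd i (\<sigma> k)) \<theta> = B j i k + \<sigma> j \<theta> * S i k + \<kappa> \<theta> * conn (-1) i k j \<theta>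
      + (S j i + \<sigma> j \<theta> * \<sigma> i \<theta> + \<kappa> \<theta> * g \<theta> $ j $ i) * \<sigma> k \<theta>
      + \<sigma> i \<theta> * (S j k + \<sigma> j \<theta> * \<sigma> k \<theta> + \<kappa> \<theta> * g \<theta> $ j $ k)
      + pd j \<kappa> \<theta> * g \<theta> $ i $ k + \<kappa> \<theta> * (conn (-1) j i k \<theta> + conn 1 j k i \<theta>)" for i j
  proof -
    have "pd j (pd i (\<sigma> k)) \<theta> = pd j (\<lambda>x. (\<Sum>r\<in>UNIV. \<gamma> (-1) i k r x * \<sigma> r x) + \<sigma> i x * \<sigma> k x
        + \<kappa> x * g x $ i $ k) \<theta>"
      by (rule pd_cong[OF V(1) \<theta> eq])
    also have "\<dots> = (\<Sum>r\<in>UNIV. pd j (\<gamma> (-1) i k r) \<theta> * \<sigma> r \<theta> + \<gamma> (-1) i k r \<theta> * pd j (\<sigma> r) \<theta>)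
        + (pd j (\<sigma> i) \<theta> * \<sigma> k \<theta> + \<sigma> i \<theta> * pd j (\<sigma> k) \<theta>)
        + (pd j \<kappa> \<theta> * g \<theta> $ i $ k + \<kappa> \<theta> * pd j (\<lambda>x. g x $ i $ k) \<theta>)"
      by (simp add: pd_add pd_sum pd_mult \<sigma>d \<kappa>[OF \<theta>] differentiable_at[OF \<theta>U])
    also have "pd j (\<lambda>x. g x $ i $ k) \<theta> = conn (-1) j i k \<theta> + conn 1 j k i \<theta>"
      by (simp add: metric_compatible[where \<alpha> = "-1"])
    also have "(\<Sum>r\<in>UNIV. pd j (\<gamma> (-1) i k r) \<theta> * \<sigma> r \<theta> + \<gamma> (-1) i k r \<theta> * pd j (\<sigma> r) \<theta>)
        = B j i k + \<sigma> j \<theta> * S i k + \<kappa> \<theta> * conn (-1) i k j \<theta>"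
    proof -
      have "(\<Sum>r\<in>UNIV. \<gamma> (-1) i k r \<theta> * pd j (\<sigma> r) \<theta>)
          = (\<Sum>r\<in>UNIV. \<gamma> (-1) i k r \<theta> * (\<Sum>p\<in>UNIV. \<gamma> (-1) j r p \<theta> * \<sigma> p \<theta>)
            + \<sigma> j \<theta> * (\<gamma> (-1) i k r \<theta> * \<sigma> r \<theta>) + \<kappa> \<theta> * (\<gamma> (-1) i k r \<theta> * g \<theta> $ r $ j))"
        unfolding eq[OF \<theta>]
        by (intro sum.cong refl) (simp add: g_sym[of \<theta> j] algebra_simps)
      also have "\<dots> = (\<Sum>r\<in>UNIV. \<gamma> (-1) i k r \<theta> * (\<Sum>p\<in>UNIV. \<gamma> (-1) j r p \<theta> * \<sigma> p \<theta>))
            + \<sigma> j \<theta> * S i k + \<kappa> \<theta> * conn (-1) i k j \<theta>"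
        by (simp only: sum.distrib sum_distrib_left[symmetric] S_def lower_\<gamma>[OF \<theta>U])
      also have "(\<Sum>r\<in>UNIV. \<gamma> (-1) i k r \<theta> * (\<Sum>p\<in>UNIV. \<gamma> (-1) j r p \<theta> * \<sigma> p \<theta>))
          = (\<Sum>p\<in>UNIV. (\<Sum>r\<in>UNIV. \<gamma> (-1) j r p \<theta> * \<gamma> (-1) i k r \<theta>) * \<sigma> p \<theta>)"
        unfolding sum_distrib_left sum_distrib_right
        by (subst sum.swap) (simp add: mult_ac)
      finally show ?thesis by (simp add: B_def sum.distrib distrib_right)
    qed
    finally show ?thesis unfolding eq[OF \<theta>] S_def by simp
  qed
  have ricci: "B j i k - B i j k = \<kappa> \<theta> * (\<sigma> j \<theta> * g \<theta> $ i $ k - \<sigma> i \<theta> * g \<theta> $ j $ k)"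
  proof -
    have "B j i k - B i j k = (\<Sum>r\<in>UNIV. curv g (conn (-1)) j i k r \<theta> * \<sigma> r \<theta>)"
      unfolding B_def sum_subtractf[symmetric] curv_def
      by (intro sum.cong refl) (simp add: algebra_simps)
    also have "\<dots> = (\<Sum>r\<in>UNIV. \<kappa> \<theta> * g \<theta> $ i $ k * (kron j r * \<sigma> r \<theta>)
        - \<kappa> \<theta> * g \<theta> $ j $ k * (kron i r * \<sigma> r \<theta>))"
      unfolding curv[OF \<theta>] by (intro sum.cong refl) (simp add: algebra_simps)
    also have "\<dots> = \<kappa> \<theta> * g \<theta> $ i $ k * \<sigma> j \<theta> - \<kappa> \<theta> * g \<theta> $ j $ k * \<sigma> i \<theta>"
      by (simp only: sum_subtractf sum_distrib_left[symmetric] sum_kron)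
    finally show ?thesis by (simp add: algebra_simps)
  qed
  \<comment> \<open>total symmetry of \<open>\<nabla>g\<close>, with the connection coefficients that arise from \<open>\<gamma> * g\<close> included\<close>
  have codazzi: "conn (-1) i k j \<theta> + conn (-1) j i k \<theta> + conn 1 j k i \<theta>
      = conn (-1) j k i \<theta> + conn (-1) i j k \<theta> + conn 1 i k j \<theta>"
    using conn_sym[of "-1" i j k \<theta>] T_sym(1)[of i k j \<theta>] T_sym(2)[of k i j \<theta>] T_sym(1)[of k j i \<theta>]
    by (simp add: conn_def)
  have "pd j (pd i (\<sigma> k)) \<theta> = pd i (pd j (\<sigma> k)) \<theta>"
    using \<sigma>[of k] unfolding smooth_on_def by (blast intro: pd_commute[OF V(1) \<theta>])
  hence "(B j i k - B i j k) + \<kappa> \<theta> * (conn (-1) i k j \<theta> + conn (-1) j i k \<theta> + conn 1 j k i \<theta>)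
      - \<kappa> \<theta> * (conn (-1) j k i \<theta> + conn (-1) i j k \<theta> + conn 1 i k j \<theta>)
      + \<kappa> \<theta> * (\<sigma> i \<theta> * g \<theta> $ j $ k - \<sigma> j \<theta> * g \<theta> $ i $ k)
      + pd j \<kappa> \<theta> * g \<theta> $ i $ k - pd i \<kappa> \<theta> * g \<theta> $ j $ k = 0"
    unfolding second using S_sym[of i j] g_sym[of \<theta> i j] by (simp add: algebra_simps)
  thus ?thesis unfolding ricci codazzi by (simp add: algebra_simps)
qed

text \<open>
Contraction with \<open>h\<^sup>k\<^sup>i\<close> for an index \<open>i\<close> other than \<open>j\<close>.
\<close>

lemma proportional_to_metric_imp_zero:
  assumes m: "CARD('m) \<ge> 2" and \<theta>: "\<theta> \<in> U"
    and eq: "\<And>i j k. a j * g \<theta> $ i $ k = a i * g \<theta> $ j $ k"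
  shows "a j = 0"
proof -
  obtain i where i: "i \<noteq> j"
  proof -
    have "(UNIV :: 'm set) \<noteq> {j}"
    proof
      assume "(UNIV :: 'm set) = {j}"
      from arg_cong[OF this, of card] m show False by simp
    qed
    thus ?thesis using that by blast
  qed
  have "(\<Sum>k\<in>UNIV. a j * (g \<theta> $ i $ k * h \<theta> $ k $ i)) = (\<Sum>k\<in>UNIV. a i * (g \<theta> $ j $ k * h \<theta> $ k $ i))"
    by (rule sum.cong[OF refl], unfold mult.assoc[symmetric], subst eq[of j i], rule refl)
  hence "a j * kron i i = a i * kron j i"
    by (simp only: sum_distrib_left[symmetric] g_h[OF \<theta>])
  with i show ?thesis by (simp add: kron_def)
qed

text \<open>
The antisymmetry makes the tensor \<open>P\<close> of the flattening gauge a multiple \<open>\<kappa>g\<close> of the metric, and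
by the analogue of Schur's lemma \<open>\<kappa>\<close> has derivative zero.
\<close>

lemma flat_imp_constant_curvature_nearby:
  assumes m: "CARD('m) \<ge> 2"
    and V: "open V" "V \<subseteq> U" and flat: "conformally_m_flat_on \<mu> V f"
    and anti: "\<And>\<theta> i j k l. \<theta> \<in> V \<Longrightarrow> curv_lower (-1) i j k l \<theta> = - curv_lower (-1) i j l k \<theta>"
    and \<theta>0: "\<theta>0 \<in> V"
  shows "\<exists>e>0. \<exists>c. ball \<theta>0 e \<subseteq> V \<and> (\<forall>\<theta>\<in>ball \<theta>0 e. constant_curvature_at c \<theta>)"
proof -
  obtain \<nu> where \<nu>: "gauge_function V \<nu>"
    and flat: "\<And>\<theta> i j k l. \<theta> \<in> V \<Longrightarrow>
      curv (conf_metric \<mu> f \<nu>) (conf_conn \<mu> f \<nu> (-1)) i j k l \<theta> = 0"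
    using flat by (auto simp: conformally_m_flat_on_def)
  define \<sigma> where "\<sigma> a = pd a (\<lambda>x. ln (\<nu> x))" for a
  define P where "P i k x = pd i (\<sigma> k) x - (\<Sum>r\<in>UNIV. \<gamma> (-1) i k r x * \<sigma> r x) - \<sigma> i x * \<sigma> k x" for i k x
  define \<kappa> where "\<kappa> x = (1 / real CARD('m)) * (\<Sum>i\<in>UNIV. \<Sum>l\<in>UNIV. h x $ i $ l * P i l x)" for x
  have \<sigma>: "smooth_on V (\<sigma> a)" for a
    unfolding \<sigma>_def using \<nu> by (intro smooth_on_pd_ln V(1)) (auto simp: gauge_function_def)
  have h: "smooth_on V (\<lambda>x. h x $ i $ l)" for i l
    by (rule smooth_on_subset[OF smooth_on_matrix_inv[OF U g_smooth g_invertible] V(2)])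
  have P: "smooth_on V (P i k)" for i k
    unfolding P_def[abs_def]
    by (intro smooth_on_intros smooth_on_pd \<sigma> smooth_on_subset[OF \<gamma>_smooth V(2)] V(1))
  have \<kappa>: "smooth_on V \<kappa>"
    unfolding \<kappa>_def[abs_def] by (intro smooth_on_intros h P V(1))
  have VU: "x \<in> U" if "x \<in> V" for x using that V(2) by blast
  have curv: "curv g (conn (-1)) i j k l x = kron i l * P j k x - kron j l * P i k x"
    "curv_lower (-1) i j k l x = P j k x * g x $ i $ l - P i k x * g x $ j $ l"
    if "x \<in> V" for i j k l x
    unfolding P_def \<sigma>_def by (rule curv_of_conformally_flat[OF V that \<nu> flat[OF that]])+
  have P_eq: "P j k x = \<kappa> x * g x $ j $ k" if "x \<in> V" for j k x
    unfolding \<kappa>_def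
    by (subst umbilic_if_antisymmetric[OF VU[OF that], of "\<lambda>j k. P j k x" j k])
      (rule anti[OF that, unfolded curv(2)[OF that]], simp)
  have pd0: "pd j \<kappa> x = 0" if x: "x \<in> V" for j x
  proof (rule proportional_to_metric_imp_zero[OF m VU[OF x]])
    fix i j k
    show "pd j \<kappa> x * g x $ i $ k = pd i \<kappa> x * g x $ j $ k"
    proof (rule hessian_factor_derivative[where \<sigma> = \<sigma> and \<kappa> = \<kappa>, OF V \<sigma> _ _ _ x])
      show "\<kappa> differentiable (at y)" if "y \<in> V" for y
        by (rule smooth_on_differentiable_at[OF \<kappa> V(1) that])
    next
      fix i k y assume "y \<in> V"
      from P_eq[OF this, of i k]
      show "pd i (\<sigma> k) y = (\<Sum>r\<in>UNIV. \<gamma> (-1) i k r y * \<sigma> r y) + \<sigma> i y * \<sigma> k y + \<kappa> y * g y $ i $ k"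
        by (simp add: P_def)
    next
      fix i j k l y assume y: "y \<in> V"
      show "curv g (conn (-1)) i j k l y = \<kappa> y * (kron i l * g y $ j $ k - kron j l * g y $ i $ k)"
        unfolding curv(1)[OF y] P_eq[OF y] by (simp add: algebra_simps)
    qed
  qed
  obtain e where e: "e > 0" "ball \<theta>0 e \<subseteq> V" using V(1) \<theta>0 open_contains_ball by blast
  have der0: "(\<kappa> has_derivative (\<lambda>_. 0)) (at x within ball \<theta>0 e)" if "x \<in> ball \<theta>0 e" for x
  proof -
    have x: "x \<in> V" using that e by blast
    have "(\<kappa> has_derivative (\<lambda>_. 0)) (at x)"
      using has_derivative_pd[OF smooth_on_differentiable_at[OF \<kappa> V(1) x]] by (simp add: pd0[OF x])
    thus ?thesis by (rule has_derivative_at_withinI)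
  qed
  have "\<exists>c. \<forall>x\<in>ball \<theta>0 e. \<kappa> x = c"
    by (rule has_derivative_zero_constant[OF convex_ball der0])
  then obtain c where c: "\<And>x. x \<in> ball \<theta>0 e \<Longrightarrow> \<kappa> x = c" by blast
  have "constant_curvature_at c x" if "x \<in> ball \<theta>0 e" for x
  proof -
    have x: "x \<in> V" using that e by blast
    show ?thesis
      unfolding constant_curvature_at_def curv(2)[OF x] P_eq[OF x] c[OF that]
      by (simp add: algebra_simps)
  qed
  with e show ?thesis by blast
qed

lemma constant_curvature_unique:
  assumes m: "CARD('m) \<ge> 2" and \<theta>: "\<theta> \<in> U"
    and c: "constant_curvature_at c \<theta>" "constant_curvature_at c' \<theta>"
  shows "c = c'"
proof -
  have eq: "(c - c') * (g \<theta> $ j $ k * g \<theta> $ i $ l - g \<theta> $ i $ k * g \<theta> $ j $ l) = 0" for i j k l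
  proof -
    note c[unfolded constant_curvature_at_def, rule_format, of i j k l, symmetric]
    thus ?thesis by (simp only: left_diff_distrib[of c c'])
  qed
  have contr: "(c - c') * (kron j p * g \<theta> $ i $ l - kron i p * g \<theta> $ j $ l) = 0" for i j l p
  proof -
    have "(\<Sum>k\<in>UNIV. (c - c') * (g \<theta> $ j $ k * g \<theta> $ i $ l - g \<theta> $ i $ k * g \<theta> $ j $ l) * h \<theta> $ k $ p) = 0"
      by (simp only: eq) simp
    also have "(\<Sum>k\<in>UNIV. (c - c') * (g \<theta> $ j $ k * g \<theta> $ i $ l - g \<theta> $ i $ k * g \<theta> $ j $ l) * h \<theta> $ k $ p)
        = (\<Sum>k\<in>UNIV. ((c - c') * g \<theta> $ i $ l) * (g \<theta> $ j $ k * h \<theta> $ k $ p)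
             - ((c - c') * g \<theta> $ j $ l) * (g \<theta> $ i $ k * h \<theta> $ k $ p))"
      by (intro sum.cong refl) (simp add: algebra_simps)
    also have "\<dots> = (c - c') * (kron j p * g \<theta> $ i $ l - kron i p * g \<theta> $ j $ l)"
      by (simp only: sum_subtractf sum_distrib_left[symmetric] g_h[OF \<theta>]) (simp add: algebra_simps)
    finally show ?thesis .
  qed
  have "(c - c') * 1 = 0"
  proof (rule proportional_to_metric_imp_zero[OF m \<theta>, of "\<lambda>_. (c - c') * 1"])
    fix i j k
    show "(c - c') * 1 * g \<theta> $ i $ k = (c - c') * 1 * g \<theta> $ j $ k"
      using contr[of j j i k] contr[of i i j k] by (cases "i = j") (auto simp: kron_def)
  qed
  thus ?thesis by simp
qed

text \<open>
Locally the curvature is constant; in dimension at least two the constant is determined by the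
curvature, so it is a locally constant function on a connected set. In dimension one the curvature
vanishes by antisymmetry in \<open>i, j\<close>.
\<close>

theorem locally_flat_imp_constant_curvature:
  assumes conn: "connected U"
    and flat: "\<And>\<theta>. \<theta> \<in> U \<Longrightarrow> \<exists>V. open V \<and> \<theta> \<in> V \<and> V \<subseteq> U \<and> conformally_m_flat_on \<mu> V f"
    and anti: "\<And>\<theta> i j k l. \<theta> \<in> U \<Longrightarrow> curv_lower (-1) i j k l \<theta> = - curv_lower (-1) i j l k \<theta>"
  shows "\<exists>c. \<forall>\<theta>\<in>U. constant_curvature_at c \<theta>"
proof (cases "CARD('m) \<ge> 2")
  case False
  hence "CARD('m) = 1" using zero_less_card_finite[where 'a = 'm] by linarith
  then obtain a :: 'm where a: "(UNIV :: 'm set) = {a}" by (auto simp: card_1_singleton_iff)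
  have all: "i = a" for i :: 'm using a by blast
  have "curv_lower (-1) i j k l \<theta> = 0" for i j k l \<theta>
  proof -
    have "i = j" using all[of i] all[of j] by simp
    thus ?thesis by (simp add: curv_lower_def curv_def)
  qed
  hence "constant_curvature_at 0 \<theta>" for \<theta>
    by (simp add: constant_curvature_at_def)
  thus ?thesis by blast
next
  case m: True
  have local: "\<exists>e>0. \<exists>c. ball \<theta> e \<subseteq> U \<and> (\<forall>x\<in>ball \<theta> e. constant_curvature_at c x)"
    if \<theta>: "\<theta> \<in> U" for \<theta>
  proof -
    obtain V where V: "open V" "\<theta> \<in> V" "V \<subseteq> U" "conformally_m_flat_on \<mu> V f"
      using flat[OF \<theta>] by blast
    from flat_imp_constant_curvature_nearby[OF m V(1,3,4) anti V(2)] V(3) show ?thesis by blast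
  qed
  define K where "K \<theta> = (SOME c. constant_curvature_at c \<theta>)" for \<theta>
  have K: "constant_curvature_at (K \<theta>) \<theta>" if \<theta>: "\<theta> \<in> U" for \<theta>
    unfolding K_def
  proof (rule someI_ex)
    obtain e c where "e > 0" "\<forall>x\<in>ball \<theta> e. constant_curvature_at c x" using local[OF \<theta>] by blast
    thus "\<exists>c. constant_curvature_at c \<theta>" by (intro exI[of _ c]) simp
  qed
  have K_const: "K a = K b" if "a \<in> U" "b \<in> U" for a b
  proof (rule connected_local_const[OF conn that], intro ballI)
    fix \<theta> assume \<theta>: "\<theta> \<in> U"
    obtain e c where e: "e > 0" "ball \<theta> e \<subseteq> U" "\<And>x. x \<in> ball \<theta> e \<Longrightarrow> constant_curvature_at c x"
      using local[OF \<theta>] by blast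
    have "K x = c" if "x \<in> ball \<theta> e" for x
      using e that by (intro constant_curvature_unique[OF m _ K]) auto
    hence "\<forall>x\<in>ball \<theta> e. K \<theta> = K x" using e(1) by simp
    thus "\<forall>\<^sub>F x in at \<theta> within U. K \<theta> = K x"
      using e(1) by (auto simp: eventually_at dist_commute intro!: exI[of _ e])
  qed
  show ?thesis
  proof (cases "U = {}")
    case False
    then obtain a where "a \<in> U" by blast
    hence "\<forall>\<theta>\<in>U. constant_curvature_at (K a) \<theta>" using K K_const by metis
    thus ?thesis by blast
  qed simp
qed

lemma constant_curvature_raised:
  assumes c: "constant_curvature_at c \<theta>" and \<theta>: "\<theta> \<in> U"
  shows "curv g (conn (-1)) i j k l \<theta> = c * (g \<theta> $ j $ k * kron i l - g \<theta> $ i $ k * kron j l)"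
proof -
  have "curv g (conn (-1)) i j k l \<theta>
      = (\<Sum>p\<in>UNIV. c * g \<theta> $ j $ k * (g \<theta> $ i $ p * h \<theta> $ p $ l)
          - c * g \<theta> $ i $ k * (g \<theta> $ j $ p * h \<theta> $ p $ l))"
    unfolding curv_eq_raised_lower[OF \<theta>] c[unfolded constant_curvature_at_def, rule_format]
    by (intro sum.cong refl) (simp add: algebra_simps)
  also have "\<dots> = c * g \<theta> $ j $ k * kron i l - c * g \<theta> $ i $ k * kron j l"
    by (simp only: sum_subtractf sum_distrib_left[symmetric] g_h[OF \<theta>])
  finally show ?thesis by (simp add: algebra_simps)
qed

text \<open>
The equation \<open>Hess u = -c * u * g\<close> as a first-order system: the component \<open>None\<close> is \<open>u\<close> and
\<open>Some k\<close> is \<open>\<partial>\<^sub>k u\<close>.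
\<close>

definition hessian_system :: "real \<Rightarrow> 'm \<Rightarrow> 'm option \<Rightarrow> 'm option \<Rightarrow> real^'m \<Rightarrow> real" where
  "hessian_system c i p q \<theta> = (case p of
     None \<Rightarrow> (case q of None \<Rightarrow> 0 | Some l \<Rightarrow> kron i l)
   | Some k \<Rightarrow> (case q of None \<Rightarrow> - c * g \<theta> $ i $ k | Some l \<Rightarrow> \<gamma> (-1) i k l \<theta>))"

lemma sum_option:
  fixes F :: "'m option \<Rightarrow> real"
  shows "(\<Sum>q\<in>UNIV. F q) = F None + (\<Sum>l\<in>UNIV. F (Some l))"
  by (simp add: UNIV_option_conv sum.reindex)

lemma hessian_system_smooth: "smooth_on U (hessian_system c i p q)"
proof -
  have "smooth_on U (\<lambda>\<theta>. - c * g \<theta> $ i $ k)" for k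
    by (intro smooth_on_intros g_smooth U)
  thus ?thesis
    unfolding hessian_system_def[abs_def]
    by (cases p; cases q) (simp_all add: smooth_on_const \<gamma>_smooth)
qed

text \<open>
The integrability conditions of \<open>Hess u = -c * u * g\<close>, one for each block of the coefficient matrix:
symmetry of \<open>g\<close> and of the connection for the first row, symmetry of \<open>\<nabla>g\<close> for the coefficient of
\<open>u\<close>, and constant curvature for the coefficients of \<open>du\<close>.
\<close>

lemma hessian_system_flat:
  assumes c: "\<And>\<theta>. \<theta> \<in> U \<Longrightarrow> constant_curvature_at c \<theta>" and \<theta>: "\<theta> \<in> U"
  shows "pd i (hessian_system c j p q) \<theta>
        + (\<Sum>r\<in>UNIV. hessian_system c j p r \<theta> * hessian_system c i r q \<theta>)
      = pd j (hessian_system c i p q) \<theta>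
        + (\<Sum>r\<in>UNIV. hessian_system c i p r \<theta> * hessian_system c j r q \<theta>)"
proof (cases p)
  case None
  show ?thesis
    unfolding None hessian_system_def[abs_def] sum_option
    by (cases q) (simp_all add: g_sym[of \<theta> i j] \<gamma>_sym[of _ i j] sum_negf)
next
  case (Some k)
  show ?thesis
  proof (cases q)
    case None
    have d: "(\<lambda>x. g x $ a $ b) differentiable (at \<theta>)" for a b by (rule differentiable_at(1)[OF \<theta>])
    have s: "(\<Sum>r\<in>UNIV. \<gamma> (-1) a k r \<theta> * (c * g \<theta> $ b $ r)) = c * conn (-1) a k b \<theta>" for a b
      unfolding lower_\<gamma>[OF \<theta>, symmetric] sum_distrib_left
      by (intro sum.cong refl) (simp add: g_sym[of \<theta> b])
    have "pd i (\<lambda>x. g x $ j $ k) \<theta> + conn (-1) j k i \<theta> = pd j (\<lambda>x. g x $ i $ k) \<theta> + conn (-1) i k j \<theta>"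
      unfolding metric_compatible[of _ _ _ \<theta> "-1"]
      using conn_sym[of "-1" i j k \<theta>] T_sym(1)[of i k j \<theta>] T_sym(2)[of k i j \<theta>] T_sym(1)[of k j i \<theta>]
      by (simp add: conn_def)
    hence "c * pd i (\<lambda>x. g x $ j $ k) \<theta> + c * conn (-1) j k i \<theta>
        = c * pd j (\<lambda>x. g x $ i $ k) \<theta> + c * conn (-1) i k j \<theta>"
      by (simp only: distrib_left[symmetric])
    thus ?thesis
      unfolding None Some hessian_system_def[abs_def] sum_option
      using pd_cmult[OF d, of _ "- c"] by (simp add: s sum_negf)
  next
    case (Some l)
    from constant_curvature_raised[OF c[OF \<theta>] \<theta>, of i j k l]
    show ?thesis
      unfolding \<open>p = Some k\<close> Some hessian_system_def[abs_def] sum_option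
      by (simp add: curv_def algebra_simps)
  qed
qed

text \<open>
With \<open>u = 1 / \<nu>\<close> the condition \<open>\<nabla>\<sigma> - \<sigma> \<otimes> \<sigma> = c * g\<close> on \<open>\<sigma> = d ln \<nu>\<close>, which makes the conformal
transform flat, turns into the linear equation \<open>Hess u = -c * u * g\<close>. It is solved with
\<open>u = 1\<close>, \<open>du = 0\<close> at \<open>\<theta>0\<close>, and the gauge is defined where the solution stays positive.
\<close>

theorem constant_curvature_imp_locally_flat:
  assumes c: "\<And>\<theta>. \<theta> \<in> U \<Longrightarrow> constant_curvature_at c \<theta>" and \<theta>0: "\<theta>0 \<in> U"
  shows "\<exists>V. open V \<and> \<theta>0 \<in> V \<and> V \<subseteq> U \<and> conformally_m_flat_on \<mu> V f"
proof -
  have C1: "Ck_on (Suc 0) U (hessian_system c i p q)" for i p q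
    using hessian_system_smooth by (simp only: smooth_on_def)
  obtain \<epsilon> y where \<epsilon>: "\<epsilon> > 0" "ball \<theta>0 \<epsilon> \<subseteq> U"
    and y0: "\<And>p. y p \<theta>0 = (case p of None \<Rightarrow> 1 | Some _ \<Rightarrow> 0)"
    and yd: "\<And>p \<theta>. \<theta> \<in> ball \<theta>0 \<epsilon> \<Longrightarrow> y p differentiable (at \<theta>)"
    and pdy: "\<And>p i \<theta>. \<theta> \<in> ball \<theta>0 \<epsilon> \<Longrightarrow>
      pd i (y p) \<theta> = (\<Sum>q\<in>UNIV. hessian_system c i p q \<theta> * y q \<theta>)"
  proof (rule linear_total_differential_system[where a = "hessian_system c"
        and ?y0.0 = "\<lambda>p. case p of None \<Rightarrow> 1 | Some _ \<Rightarrow> 0", OF U \<theta>0 C1])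
    fix \<theta> i j p q assume "\<theta> \<in> U"
    thus "pd i (hessian_system c j p q) \<theta>
          + (\<Sum>r\<in>UNIV. hessian_system c j p r \<theta> * hessian_system c i r q \<theta>)
        = pd j (hessian_system c i p q) \<theta>
          + (\<Sum>r\<in>UNIV. hessian_system c i p r \<theta> * hessian_system c j r q \<theta>)"
      by (intro hessian_system_flat c)
  qed (rule that)
  define u where "u = y None"
  define w where "w k = y (Some k)" for k
  have ys: "smooth_on (ball \<theta>0 \<epsilon>) (y p)" for p
  proof (rule total_differential_solution_smooth[where a = "hessian_system c", OF open_ball])
    show "smooth_on (ball \<theta>0 \<epsilon>) (hessian_system c i p q)" for i p q
      by (rule smooth_on_subset[OF hessian_system_smooth \<epsilon>(2)])
  qed (fact yd pdy)+
  define V where "V = {\<theta> \<in> ball \<theta>0 \<epsilon>. u \<theta> > 0}"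
  have "continuous_on (ball \<theta>0 \<epsilon>) u"
    unfolding u_def by (rule continuous_at_imp_continuous_on)
      (blast intro: differentiable_imp_continuous_within yd)
  hence "open (ball \<theta>0 \<epsilon> \<inter> u -` {0<..})"
    by (intro continuous_open_preimage open_ball open_greaterThan)
  moreover have "V = ball \<theta>0 \<epsilon> \<inter> u -` {0<..}" by (auto simp: V_def)
  ultimately have V_open: "open V" by simp
  have V: "\<theta>0 \<in> V" "V \<subseteq> ball \<theta>0 \<epsilon>" "V \<subseteq> U"
  proof -
    show "\<theta>0 \<in> V" using \<epsilon>(1) y0[of None] by (simp add: V_def u_def)
    show V: "V \<subseteq> ball \<theta>0 \<epsilon>" by (auto simp: V_def)
    from V \<epsilon>(2) show "V \<subseteq> U" by (rule subset_trans)
  qed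
  define \<nu> where "\<nu> x = inverse (u x)" for x
  have \<nu>: "gauge_function V \<nu>"
    unfolding gauge_function_def \<nu>_def[abs_def]
  proof (intro conjI ballI)
    show "smooth_on V (\<lambda>x. inverse (u x))"
      unfolding u_def
      by (rule smooth_on_inverse[OF V_open smooth_on_subset[OF ys V(2)]]) (simp add: V_def u_def)
  qed (simp add: V_def)
  define \<sigma> where "\<sigma> a = pd a (\<lambda>x. ln (\<nu> x))" for a
  have pdu: "pd i u x = w i x" if "x \<in> V" for i x
    using pdy[OF subsetD[OF V(2) that], of i None]
    by (simp add: u_def w_def sum_option hessian_system_def)
  have pdw: "pd i (w k) x = (\<Sum>l\<in>UNIV. \<gamma> (-1) i k l x * w l x) - c * g x $ i $ k * u x" if "x \<in> V" for i k x
    using pdy[OF subsetD[OF V(2) that], of i "Some k"]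
    by (simp add: u_def w_def sum_option hessian_system_def)
  have d: "u differentiable (at x)" "w k differentiable (at x)" if "x \<in> V" for x k
    unfolding u_def w_def by (rule yd[OF subsetD[OF V(2) that]])+
  have pos: "u x > 0" if "x \<in> V" for x using that by (simp add: V_def)
  have \<sigma>: "\<sigma> k x = (-1) * (w k x * inverse (u x))" if x: "x \<in> V" for k x
  proof -
    have "\<sigma> k x = pd k (\<lambda>x. (-1) * ln (u x)) x"
      unfolding \<sigma>_def \<nu>_def by (rule pd_cong[OF V_open x]) (simp add: ln_inverse pos)
    also have "\<dots> = (-1) * pd k (\<lambda>x. ln (u x)) x"
      by (rule pd_cmult[OF pd_ln(2)[OF d(1)[OF x] pos[OF x]]])
    also have "\<dots> = (-1) * (w k x * inverse (u x))"
      by (simp only: pd_ln(1)[OF d(1)[OF x] pos[OF x]] pdu[OF x] divide_inverse)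
    finally show ?thesis .
  qed
  have P: "pd i (\<sigma> k) x - (\<Sum>r\<in>UNIV. \<gamma> (-1) i k r x * \<sigma> r x) - \<sigma> i x * \<sigma> k x = c * g x $ i $ k"
    if x: "x \<in> V" for i k x
  proof -
    note di = pd_inverse[OF d(1)[OF x] less_imp_neq[OF pos[OF x], symmetric]]
    have "pd i (\<sigma> k) x = pd i (\<lambda>x. (-1) * (w k x * inverse (u x))) x"
      by (rule pd_cong[OF V_open x \<sigma>])
    also have "\<dots> = (-1) * pd i (\<lambda>x. w k x * inverse (u x)) x"
      by (rule pd_cmult[OF differentiable_mult[OF d(2)[OF x] di(2)]])
    also have "\<dots> = (-1) * (pd i (w k) x * inverse (u x) + w k x * pd i (\<lambda>x. inverse (u x)) x)"
      by (simp only: pd_mult[OF d(2)[OF x] di(2)])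
    also have "\<dots> = (-1) * (((\<Sum>l\<in>UNIV. \<gamma> (-1) i k l x * w l x) - c * g x $ i $ k * u x) * inverse (u x)
        + w k x * - (w i x * (inverse (u x) * inverse (u x))))"
      by (simp only: pdw[OF x] di(1) pdu[OF x])
    finally have 1: "pd i (\<sigma> k) x = - ((\<Sum>l\<in>UNIV. \<gamma> (-1) i k l x * w l x) * inverse (u x))
        + c * g x $ i $ k + w k x * w i x * (inverse (u x) * inverse (u x))"
      using pos[OF x] by (simp add: algebra_simps)
    have 2: "(\<Sum>r\<in>UNIV. \<gamma> (-1) i k r x * \<sigma> r x)
        = - ((\<Sum>l\<in>UNIV. \<gamma> (-1) i k l x * w l x) * inverse (u x))"
    proof -
      have "(\<Sum>r\<in>UNIV. \<gamma> (-1) i k r x * \<sigma> r x)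
          = (\<Sum>r\<in>UNIV. - (\<gamma> (-1) i k r x * w r x * inverse (u x)))"
        by (simp add: \<sigma>[OF x] mult.assoc)
      thus ?thesis by (simp only: sum_negf sum_distrib_right)
    qed
    show ?thesis unfolding 1 2 by (simp add: \<sigma>[OF x] algebra_simps)
  qed
  have "curv (conf_metric \<mu> f \<nu>) (conf_conn \<mu> f \<nu> (-1)) i j k l x = 0" if x: "x \<in> V" for i j k l x
  proof -
    have xU: "x \<in> U" using x V(3) by blast
    show ?thesis
      unfolding curv_conformal[OF V_open V(3) x \<nu>] P[OF x, unfolded \<sigma>_def]
        constant_curvature_raised[OF c[OF xU] xU] by (simp add: algebra_simps)
  qed
  hence "conformally_m_flat_on \<mu> V f"
    unfolding conformally_m_flat_on_def by (intro exI[of _ \<nu>] conjI \<nu> ballI allI)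
  with V_open V(1,3) show ?thesis by blast
qed

end

section \<open>The connections of a family of densities\<close>

lemma posdef_invertible:
  fixes A :: "real^'m^'m"
  assumes "\<And>v. v \<noteq> 0 \<Longrightarrow> v \<bullet> (A *v v) > 0"
  shows "invertible A"
proof -
  have "\<forall>x. A *v x = 0 \<longrightarrow> x = 0"
  proof (intro allI impI, rule ccontr)
    fix x assume "A *v x = 0" "x \<noteq> 0"
    with assms[of x] show False by simp
  qed
  thus ?thesis unfolding invertible_left_inverse matrix_left_invertible_ker .
qed

lemma statistical_manifold_structure:
  assumes "statistical_manifold \<mu> \<Theta> f"
  shows "statistical_structure \<Theta> \<mu> f"
proof
  show "open \<Theta>" "smooth_on \<Theta> (\<lambda>\<theta>. fisher \<mu> f \<theta> $ i $ j)" "smooth_on \<Theta> (skew \<mu> f i j k)" for i j k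
    using assms by (simp_all add: statistical_manifold_def)
  fix \<theta> assume "\<theta> \<in> \<Theta>"
  thus "invertible (fisher \<mu> f \<theta>)"
    using assms by (intro posdef_invertible) (simp add: statistical_manifold_def)
qed

text \<open>
The facts about a single log-likelihood that hold where the density is positive. The last one is
the score identity, which turns derivatives of the density into factors of the integrand.
\<close>

lemma loglik_smooth:
  assumes U: "open U" and f: "smooth_on U (f x)" "\<And>\<theta>. \<theta> \<in> U \<Longrightarrow> f x \<theta> > 0"
  shows "smooth_on U (pd i (loglik f x))" "\<theta> \<in> U \<Longrightarrow> pd i (pd j (loglik f x)) \<theta> = pd j (pd i (loglik f x)) \<theta>"
    "\<theta> \<in> U \<Longrightarrow> pd i (f x) \<theta> = pd i (loglik f x) \<theta> * f x \<theta>"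
proof -
  have l: "loglik f x = (\<lambda>\<theta>. ln (f x \<theta>))" by (simp add: loglik_def[abs_def])
  have d: "f x differentiable (at \<theta>)" if "\<theta> \<in> U" for \<theta>
    by (rule smooth_on_differentiable_at[OF f(1) U that])
  show s: "smooth_on U (pd i (loglik f x))" for i
    unfolding l by (rule smooth_on_pd_ln[OF U f])
  show "pd i (f x) \<theta> = pd i (loglik f x) \<theta> * f x \<theta>" if "\<theta> \<in> U" for i
    using pd_ln(1)[OF d[OF that] f(2)[OF that], of i] f(2)[OF that] by (simp add: l)
  have "Ck_on (Suc (Suc 0)) U (loglik f x)"
  proof -
    have "loglik f x differentiable_on U"
      using pd_ln(2)[OF d f(2)] U by (simp add: l differentiable_on_eq_differentiable_at)
    moreover have "Ck_on (Suc 0) U (pd a (loglik f x))" for a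
      using s[of a] unfolding smooth_on_def by (rule spec)
    ultimately show ?thesis by (simp only: Ck_on.simps(2)[of "Suc 0"]) blast
  qed
  thus "pd i (pd j (loglik f x)) \<theta> = pd j (pd i (loglik f x)) \<theta>" if "\<theta> \<in> U"
    by (rule pd_commute[OF U that])
qed

text \<open>
Differentiation of \<open>g\<^sub>i\<^sub>j\<close> under the integral, with one term for each of the three factors, gives
\<open>\<partial>\<^sub>k g\<^sub>i\<^sub>j = A\<^sub>k\<^sub>i\<^sub>j + A\<^sub>k\<^sub>j\<^sub>i + T\<^sub>i\<^sub>j\<^sub>k\<close> for \<open>A\<^sub>i\<^sub>j\<^sub>k = E[\<partial>\<^sub>i\<partial>\<^sub>jl \<partial>\<^sub>kl]\<close>. So the Levi-Civita connection is
\<open>A + T/2\<close>.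
\<close>

lemma alpha_conn_levi_civita:
  assumes M: "statistical_manifold \<mu> \<Theta> f" and \<theta>: "\<theta> \<in> \<Theta>"
  shows "alpha_conn \<mu> f \<alpha> i j k \<theta> = levi_civita (fisher \<mu> f) i j k \<theta> - \<alpha> / 2 * skew \<mu> f i j k \<theta>"
proof -
  have U: "open \<Theta>" and smooth: "\<And>x. x \<in> space \<mu> \<Longrightarrow> smooth_on \<Theta> (f x)"
    and supp: "\<And>x. x \<in> space \<mu> \<Longrightarrow> (\<forall>\<theta>\<in>\<Theta>. f x \<theta> > 0) \<or> (\<forall>\<theta>\<in>\<Theta>. f x \<theta> = 0)"
    and int3: "\<And>i j k. integrable \<mu> (\<lambda>x. pd i (loglik f x) \<theta> * pd j (loglik f x) \<theta> * pd k (loglik f x) \<theta> * f x \<theta>)"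
    and int2: "\<And>i j k. integrable \<mu> (\<lambda>x. pd i (pd j (loglik f x)) \<theta> * pd k (loglik f x) \<theta> * f x \<theta>)"
    and dui: "\<And>i j. diff_under_integral \<mu> \<Theta> (\<lambda>x \<theta>. pd i (loglik f x) \<theta> * pd j (loglik f x) \<theta> * f x \<theta>)"
    using M \<theta> by (simp_all add: statistical_manifold_def)
  define A where "A i j k = expect \<mu> f \<theta> (\<lambda>x. pd i (pd j (loglik f x)) \<theta> * pd k (loglik f x) \<theta>)" for i j k
  have A_sym: "A i j k = A j i k" for i j k
    unfolding A_def expect_def
  proof (rule Bochner_Integration.integral_cong[OF refl])
    fix x assume x: "x \<in> space \<mu>"
    show "pd i (pd j (loglik f x)) \<theta> * pd k (loglik f x) \<theta> * f x \<theta>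
        = pd j (pd i (loglik f x)) \<theta> * pd k (loglik f x) \<theta> * f x \<theta>"
      using supp[OF x] loglik_smooth(2)[where f = f and x = x, OF U smooth[OF x] _ \<theta>, of i j] \<theta> by auto
  qed
  have dg: "pd c (\<lambda>\<theta>. fisher \<mu> f \<theta> $ a $ b) \<theta> = A c a b + A c b a + skew \<mu> f a b c \<theta>" for a b c
  proof -
    have "pd c (\<lambda>\<theta>. fisher \<mu> f \<theta> $ a $ b) \<theta>
        = pd c (\<lambda>\<theta>. \<integral>x. pd a (loglik f x) \<theta> * pd b (loglik f x) \<theta> * f x \<theta> \<partial>\<mu>) \<theta>"
      by (simp add: fisher_def expect_def)
    also have "\<dots> = (\<integral>x. pd c (\<lambda>\<theta>. pd a (loglik f x) \<theta> * pd b (loglik f x) \<theta> * f x \<theta>) \<theta> \<partial>\<mu>)"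
      using dui[of a b] \<theta> by (simp add: diff_under_integral_def)
    also have "\<dots> = (\<integral>x. pd c (pd a (loglik f x)) \<theta> * pd b (loglik f x) \<theta> * f x \<theta>
        + pd c (pd b (loglik f x)) \<theta> * pd a (loglik f x) \<theta> * f x \<theta>
        + pd a (loglik f x) \<theta> * pd b (loglik f x) \<theta> * pd c (loglik f x) \<theta> * f x \<theta> \<partial>\<mu>)"
    proof (rule Bochner_Integration.integral_cong[OF refl])
      fix x assume x: "x \<in> space \<mu>"
      let ?l = "loglik f x"
      show "pd c (\<lambda>\<theta>. pd a ?l \<theta> * pd b ?l \<theta> * f x \<theta>) \<theta> = pd c (pd a ?l) \<theta> * pd b ?l \<theta> * f x \<theta>
        + pd c (pd b ?l) \<theta> * pd a ?l \<theta> * f x \<theta> + pd a ?l \<theta> * pd b ?l \<theta> * pd c ?l \<theta> * f x \<theta>"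
        using supp[OF x]
      proof
        assume pos: "\<forall>\<theta>\<in>\<Theta>. f x \<theta> > 0"
        have l: "smooth_on \<Theta> (pd a ?l)" "pd a (f x) \<theta> = pd a ?l \<theta> * f x \<theta>" for a
          using pos \<theta> by (auto intro: loglik_smooth(1,3)[where f = f and x = x, OF U smooth[OF x]])
        have d: "pd a ?l differentiable (at \<theta>)" "f x differentiable (at \<theta>)" for a
          using smooth_on_differentiable_at[OF l(1) U \<theta>] smooth_on_differentiable_at[OF smooth[OF x] U \<theta>]
          by blast+
        show ?thesis
          by (simp add: pd_mult d differentiable_mult l(2) algebra_simps)
      next
        \<comment> \<open>off the common support both sides carry the factor \<open>f x \<theta> = 0\<close>, whatever the value of the log-likelihood\<close>
        assume zero: "\<forall>\<theta>\<in>\<Theta>. f x \<theta> = 0"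
        have "pd c (\<lambda>\<theta>. pd a ?l \<theta> * pd b ?l \<theta> * f x \<theta>) \<theta> = pd c (\<lambda>_. 0) \<theta>"
          by (rule pd_cong[OF U \<theta>]) (use zero in simp)
        with zero \<theta> show ?thesis by simp
      qed
    qed
    also have "\<dots> = A c a b + A c b a + skew \<mu> f a b c \<theta>"
      unfolding A_def skew_def expect_def
      by (subst Bochner_Integration.integral_add) (simp_all add: int2 int3)
    finally show ?thesis .
  qed
  have T: "skew \<mu> f j k i \<theta> = skew \<mu> f i j k \<theta>" "skew \<mu> f i k j \<theta> = skew \<mu> f i j k \<theta>"
    by (simp_all add: skew_def mult_ac)
  have "levi_civita (fisher \<mu> f) i j k \<theta> = A i j k + skew \<mu> f i j k \<theta> / 2"
    unfolding levi_civita_def dg T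
    using A_sym[of j i k] A_sym[of k i j] A_sym[of k j i] by simp
  thus ?thesis
    by (simp add: alpha_conn_def A_def diff_divide_distrib left_diff_distrib)
qed

lemma alpha_curv_lower_eq:
  assumes M: "statistical_manifold \<mu> \<Theta> f" and \<theta>: "\<theta> \<in> \<Theta>"
  shows "alpha_curv_lower \<mu> f \<alpha> i j k l \<theta> = statistical_structure.curv_lower \<mu> f \<alpha> i j k l \<theta>"
proof -
  interpret statistical_structure \<Theta> \<mu> f by (rule statistical_manifold_structure[OF M])
  have "curv g (alpha_conn \<mu> f \<alpha>) i j k r \<theta> = curv g (conn \<alpha>) i j k r \<theta>" for r
    by (rule curv_cong[OF U \<theta>]) (simp add: alpha_conn_levi_civita[OF M] conn_def)
  thus ?thesis by (simp add: alpha_curv_lower_def curv_lower_def)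
qed

text \<open>
From left to right, conjugate symmetry supplies the antisymmetry of the \<open>-1\<close>-curvature in its last two indices. From
right to left this antisymmetry, and the one in the first two indices, can be read off from the form
of a constant curvature, and duality transfers them to the \<open>1\<close>-curvature.
\<close>

theorem conformally_flat_iff_constant_curvature:
  assumes M: "statistical_manifold \<mu> \<Theta> f"
  shows "conjugate_m_symmetric \<mu> \<Theta> f \<and> conformally_m_flat \<mu> \<Theta> f \<longleftrightarrow> const_m_curvature \<mu> \<Theta> f"
proof -
  interpret statistical_structure \<Theta> \<mu> f by (rule statistical_manifold_structure[OF M])
  note R = alpha_curv_lower_eq[OF M]
  have const: "const_m_curvature \<mu> \<Theta> f \<longleftrightarrow> (\<exists>c. \<forall>\<theta>\<in>\<Theta>. constant_curvature_at c \<theta>)"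
    by (simp add: const_m_curvature_def constant_curvature_at_def R)
  show ?thesis
  proof
    assume L: "conjugate_m_symmetric \<mu> \<Theta> f \<and> conformally_m_flat \<mu> \<Theta> f"
    have "\<Theta> homeomorphic (UNIV :: (real^'b) set)" using M by (simp add: statistical_manifold_def)
    hence conn: "connected \<Theta>" using homeomorphic_connectedness connected_UNIV by blast
    show "const_m_curvature \<mu> \<Theta> f"
      unfolding const
    proof (rule locally_flat_imp_constant_curvature[OF conn])
      show "\<exists>V. open V \<and> \<theta> \<in> V \<and> V \<subseteq> \<Theta> \<and> conformally_m_flat_on \<mu> V f" if "\<theta> \<in> \<Theta>" for \<theta>
        using L that by (simp add: conformally_m_flat_def)
      fix \<theta> i j k l assume \<theta>: "\<theta> \<in> \<Theta>"
      have "alpha_curv_lower \<mu> f (-1) i j k l \<theta> = - alpha_curv_lower \<mu> f (-1) i j l k \<theta>"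
        using L \<theta> unfolding conjugate_m_symmetric_def by blast
      thus "curv_lower (-1) i j k l \<theta> = - curv_lower (-1) i j l k \<theta>" by (simp only: R[OF \<theta>])
    qed
  next
    assume "const_m_curvature \<mu> \<Theta> f"
    then obtain c where c: "\<And>\<theta>. \<theta> \<in> \<Theta> \<Longrightarrow> constant_curvature_at c \<theta>" unfolding const by blast
    have "conjugate_m_symmetric \<mu> \<Theta> f"
      unfolding conjugate_m_symmetric_def
    proof (intro ballI allI)
      fix \<theta> i j k l assume \<theta>: "\<theta> \<in> \<Theta>"
      have dual: "curv_lower 1 i j k l \<theta> = - curv_lower (-1) i j l k \<theta>"
        using curv_lower_dual[OF \<theta>, of "-1" i j k l] by simp
      show "alpha_curv_lower \<mu> f (-1) i j k l \<theta> = - alpha_curv_lower \<mu> f (-1) i j l k \<theta>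
        \<and> - alpha_curv_lower \<mu> f (-1) i j l k \<theta> = alpha_curv_lower \<mu> f 1 i j k l \<theta>
        \<and> alpha_curv_lower \<mu> f 1 i j k l \<theta> = alpha_curv_lower \<mu> f (-1) j i l k \<theta>"
        unfolding R[OF \<theta>] dual c[OF \<theta>, unfolded constant_curvature_at_def, rule_format]
        by (simp add: algebra_simps)
    qed
    moreover have "conformally_m_flat \<mu> \<Theta> f"
      unfolding conformally_m_flat_def
    proof
      fix \<theta> assume \<theta>: "\<theta> \<in> \<Theta>"
      show "\<exists>V. open V \<and> \<theta> \<in> V \<and> V \<subseteq> \<Theta> \<and> conformally_m_flat_on \<mu> V f"
      proof (rule constant_curvature_imp_locally_flat[OF _ \<theta>])
        show "constant_curvature_at c x" if "x \<in> \<Theta>" for x by (rule c[OF that])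
      qed
    qed
    ultimately show "conjugate_m_symmetric \<mu> \<Theta> f \<and> conformally_m_flat \<mu> \<Theta> f" ..
  qed
qed

section \<open>Exponential families\<close>

lemma abs_exp_minus_one_le: "\<bar>exp a - 1\<bar> \<le> \<bar>a\<bar> * exp \<bar>a\<bar>" for a :: real
proof (cases "a \<ge> 0")
  case True
  have "(1 - a) * exp a \<le> exp (- a) * exp a"
    using exp_ge_add_one_self[of "- a"] by (intro mult_right_mono) auto
  with True show ?thesis by (simp add: exp_minus algebra_simps)
next
  case False
  have "\<bar>a\<bar> * 1 \<le> \<bar>a\<bar> * exp \<bar>a\<bar>" by (intro mult_left_mono) auto
  moreover have "\<bar>exp a - 1\<bar> = 1 - exp a" using False by simp
  moreover have "1 - exp a \<le> \<bar>a\<bar>" using False exp_ge_add_one_self[of a] by linarith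
  ultimately show ?thesis by linarith
qed

text \<open>
Differentiation of a Laplace transform at an interior point of its domain, by dominated
convergence. The difference quotients are dominated by an integrable function because
\<open>\<bar>(e\<^sup>s\<^sup>u - 1)/s\<bar> \<le> \<bar>u\<bar> * e\<^sup>\<bar>\<^sup>s\<^sup>u\<^sup>\<bar>\<close>, and for \<open>\<bar>s\<bar> \<le> \<delta>/2\<close> one half of the exponent \<open>\<delta> * \<bar>u\<bar>\<close> pays for the
exponential and the other half for the factor \<open>\<bar>u\<bar>\<close>.
\<close>

lemma exponential_tilt_derivative:
  fixes k u :: "'a \<Rightarrow> real"
  assumes meas [measurable]: "k \<in> borel_measurable M" "u \<in> borel_measurable M" and \<delta>: "\<delta> > 0"
    and int: "\<And>s. \<bar>s\<bar> \<le> \<delta> \<Longrightarrow> integrable M (\<lambda>x. k x * exp (s * u x))"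
  shows "integrable M (\<lambda>x. k x * u x)"
    and "((\<lambda>s. \<integral>x. k x * exp (s * u x) \<partial>M) has_real_derivative (\<integral>x. k x * u x \<partial>M)) (at 0)"
proof -
  \<comment> \<open>the bound \<open>(2/\<delta>) * e\<close> to the power \<open>\<delta> * \<bar>u\<bar>\<close>, with the absolute value replaced by a sum over both signs, as the integrability hypothesis supplies them\<close>
  define w where "w x = (2 / \<delta>) * (\<bar>k x * exp (\<delta> * u x)\<bar> + \<bar>k x * exp (- \<delta> * u x)\<bar>)" for x
  have w: "integrable M w"
    unfolding w_def using int[of \<delta>] int[of "- \<delta>"] \<delta>
    by (intro integrable_mult_right Bochner_Integration.integrable_add integrable_abs) simp_all
  have bound: "\<bar>k x * ((exp (s * u x) - 1) / s)\<bar> \<le> w x" if s: "s \<noteq> 0" "\<bar>s\<bar> \<le> \<delta> / 2" for s x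
  proof -
    have 1: "\<bar>u x\<bar> \<le> (2 / \<delta>) * exp (\<delta> / 2 * \<bar>u x\<bar>)"
    proof -
      have "\<delta> / 2 * \<bar>u x\<bar> \<le> exp (\<delta> / 2 * \<bar>u x\<bar>)"
        using exp_ge_add_one_self[of "\<delta> / 2 * \<bar>u x\<bar>"] by linarith
      thus ?thesis using \<delta> by (simp add: field_simps)
    qed
    have "\<bar>exp (s * u x) - 1\<bar> \<le> \<bar>s\<bar> * (\<bar>u x\<bar> * exp (\<bar>s\<bar> * \<bar>u x\<bar>))"
      using abs_exp_minus_one_le[of "s * u x"] by (simp add: abs_mult mult.assoc)
    hence "\<bar>(exp (s * u x) - 1) / s\<bar> \<le> \<bar>u x\<bar> * exp (\<bar>s\<bar> * \<bar>u x\<bar>)"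
      using s(1) by (simp add: field_simps)
    also have "\<dots> \<le> ((2 / \<delta>) * exp (\<delta> / 2 * \<bar>u x\<bar>)) * exp (\<delta> / 2 * \<bar>u x\<bar>)"
    proof (rule mult_mono[OF 1])
      have "\<bar>s\<bar> * \<bar>u x\<bar> \<le> \<delta> / 2 * \<bar>u x\<bar>" using s(2) by (rule mult_right_mono) simp
      thus "exp (\<bar>s\<bar> * \<bar>u x\<bar>) \<le> exp (\<delta> / 2 * \<bar>u x\<bar>)" by simp
    qed (use \<delta> in auto)
    also have "\<dots> = (2 / \<delta>) * exp (\<delta> * \<bar>u x\<bar>)"
      by (simp add: exp_add[symmetric] algebra_simps)
    also have "exp (\<delta> * \<bar>u x\<bar>) \<le> exp (\<delta> * u x) + exp (- \<delta> * u x)"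
      by (cases "u x \<ge> 0") (simp_all add: abs_if)
    finally have "\<bar>(exp (s * u x) - 1) / s\<bar> \<le> (2 / \<delta>) * (exp (\<delta> * u x) + exp (- \<delta> * u x))"
      using \<delta> by (simp add: mult_left_mono divide_right_mono)
    hence "\<bar>k x\<bar> * \<bar>(exp (s * u x) - 1) / s\<bar> \<le> \<bar>k x\<bar> * ((2 / \<delta>) * (exp (\<delta> * u x) + exp (- \<delta> * u x)))"
      by (intro mult_left_mono) auto
    also have "\<dots> = w x" by (simp add: w_def abs_mult algebra_simps)
    finally show ?thesis by (simp only: abs_mult)
  qed
  have lim: "integrable M (\<lambda>x. k x * u x) \<and>
      (\<lambda>n. \<integral>x. k x * ((exp (X n * u x) - 1) / X n) \<partial>M) \<longlonglongrightarrow> (\<integral>x. k x * u x \<partial>M)"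
    if X: "\<And>n. X n \<noteq> 0" "\<And>n. \<bar>X n\<bar> \<le> \<delta> / 2" "X \<longlonglongrightarrow> 0" for X
  proof -
    have ptw: "(\<lambda>n. k x * ((exp (X n * u x) - 1) / X n)) \<longlonglongrightarrow> k x * u x" for x
    proof -
      have "((\<lambda>s. exp (s * u x)) has_real_derivative u x) (at 0)"
        by (auto intro!: derivative_eq_intros)
      hence "((\<lambda>s. (exp (s * u x) - 1) / s) \<longlongrightarrow> u x) (at 0)"
        by (simp add: DERIV_def)
      hence "(\<lambda>n. (exp (X n * u x) - 1) / X n) \<longlonglongrightarrow> u x"
        by (rule filterlim_compose) (use X in \<open>auto simp: filterlim_at\<close>)
      thus ?thesis by (rule tendsto_mult_left)
    qed
    show ?thesis
    proof
      show "integrable M (\<lambda>x. k x * u x)"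
        by (rule integrable_dominated_convergence[OF _ _ w AE_I2[OF ptw]])
          (use bound X in auto)
      show "(\<lambda>n. \<integral>x. k x * ((exp (X n * u x) - 1) / X n) \<partial>M) \<longlonglongrightarrow> (\<integral>x. k x * u x \<partial>M)"
        by (rule integral_dominated_convergence[OF _ _ w AE_I2[OF ptw]])
          (use bound X in auto)
    qed
  qed
  have "(\<lambda>n. (\<delta> / 2) * inverse (real (Suc n))) \<longlonglongrightarrow> 0"
    by (rule tendsto_mult_right_zero[OF LIMSEQ_inverse_real_of_nat])
  moreover have "\<bar>(\<delta> / 2) * inverse (real (Suc n))\<bar> \<le> \<delta> / 2" for n
    using \<delta> by (simp add: abs_mult field_simps)
  ultimately show "integrable M (\<lambda>x. k x * u x)"
    using lim[of "\<lambda>n. (\<delta> / 2) * inverse (real (Suc n))"] \<delta> by simp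
  define F where "F s = (\<integral>x. k x * exp (s * u x) \<partial>M)" for s
  have quotient: "(F s - F 0) / s = (\<integral>x. k x * ((exp (s * u x) - 1) / s) \<partial>M)"
    if "\<bar>s\<bar> \<le> \<delta> / 2" for s
  proof -
    have "F s - F 0 = (\<integral>x. k x * exp (s * u x) - k x * exp (0 * u x) \<partial>M)"
      unfolding F_def using that \<delta> by (intro Bochner_Integration.integral_diff[symmetric] int) auto
    hence "(F s - F 0) / s = (\<integral>x. (k x * exp (s * u x) - k x * exp (0 * u x)) / s \<partial>M)" by simp
    thus ?thesis by (simp add: right_diff_distrib diff_divide_distrib)
  qed
  have "((\<lambda>s. (F s - F 0) / s) \<longlongrightarrow> (\<integral>x. k x * u x \<partial>M)) (at 0 within {- (\<delta>/2)<..<\<delta>/2})"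
    unfolding tendsto_at_iff_sequentially comp_def
  proof (intro allI impI)
    fix X :: "nat \<Rightarrow> real"
    assume X: "\<forall>i. X i \<in> {- (\<delta>/2)<..<\<delta>/2} - {0}" "X \<longlonglongrightarrow> 0"
    have X': "X n \<noteq> 0" "\<bar>X n\<bar> \<le> \<delta> / 2" for n
      using X(1)[rule_format, of n] by auto
    show "(\<lambda>n. (F (X n) - F 0) / X n) \<longlonglongrightarrow> (\<integral>x. k x * u x \<partial>M)"
      unfolding quotient[OF X'(2)] using lim[OF X' X(2)] by blast
  qed
  hence "((\<lambda>s. (F s - F 0) / s) \<longlongrightarrow> (\<integral>x. k x * u x \<partial>M)) (at 0)"
    using \<delta> by (subst (asm) at_within_open) auto
  thus "((\<lambda>s. \<integral>x. k x * exp (s * u x) \<partial>M) has_real_derivative (\<integral>x. k x * u x \<partial>M)) (at 0)"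
    by (simp add: DERIV_def F_def)
qed

text \<open>
The moment with weight \<open>H x\<close> determines the one with weight \<open>H x * x\<^sub>i\<close>. The value \<open>F\<close> of the former is
assumed differentiable, so only a derivative in one real variable has to be taken under
the integral. For an exponential family this assumption is free, since all moments are expressed
by the smooth function \<open>\<psi>\<close>.
\<close>

lemma exponential_moment_pd:
  fixes \<rho> :: "(real^'n::finite) measure" and H :: "real^'n \<Rightarrow> real"
  assumes \<rho>: "sets \<rho> = sets borel" and \<Xi>: "open \<Xi>" "\<theta> \<in> \<Xi>" and H: "H \<in> borel_measurable \<rho>"
    and int: "\<And>\<theta>. \<theta> \<in> \<Xi> \<Longrightarrow> has_bochner_integral \<rho> (\<lambda>x. H x * exp (\<theta> \<bullet> x)) (F \<theta>)"
    and F: "F differentiable (at \<theta>)"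
  shows "has_bochner_integral \<rho> (\<lambda>x. (H x * x $ i) * exp (\<theta> \<bullet> x)) (pd i F \<theta>)"
proof -
  define p where "p s = \<theta> + s *\<^sub>R axis i (1::real)" for s
  obtain e where e: "e > 0" "ball \<theta> e \<subseteq> \<Xi>" using \<Xi> open_contains_ball by blast
  have p_in: "p s \<in> \<Xi>" if "\<bar>s\<bar> \<le> e / 2" for s
    using that e by (auto simp: p_def dist_norm intro!: subsetD[OF e(2)])
  have p_inner: "p s \<bullet> x = \<theta> \<bullet> x + s * x $ i" for s and x :: "real^'n"
    by (simp add: p_def inner_add_left inner_axis' )
  have tilt: "H x * exp (p s \<bullet> x) = (H x * exp (\<theta> \<bullet> x)) * exp (s * x $ i)" for s x
    by (simp add: p_inner exp_add)
  have meas: "(\<lambda>x. H x * exp (\<theta> \<bullet> x)) \<in> borel_measurable \<rho>" "(\<lambda>x. x $ i) \<in> borel_measurable \<rho>"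
    using borel_measurable_integrable[OF integrable.intros[OF int[OF \<Xi>(2)]]]
    by (simp_all add: measurable_cong_sets[OF \<rho> refl])
  have int': "integrable \<rho> (\<lambda>x. (H x * exp (\<theta> \<bullet> x)) * exp (s * x $ i))" if "\<bar>s\<bar> \<le> e / 2" for s
    using integrable.intros[OF int[OF p_in[OF that]]] by (simp only: tilt)
  note deriv = exponential_tilt_derivative[OF meas, of "e / 2", OF _ int']
  have "((\<lambda>s. F (p s)) has_real_derivative pd i F \<theta>) (at 0)"
  proof -
    have "(p has_derivative (\<lambda>s. s *\<^sub>R axis i 1)) (at 0)"
      unfolding p_def by (auto intro!: derivative_eq_intros)
    moreover have "(F has_derivative frechet_derivative F (at \<theta>)) (at (p 0))"
      using F by (simp add: p_def frechet_derivative_works)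
    ultimately have "((\<lambda>s. F (p s)) has_derivative (\<lambda>s. frechet_derivative F (at \<theta>) (s *\<^sub>R axis i 1))) (at 0)"
      by (rule has_derivative_compose)
    thus ?thesis
      by (rule has_derivative_imp_has_field_derivative)
        (simp add: pd_def linear_cmul[OF linear_frechet_derivative[OF F]])
  qed
  moreover have "((\<lambda>s. F (p s)) has_real_derivative (\<integral>x. (H x * exp (\<theta> \<bullet> x)) * x $ i \<partial>\<rho>)) (at 0)"
  proof (rule DERIV_cong_ev[OF refl _ refl, THEN iffD1])
    show "((\<lambda>s. \<integral>x. (H x * exp (\<theta> \<bullet> x)) * exp (s * x $ i) \<partial>\<rho>) has_real_derivative
        (\<integral>x. (H x * exp (\<theta> \<bullet> x)) * x $ i \<partial>\<rho>)) (at 0)"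
      using e by (intro deriv(2)) auto
    have "(\<integral>x. (H x * exp (\<theta> \<bullet> x)) * exp (s * x $ i) \<partial>\<rho>) = F (p s)" if "\<bar>s\<bar> \<le> e / 2" for s
      using has_bochner_integral_integral_eq[OF int[OF p_in[OF that]]] by (simp only: tilt)
    thus "\<forall>\<^sub>F s in nhds 0. (\<integral>x. (H x * exp (\<theta> \<bullet> x)) * exp (s * x $ i) \<partial>\<rho>) = F (p s)"
      unfolding eventually_nhds_metric using e by (auto intro!: exI[of _ "e/2"])
  qed
  ultimately have "pd i F \<theta> = (\<integral>x. (H x * exp (\<theta> \<bullet> x)) * x $ i \<partial>\<rho>)" by (rule DERIV_unique)
  moreover have "integrable \<rho> (\<lambda>x. (H x * exp (\<theta> \<bullet> x)) * x $ i)" using e by (intro deriv(1)) auto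
  ultimately have "has_bochner_integral \<rho> (\<lambda>x. (H x * exp (\<theta> \<bullet> x)) * x $ i) (pd i F \<theta>)"
    by (simp add: has_bochner_integral_iff)
  thus ?thesis by (simp only: mult_ac)
qed

context
  fixes \<rho> :: "(real^'n::finite) measure" and \<Xi> :: "(real^'n) set" and \<psi> :: "real^'n \<Rightarrow> real"
  assumes frm: "frm_exponential_family \<rho> \<Xi> \<psi>"
begin

lemma family_open: "open \<Xi>" and psi_smooth: "smooth_on \<Xi> \<psi>" and rho_borel: "sets \<rho> = sets borel"
  using frm unfolding frm_exponential_family_def by blast+

lemma psi_differentiable:
  assumes "\<theta> \<in> \<Xi>"
  shows "\<psi> differentiable (at \<theta>)" "pd i \<psi> differentiable (at \<theta>)"
    "pd j (pd i \<psi>) differentiable (at \<theta>)" "(\<lambda>x. exp (\<psi> x)) differentiable (at \<theta>)"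
    "pd i (\<lambda>x. exp (\<psi> x)) \<theta> = pd i \<psi> \<theta> * exp (\<psi> \<theta>)"
proof -
  show d: "\<psi> differentiable (at \<theta>)"
    by (rule smooth_on_differentiable_at[OF psi_smooth family_open assms])
  show "pd i \<psi> differentiable (at \<theta>)"
    by (rule smooth_on_differentiable_at[OF smooth_on_pd[OF psi_smooth] family_open assms])
  show "pd j (pd i \<psi>) differentiable (at \<theta>)"
    by (rule smooth_on_differentiable_at[OF smooth_on_pd[OF smooth_on_pd[OF psi_smooth]] family_open assms])
  show "(\<lambda>x. exp (\<psi> x)) differentiable (at \<theta>)" "pd i (\<lambda>x. exp (\<psi> x)) \<theta> = pd i \<psi> \<theta> * exp (\<psi> \<theta>)"
    using pd_chain[OF d DERIV_exp] by (simp_all add: mult.commute)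
qed

text \<open>
Differentiate \<open>\<integral> e\<^sup>\<theta>\<^sup>x = e\<^sup>\<psi>\<close> three times. The factor 1 in the integrands is the weight of the zeroth
moment, from which the others are generated.
\<close>

lemma moments:
  assumes \<theta>: "\<theta> \<in> \<Xi>"
  shows "has_bochner_integral \<rho> (\<lambda>x. 1 * exp (\<theta> \<bullet> x)) (exp (\<psi> \<theta>))"
    and "has_bochner_integral \<rho> (\<lambda>x. (1 * x $ i) * exp (\<theta> \<bullet> x)) (pd i \<psi> \<theta> * exp (\<psi> \<theta>))"
    and "has_bochner_integral \<rho> (\<lambda>x. (1 * x $ i * x $ j) * exp (\<theta> \<bullet> x))
          ((pd j (pd i \<psi>) \<theta> + pd i \<psi> \<theta> * pd j \<psi> \<theta>) * exp (\<psi> \<theta>))"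
    and "has_bochner_integral \<rho> (\<lambda>x. (1 * x $ i * x $ j * x $ k) * exp (\<theta> \<bullet> x))
          ((pd k (pd j (pd i \<psi>)) \<theta> + pd k (pd i \<psi>) \<theta> * pd j \<psi> \<theta> + pd i \<psi> \<theta> * pd k (pd j \<psi>) \<theta>
            + (pd j (pd i \<psi>) \<theta> + pd i \<psi> \<theta> * pd j \<psi> \<theta>) * pd k \<psi> \<theta>) * exp (\<psi> \<theta>))"
proof -
  note d = psi_differentiable
  have x: "(\<lambda>x. x $ i) \<in> borel_measurable \<rho>" for i
    by (simp add: measurable_cong_sets[OF rho_borel refl])
  have m: "(\<lambda>_. 1) \<in> borel_measurable \<rho>" "(\<lambda>x. 1 * x $ i) \<in> borel_measurable \<rho>"
    "(\<lambda>x. 1 * x $ i * x $ j) \<in> borel_measurable \<rho>" for i j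
    by (intro borel_measurable_times borel_measurable_const x)+
  have m0: "has_bochner_integral \<rho> (\<lambda>x. 1 * exp (\<theta> \<bullet> x)) (exp (\<psi> \<theta>))" if "\<theta> \<in> \<Xi>" for \<theta>
  proof -
    have "has_bochner_integral \<rho> (\<lambda>x. exp_density \<psi> x 1 \<theta>) 1"
      using frm that by (simp add: frm_exponential_family_def)
    hence "has_bochner_integral \<rho> (\<lambda>x. exp (\<psi> \<theta>) * exp_density \<psi> x 1 \<theta>) (exp (\<psi> \<theta>) * 1)"
      by (intro has_bochner_integral_mult_right)
    thus ?thesis by (simp add: exp_density_def exp_diff)
  qed
  have m1: "has_bochner_integral \<rho> (\<lambda>x. (1 * x $ i) * exp (\<theta> \<bullet> x)) (pd i \<psi> \<theta> * exp (\<psi> \<theta>))"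
    if "\<theta> \<in> \<Xi>" for \<theta> i
    using exponential_moment_pd[OF rho_borel family_open that m(1) m0 d(4)[OF that], of i] d(5)[OF that]
    by simp
  have m2: "has_bochner_integral \<rho> (\<lambda>x. (1 * x $ i * x $ j) * exp (\<theta> \<bullet> x))
          ((pd j (pd i \<psi>) \<theta> + pd i \<psi> \<theta> * pd j \<psi> \<theta>) * exp (\<psi> \<theta>))" if "\<theta> \<in> \<Xi>" for \<theta> i j
  proof -
    have "(\<lambda>x. pd i \<psi> x * exp (\<psi> x)) differentiable (at \<theta>)"
      by (intro differentiable_mult d that)
    from exponential_moment_pd[OF rho_borel family_open that m(2) m1 this, of j]
    show ?thesis by (simp add: pd_mult d[OF that] algebra_simps)
  qed
  have m3: "has_bochner_integral \<rho> (\<lambda>x. (1 * x $ i * x $ j * x $ k) * exp (\<theta> \<bullet> x))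
          ((pd k (pd j (pd i \<psi>)) \<theta> + pd k (pd i \<psi>) \<theta> * pd j \<psi> \<theta> + pd i \<psi> \<theta> * pd k (pd j \<psi>) \<theta>
            + (pd j (pd i \<psi>) \<theta> + pd i \<psi> \<theta> * pd j \<psi> \<theta>) * pd k \<psi> \<theta>) * exp (\<psi> \<theta>))"
    if "\<theta> \<in> \<Xi>" for \<theta> i j k
  proof -
    have "(\<lambda>x. (pd j (pd i \<psi>) x + pd i \<psi> x * pd j \<psi> x) * exp (\<psi> x)) differentiable (at \<theta>)"
      by (intro differentiable_mult differentiable_add d that)
    from exponential_moment_pd[OF rho_borel family_open that m(3) m2 this, of k]
    show ?thesis
      by (simp add: pd_mult pd_add differentiable_mult differentiable_add d[OF that] algebra_simps)
  qed
  show "has_bochner_integral \<rho> (\<lambda>x. 1 * exp (\<theta> \<bullet> x)) (exp (\<psi> \<theta>))"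
    "has_bochner_integral \<rho> (\<lambda>x. (1 * x $ i) * exp (\<theta> \<bullet> x)) (pd i \<psi> \<theta> * exp (\<psi> \<theta>))"
    "has_bochner_integral \<rho> (\<lambda>x. (1 * x $ i * x $ j) * exp (\<theta> \<bullet> x))
          ((pd j (pd i \<psi>) \<theta> + pd i \<psi> \<theta> * pd j \<psi> \<theta>) * exp (\<psi> \<theta>))"
    "has_bochner_integral \<rho> (\<lambda>x. (1 * x $ i * x $ j * x $ k) * exp (\<theta> \<bullet> x))
          ((pd k (pd j (pd i \<psi>)) \<theta> + pd k (pd i \<psi>) \<theta> * pd j \<psi> \<theta> + pd i \<psi> \<theta> * pd k (pd j \<psi>) \<theta>
            + (pd j (pd i \<psi>) \<theta> + pd i \<psi> \<theta> * pd j \<psi> \<theta>) * pd k \<psi> \<theta>) * exp (\<psi> \<theta>))"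
    by (rule m0[OF \<theta>] m1[OF \<theta>] m2[OF \<theta>] m3[OF \<theta>])+
qed

text \<open>
The central moments of order two and three are the derivatives of the same order of \<open>\<psi>\<close>, the
cumulant generating function.
\<close>

lemma central_moments:
  assumes \<theta>: "\<theta> \<in> \<Xi>"
  shows "has_bochner_integral \<rho> (\<lambda>x. (x $ i - pd i \<psi> \<theta>) * (x $ j - pd j \<psi> \<theta>) * exp_density \<psi> x 1 \<theta>)
          (pd j (pd i \<psi>) \<theta>)"
    and "has_bochner_integral \<rho> (\<lambda>x. (x $ i - pd i \<psi> \<theta>) * (x $ j - pd j \<psi> \<theta>) * (x $ k - pd k \<psi> \<theta>)
          * exp_density \<psi> x 1 \<theta>) (pd k (pd j (pd i \<psi>)) \<theta>)"
proof -
  let ?a = "pd i \<psi> \<theta>" and ?b = "pd j \<psi> \<theta>" and ?c = "pd k \<psi> \<theta>" and ?Z = "exp (\<psi> \<theta>)"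
  note m = moments[OF \<theta>]
  have dens: "exp_density \<psi> x 1 \<theta> = inverse ?Z * exp (\<theta> \<bullet> x)" for x
    by (simp add: exp_density_def exp_diff divide_inverse)
  have "has_bochner_integral \<rho> (\<lambda>x. inverse ?Z * ((1 * x $ i * x $ j) * exp (\<theta> \<bullet> x)
        - ?b * ((1 * x $ i) * exp (\<theta> \<bullet> x)) - ?a * ((1 * x $ j) * exp (\<theta> \<bullet> x)) + (?a * ?b) * (1 * exp (\<theta> \<bullet> x))))
      (inverse ?Z * ((pd j (pd i \<psi>) \<theta> + ?a * ?b) * ?Z - ?b * (?a * ?Z) - ?a * (?b * ?Z) + (?a * ?b) * ?Z))"
    by (intro has_bochner_integral_mult_right has_bochner_integral_add has_bochner_integral_diff m)
  thus "has_bochner_integral \<rho> (\<lambda>x. (x $ i - ?a) * (x $ j - ?b) * exp_density \<psi> x 1 \<theta>) (pd j (pd i \<psi>) \<theta>)"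
    by (rule has_bochner_integral_cong[THEN iffD1, rotated -1]) (simp_all add: dens algebra_simps)
  have "has_bochner_integral \<rho> (\<lambda>x. inverse ?Z * ((1 * x $ i * x $ j * x $ k) * exp (\<theta> \<bullet> x)
        - ?c * ((1 * x $ i * x $ j) * exp (\<theta> \<bullet> x)) - ?b * ((1 * x $ i * x $ k) * exp (\<theta> \<bullet> x))
        - ?a * ((1 * x $ j * x $ k) * exp (\<theta> \<bullet> x))
        + (?b * ?c) * ((1 * x $ i) * exp (\<theta> \<bullet> x)) + (?a * ?c) * ((1 * x $ j) * exp (\<theta> \<bullet> x))
        + (?a * ?b) * ((1 * x $ k) * exp (\<theta> \<bullet> x)) - (?a * ?b * ?c) * (1 * exp (\<theta> \<bullet> x))))
      (inverse ?Z * ((pd k (pd j (pd i \<psi>)) \<theta> + pd k (pd i \<psi>) \<theta> * ?b + ?a * pd k (pd j \<psi>) \<theta>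
            + (pd j (pd i \<psi>) \<theta> + ?a * ?b) * ?c) * ?Z
        - ?c * ((pd j (pd i \<psi>) \<theta> + ?a * ?b) * ?Z) - ?b * ((pd k (pd i \<psi>) \<theta> + ?a * ?c) * ?Z)
        - ?a * ((pd k (pd j \<psi>) \<theta> + ?b * ?c) * ?Z)
        + (?b * ?c) * (?a * ?Z) + (?a * ?c) * (?b * ?Z) + (?a * ?b) * (?c * ?Z) - (?a * ?b * ?c) * ?Z))"
    by (intro has_bochner_integral_mult_right has_bochner_integral_add has_bochner_integral_diff m)
  thus "has_bochner_integral \<rho> (\<lambda>x. (x $ i - ?a) * (x $ j - ?b) * (x $ k - ?c) * exp_density \<psi> x 1 \<theta>)
      (pd k (pd j (pd i \<psi>)) \<theta>)"
    by (rule has_bochner_integral_cong[THEN iffD1, rotated -1]) (simp_all add: dens algebra_simps)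
qed

lemma exp_family_tensors:
  defines "f \<equiv> \<lambda>x. exp_density \<psi> x 1"
  assumes \<theta>: "\<theta> \<in> \<Xi>"
  shows "fisher \<rho> f \<theta> $ i $ j = pd j (pd i \<psi>) \<theta>"
    and "skew \<rho> f i j k \<theta> = pd k (pd j (pd i \<psi>)) \<theta>"
proof -
  have score: "pd i (loglik f x) \<theta> = x $ i - pd i \<psi> \<theta>" for i x
  proof -
    have "loglik f x = (\<lambda>\<theta>. \<theta> \<bullet> x - \<psi> \<theta>)" by (simp add: fun_eq_iff loglik_def f_def exp_density_def)
    moreover have "((\<lambda>\<theta>. \<theta> \<bullet> x) has_derivative (\<lambda>v. v \<bullet> x)) (at \<theta>)"
      by (auto intro!: derivative_eq_intros)
    hence "pd i (\<lambda>\<theta>. \<theta> \<bullet> x) \<theta> = x $ i" "(\<lambda>\<theta>. \<theta> \<bullet> x) differentiable (at \<theta>)"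
      by (auto simp: pd_eqI inner_axis' differentiable_def)
    ultimately show ?thesis by (simp add: pd_diff psi_differentiable[OF \<theta>])
  qed
  show "fisher \<rho> f \<theta> $ i $ j = pd j (pd i \<psi>) \<theta>"
    using has_bochner_integral_integral_eq[OF central_moments(1)[OF \<theta>, of i j]]
    by (simp add: fisher_def expect_def score[unfolded f_def] f_def)
  show "skew \<rho> f i j k \<theta> = pd k (pd j (pd i \<psi>)) \<theta>"
    using has_bochner_integral_integral_eq[OF central_moments(2)[OF \<theta>, of i j k]]
    by (simp add: skew_def expect_def score[unfolded f_def] f_def)
qed

text \<open>
A null vector \<open>v\<close> of the covariance matrix makes the variance of \<open>v \<bullet> x\<close> vanish, so \<open>v \<bullet> x\<close> is
constant almost everywhere, which minimality excludes.
\<close>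

lemma exp_family_fisher_invertible:
  assumes \<theta>: "\<theta> \<in> \<Xi>"
  shows "invertible (fisher \<rho> (\<lambda>x. exp_density \<psi> x 1) \<theta>)"
  unfolding invertible_left_inverse matrix_left_invertible_ker
proof (intro allI impI)
  fix v :: "real^'n" assume v: "fisher \<rho> (\<lambda>x. exp_density \<psi> x 1) \<theta> *v v = 0"
  define L where "L x = (\<Sum>i\<in>UNIV. v $ i * (x $ i - pd i \<psi> \<theta>))" for x
  have "has_bochner_integral \<rho> (\<lambda>x. \<Sum>i\<in>UNIV. v $ i * (\<Sum>j\<in>UNIV. v $ j *
        ((x $ i - pd i \<psi> \<theta>) * (x $ j - pd j \<psi> \<theta>) * exp_density \<psi> x 1 \<theta>)))
      (\<Sum>i\<in>UNIV. v $ i * (\<Sum>j\<in>UNIV. v $ j * pd j (pd i \<psi>) \<theta>))"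
    by (intro has_bochner_integral_sum has_bochner_integral_mult_right central_moments \<theta>)
  moreover have "(\<Sum>j\<in>UNIV. v $ j * pd j (pd i \<psi>) \<theta>) = 0" for i
  proof -
    have "(fisher \<rho> (\<lambda>x. exp_density \<psi> x 1) \<theta> *v v) $ i = 0" by (simp add: v)
    thus ?thesis by (simp add: matrix_vector_mult_def exp_family_tensors[OF \<theta>] mult.commute)
  qed
  moreover have "(\<Sum>i\<in>UNIV. v $ i * (\<Sum>j\<in>UNIV. v $ j *
        ((x $ i - pd i \<psi> \<theta>) * (x $ j - pd j \<psi> \<theta>) * exp_density \<psi> x 1 \<theta>)))
      = L x * L x * exp_density \<psi> x 1 \<theta>" for x
    unfolding L_def sum_product sum_distrib_left sum_distrib_right
    by (intro sum.cong refl) (simp add: mult_ac)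
  ultimately have "has_bochner_integral \<rho> (\<lambda>x. L x * L x * exp_density \<psi> x 1 \<theta>) 0" by simp
  hence "integrable \<rho> (\<lambda>x. L x * L x * exp_density \<psi> x 1 \<theta>)"
    "integral\<^sup>L \<rho> (\<lambda>x. L x * L x * exp_density \<psi> x 1 \<theta>) = 0"
    by (simp_all add: has_bochner_integral_iff)
  hence "AE x in \<rho>. L x * L x * exp_density \<psi> x 1 \<theta> = 0"
    by (subst (asm) integral_nonneg_eq_0_iff_AE) (auto simp: exp_density_def)
  hence "AE x in \<rho>. v \<bullet> x = (\<Sum>i\<in>UNIV. v $ i * pd i \<psi> \<theta>)"
  proof (rule AE_mp, intro AE_I2 impI)
    fix x assume "L x * L x * exp_density \<psi> x 1 \<theta> = 0"
    hence "L x = 0" by (simp add: exp_density_def)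
    thus "v \<bullet> x = (\<Sum>i\<in>UNIV. v $ i * pd i \<psi> \<theta>)"
      by (simp add: L_def right_diff_distrib sum_subtractf inner_vec_def)
  qed
  thus "v = 0" using frm unfolding frm_exponential_family_def by blast
qed

text \<open>
In natural parameters \<open>T\<^sub>i\<^sub>j\<^sub>k = \<partial>\<^sub>k g\<^sub>i\<^sub>j\<close>, both being third derivatives of \<open>\<psi>\<close>. So the coefficients of
the \<open>1\<close>-connection vanish, by duality the \<open>-1\<close>-connection is flat as well, and the constant gauge
works.
\<close>

theorem exp_family_flat: "conformally_m_flat_on \<rho> \<Xi> (\<lambda>x. exp_density \<psi> x 1)"
proof -
  define f where "f = (\<lambda>x. exp_density \<psi> x 1)"
  note tensors = exp_family_tensors[folded f_def]
  have sm: "smooth_on \<Xi> (\<lambda>\<theta>. fisher \<rho> f \<theta> $ i $ j)" for i j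
    by (subst smooth_on_cong[OF family_open tensors(1)], assumption) (intro smooth_on_pd psi_smooth)
  have sm': "smooth_on \<Xi> (skew \<rho> f i j k)" for i j k
    by (subst smooth_on_cong[OF family_open tensors(2)], assumption) (intro smooth_on_pd psi_smooth)
  interpret statistical_structure \<Xi> \<rho> f
    by unfold_locales
      (auto simp: family_open sm sm' exp_family_fisher_invertible[folded f_def])
  have T: "pd k (\<lambda>x. g x $ i $ j) \<theta> = T i j k \<theta>" if \<theta>: "\<theta> \<in> \<Xi>" for i j k \<theta>
    unfolding tensors(2)[OF \<theta>] by (rule pd_cong[OF family_open \<theta> tensors(1)])
  have conn0: "conn 1 i j k \<theta> = 0" if "\<theta> \<in> \<Xi>" for i j k \<theta>
  proof -
    have "T j k i \<theta> = T i j k \<theta>" "T i k j \<theta> = T i j k \<theta>"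
      by (simp_all add: skew_def mult_ac)
    thus ?thesis unfolding conn_def levi_civita_def T[OF that] by simp
  qed
  have curv: "curv g (conn (-1)) i j k l \<theta> = 0" if \<theta>: "\<theta> \<in> \<Xi>" for i j k l \<theta>
  proof -
    have pd0: "pd i (conn 1 j k l) \<theta> = 0" for i j k l
      by (subst pd_cong[OF family_open \<theta> conn0]) simp_all
    have "curv_lower 1 i j k l \<theta> = 0" for i j k l
      unfolding curv_lower_eq[OF \<theta>] pd0 by (simp add: raise_conn_def conn0[OF \<theta>])
    hence "curv_lower (-1) i j k l \<theta> = 0" for i j k l
      using curv_lower_dual[OF \<theta>, of 1 i j k l] by simp
    thus ?thesis by (simp add: curv_eq_raised_lower[OF \<theta>])
  qed
  have one: "gauge_function \<Xi> (\<lambda>_. 1)" by (simp add: gauge_function_def smooth_on_const)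
  have "curv (conf_metric \<rho> f (\<lambda>_. 1)) (conf_conn \<rho> f (\<lambda>_. 1) (-1)) i j k l \<theta> = 0"
    if \<theta>: "\<theta> \<in> \<Xi>" for i j k l \<theta>
  proof -
    have zero: "pd a (\<lambda>x. ln 1) = (\<lambda>_. 0)" for a :: 'n by (rule ext) simp
    show ?thesis
      unfolding curv_conformal[OF family_open subset_refl \<theta> one] curv[OF \<theta>] zero by simp
  qed
  thus ?thesis
    unfolding conformally_m_flat_on_def f_def by (intro exI[of _ "\<lambda>_. 1"] conjI one ballI allI)
qed

end

theorem theorem3p2:
  fixes \<mu> :: "'x measure" and \<Theta> :: "(real^'m::finite) set" and f :: "'x \<Rightarrow> real^'m \<Rightarrow> real"
    and \<rho> :: "(real^'n::finite) measure" and \<Xi> :: "(real^'n) set" and \<psi> :: "real^'n \<Rightarrow> real"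
  shows "(statistical_manifold \<mu> \<Theta> f \<longrightarrow>
            (conjugate_m_symmetric \<mu> \<Theta> f \<and> conformally_m_flat \<mu> \<Theta> f
               \<longleftrightarrow> const_m_curvature \<mu> \<Theta> f))
       \<and> (frm_exponential_family \<rho> \<Xi> \<psi> \<longrightarrow>
            conformally_m_flat_on \<rho> \<Xi> (\<lambda>x. exp_density \<psi> x 1))"
  using conformally_flat_iff_constant_curvature[of \<mu> \<Theta> f] exp_family_flat[of \<rho> \<Xi> \<psi>] by blast

end
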